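(* Assume that all the perturbing Laurent polynomials are prepared, i.e. for $a\in\{1,2\}$ and $\rho\in\{\Gamma,\mathfrak C\}$, $L^{(a)}_\rho(z)=L^{(a)}_{\rho,N_\rho}z^{N_\rho}+\dots+L^{(a)}_{\rho,-N_\rho}z^{-N_\rho}$ with $L^{(a)}_{\rho,N_\rho}L^{(a)}_{\rho,-N_\rho}\neq0$, $N_\rho\in\{1,2,\dots\}$. For $k\ge 0$ define the row vectors of length $2N_\Gamma+2N_{\mathfrak C}$ $$A^{(2,1)}_k:=\Big[\mathcal J^{\overline{L^{(2)}_\Gamma}}_{C_{1,k}}-\langle\xi^{(2)},\phi_{1,k}\rangle\mathcal L^{(2)},\ \mathcal J^{L^{(1)}_{\mathfrak C}}_{\phi_{1,k}}\Big],\qquad A^{(1,2)}_k:=\Big[\mathcal J^{\overline{L^{(1)}_\Gamma}}_{C_{2,k}}-\langle\xi^{(1)},\phi_{2,k}\rangle\mathcal L^{(1)},\ \mathcal J^{L^{(2)}_{\mathfrak C}}_{\phi_{2,k}}\Big],$$ and, for $l\ge 2N_\Gamma$, let $\tilde\tau^{(2,1)}_l$ (resp. $\tilde\tau^{(1,2)}_l$) be the determinant of the square matrix with rows $A^{(2,1)}_k$ (resp. $A^{(1,2)}_k$), $k=l-2N_\Gamma,\dots,l+2N_{\mathfrak C}-1$, in this order. (I) Let $l\ge 2\max(N_\Gamma,N_{\mathfrak C})$ and $\tilde\tau^{(2,1)}_l\ne0$. Then, for $z\in\mathbb C^*$ for which the denominators do not vanish, $$\tilde\phi^{(2,1)}_{1,l}(z)=\frac{L^{(1)}_{\mathfrak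 C,(-1)^lN_{\mathfrak C}}}{L^{(1)}_{\mathfrak C}(z)}\frac1{\tilde\tau^{(2,1)}_l}\begin{vmatrix}A^{(2,1)}_{l-2N_\Gamma}&\phi_{1,l-2N_\Gamma}(z)\\ \vdots&\vdots\\ A^{(2,1)}_{l+2N_{\mathfrak C}}&\phi_{1,l+2N_{\mathfrak C}}(z)\end{vmatrix},$$ $$\tilde H^{(2,1)}_l=\frac{L^{(1)}_{\mathfrak C,(-1)^lN_{\mathfrak C}}}{\overline{L^{(2)}_{\Gamma,(-1)^lN_\Gamma}}}\,H_{l-2N_\Gamma}\,\frac{\tilde\tau^{(2,1)}_{l+1}}{\tilde\tau^{(2,1)}_l},$$ $$\overline{\tilde\phi^{(2,1)}_{2,l}(z)}=-\frac{\overline{L^{(2)}_\Gamma(z)}}{\overline{L^{(2)}_{\Gamma,(-1)^lN_\Gamma}}}\frac{H_{l-2N_\Gamma}}{\tilde\tau^{(2,1)}_l}\begin{vmatrix}A^{(2,1)}_{l-2N_\Gamma+1}\\ \vdots\\ A^{(2,1)}_{l+2N_{\mathfrak C}-1}\\ B^{(2,1)}_l(z)\end{vmatrix},$$ where, with $m:=l-2N_\Gamma+1$, $$B^{(2,1)}_l(z):=\Big[\mathcal J^{\overline{L^{(2)}_\Gamma}}_{K^{[m]}_{C_1}}(\bar z)-\langle(\xi^{(2)})_w,K^{[m]}(\bar z,w)\rangle\mathcal L^{(2)}+\tfrac{1}{\overline{L^{(2)}_\Gamma(z)}}\mathcal J^{\overline{L^{(2)}_\Gamma}}_{\delta\overline{L^{(2)}_\Gamma}}(\bar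 z),\ \mathcal J^{L^{(1)}_{\mathfrak C}}_{K^{[m]}}(\bar z)\Big],$$ all spectral jets in $B^{(2,1)}_l(z)$ being taken with respect to the second variable, the first variable being fixed equal to $\bar z$. (II) Let $l\ge 2\max(N_\Gamma,N_{\mathfrak C})$ and $\tilde\tau^{(1,2)}_l\ne0$. Then, for $z\in\mathbb C^*$ for which the denominators do not vanish, $$\tilde\phi^{(1,2)}_{2,l}(z)=\frac{L^{(2)}_{\mathfrak C,(-1)^lN_{\mathfrak C}}}{L^{(2)}_{\mathfrak C}(z)}\frac1{\tilde\tau^{(1,2)}_l}\begin{vmatrix}A^{(1,2)}_{l-2N_\Gamma}&\phi_{2,l-2N_\Gamma}(z)\\ \vdots&\vdots\\ A^{(1,2)}_{l+2N_{\mathfrak C}}&\phi_{2,l+2N_{\mathfrak C}}(z)\end{vmatrix},$$ $$\overline{\tilde H^{(1,2)}_l}=\frac{L^{(2)}_{\mathfrak C,(-1)^lN_{\mathfrak C}}}{\overline{L^{(1)}_{\Gamma,(-1)^lN_\Gamma}}}\,\overline{H_{l-2N_\Gamma}}\,\frac{\tilde\tau^{(1,2)}_{l+1}}{\tilde\tau^{(1,2)}_l},$$ $$\tilde\phi^{(1,2)}_{1,l}(z)=-\frac{L^{(1)}_\Gamma(z)}{L^{(1)}_{\Gamma,(-1)^lN_\Gamma}}\frac{H_{l-2N_\Gamma}}{\overline{\tilde\tau^{(1,2)}_l}}\begin{vmatrix}\overline{A^{(1,2)}_{l-2N_\Gamma+1}}\\ \vdots\\ \overline{A^{(1,2)}_{l+2N_{\mathfrak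 C}-1}}\\ B^{(1,2)}_l(z)\end{vmatrix},$$ where, with $m:=l-2N_\Gamma+1$, $$B^{(1,2)}_l(z):=\Big[\mathcal J^{L^{(1)}_\Gamma}_{K^{[m]}_{C_2}}(z)-\langle\overline{(\xi^{(1)})_w},K^{[m]}(\bar w,z)\rangle\overline{\mathcal L^{(1)}}+\tfrac1{L^{(1)}_\Gamma(z)}\mathcal J^{L^{(1)}_\Gamma}_{\delta L^{(1)}_\Gamma}(z),\ \mathcal J^{\overline{L^{(2)}_{\mathfrak C}}}_{K^{[m]}}(z)\Big],$$ all spectral jets in $B^{(1,2)}_l(z)$ being taken with respect to the first variable (the first argument of the kernel or of $\delta L^{(1)}_\Gamma$, considered as an independent complex variable), the second variable being fixed equal to $z$; and $\langle\overline{(\xi^{(1)})_w},K^{[m]}(\bar w,z)\rangle:=\sum_{k=0}^{m-1}\overline{\langle\xi^{(1)},\phi_{2,k}\rangle}\,H_k^{-1}\phi_{1,k}(z)$.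
   Context: Conventions: $\mathbb C^*=\mathbb C\setminus\{0\}$; $\dagger$ is conjugate transpose; for a Laurent polynomial $\overline L(z):=\overline{L(\bar z)}$ (conjugated coefficients); $\sigma(L)$ is the zero set of $L$ in $\mathbb C^*$; $f^{(l)}=\partial^l f/\partial z^l$. Functionals: $\mathcal F$ is a space of fundamental (test) functions on $\mathbb C^*$ strictly containing $\mathbb C[z,z^{-1}]$, whose continuous linear functionals have a well-defined support (e.g. $\mathcal F=C^\infty(\mathbb C^* )$, functionals being compactly supported distributions). A functional may be evaluated on functions that are admissible only on a neighbourhood of its support. $u=u_{z_1,\bar z_2}$ is a bivariate linear functional with well-defined support; $\operatorname{supp}_1(u),\operatorname{supp}_2(u)$ are the projections of the support to the $z_1$- and $z_2$-coordinates. Its sesquilinear form is $\langle f(z_1),g(z_2)\rangle_u=\langle u_{z_1,\bar z_2},f(z_1)\otimes\overline{g(z_2)}\rangle$. CMV basis: $\chi=[\chi^{(0)},\chi^{(1)},\dots]^\top$, $\chi^{(2k)}(z)=z^k$, $\chi^{(2k+1)}(z)=z^{-k-1}$. Gram matrix $G=(\langle\chi^{(k)},\chi^{(l)}\rangle_u)_{k,l\ge0}$, assumed quasidefinite (all leading principal minors nonzero), so $G=S_1^{-1}H(S_2^{-1})^\dagger$ with $S_1,S_2$ lower unitriangular, $H=\operatorname{diag}(H_0,H_1,\dots)$ nonsingular. Biorthogonal Laurent polynomials: $\phi_1=S_1\chi$, $\phi_2=S_2\chi$, with components $\phi_{1,k},\phi_{2,k}$. Geronimus–Uvarov perturbations: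 for $a\in\{1,2\}$, $L^{(a)}_\Gamma,L^{(a)}_{\mathfrak C}$ are Laurent polynomials with $\sigma(L^{(1)}_\Gamma)\cap\operatorname{supp}_1(u)=\varnothing$, $\sigma(L^{(2)}_\Gamma)\cap\operatorname{supp}_2(u)=\varnothing$. $L^{(a)}_\Gamma$ has distinct zeros $\zeta^{(a)}_i$ with multiplicities $m^{(a)}_i$, $1\le i\le d^{(a)}$; $\xi^{(a)}_{i,l}$ ($0\le l\le m^{(a)}_i-1$) are arbitrary univariate linear functionals. The perturbed forms are $$\langle f,g\rangle_{\tilde u^{(1,2)}}=\Big\langle u,\tfrac{f(z_1)}{L^{(1)}_\Gamma(z_1)}\otimes\overline{L^{(2)}_{\mathfrak C}(z_2)g(z_2)}\Big\rangle+\sum_{i=1}^{d^{(1)}}\sum_{l=0}^{m^{(1)}_i-1}\tfrac1{l!}f^{(l)}(\zeta^{(1)}_i)\overline{\langle\xi^{(1)}_{i,l},L^{(2)}_{\mathfrak C}g\rangle},$$ $$\langle f,g\rangle_{\tilde u^{(2,1)}}=\Big\langle u,L^{(1)}_{\mathfrak C}(z_1)f(z_1)\otimes\overline{\tfrac{g(z_2)}{L^{(2)}_\Gamma(z_2)}}\Big\rangle+\sum_{i=1}^{d^{(2)}}\sum_{l=0}^{m^{(2)}_i-1}\tfrac1{l!}\langle\xi^{(2)}_{i,l},L^{(1)}_{\mathfrak C}f\rangle\overline{g^{(l)}(\zeta^{(2)}_i)}.$$ Both perturbed Gram matrices (in the CMV basis) are assumed quasidefinite; $\tilde\phi^{(1,2)}_{1,k},\tilde\phi^{(1,2)}_{2,k},\tilde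 H^{(1,2)}_k$ and $\tilde\phi^{(2,1)}_{1,k},\tilde\phi^{(2,1)}_{2,k},\tilde H^{(2,1)}_k$ denote the objects built from them as $\phi_{1,k},\phi_{2,k},H_k$ are built from $G$. Second kind functions and kernels: $C_{1,k}(z)=\langle\phi_{1,k}(z_1),\frac1{\bar z-z_2}\rangle_u$ for $\bar z\notin\operatorname{supp}_2(u)$; $\overline{C_{2,k}(z)}=\langle\frac1{\bar z-z_1},\phi_{2,k}(z_2)\rangle_u$ for $\bar z\notin\operatorname{supp}_1(u)$. $K^{[m]}(\bar z_1,z_2)=\sum_{k=0}^{m-1}\overline{\phi_{2,k}(z_1)}H_k^{-1}\phi_{1,k}(z_2)$, $K^{[m]}_{C_2}(\bar z_1,z_2)=\sum_{k=0}^{m-1}\overline{C_{2,k}(z_1)}H_k^{-1}\phi_{1,k}(z_2)$, $K^{[m]}_{C_1}(\bar z_1,z_2)=\sum_{k=0}^{m-1}\overline{\phi_{2,k}(z_1)}H_k^{-1}C_{1,k}(z_2)$. Each is regarded as a function of its first argument ($=\bar z_1$) and second argument ($=z_2$), holomorphic in both. $\delta L(z_1,z_2):=\frac{L(z_1)-L(z_2)}{z_1-z_2}$ (a Laurent polynomial in two variables). Spectral jets: if $L$ has distinct zeros $\zeta_1,\dots,\zeta_d$ in $\mathbb C^*$ with multiplicities $m_1,\dots,m_d$, then $\mathcal J^L_f:=\big[f(\zeta_1),f'(\zeta_1),\dots,\frac{f^{(m_1-1)}(\zeta_1)}{(m_1-1)!},\dots,f(\zeta_d),\dots,\frac{f^{(m_d-1)}(\zeta_d)}{(m_d-1)!}\big]$.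 The zeros of $\overline{L}$ are enumerated as $\bar\zeta_1,\dots,\bar\zeta_d$. Mass notation: $\langle\xi^{(a)},f\rangle$ is the row vector of the numbers $\langle\xi^{(a)}_{i,l},f\rangle$, ordered by $i=1,\dots,d^{(a)}$ and, for each $i$, $l=0,\dots,m^{(a)}_i-1$ (for $f$ depending on further parameters, $(\xi^{(a)})_w$ means that the functional acts in the variable $w$). Writing $L^{(a)}_\Gamma(z)=L^{(a)}_{\Gamma,N_\Gamma}z^{-N_\Gamma}\prod_j(z-\zeta^{(a)}_j)^{m^{(a)}_j}$, let $L^{(a)}_{\Gamma,[i]}(z)=L^{(a)}_{\Gamma,N_\Gamma}z^{-N_\Gamma}\prod_{j\ne i}(z-\zeta^{(a)}_j)^{m^{(a)}_j}$ and $\ell^{(a)}_{[j],k}:=\frac1{k!}\frac{d^k\overline{L^{(a)}_{\Gamma,[j]}}(z)}{dz^k}\big|_{z=\overline{\zeta^{(a)}_j}}$. $\mathcal L^{(a)}:=\operatorname{diag}(\mathcal L^{(a)}_{[1]},\dots,\mathcal L^{(a)}_{[d^{(a)}]})$ where $\mathcal L^{(a)}_{[j]}$ is the $m^{(a)}_j\times m^{(a)}_j$ matrix with entries (indices $p,q=0,\dots,m^{(a)}_j-1$) $(\mathcal L^{(a)}_{[j]})_{p,q}=\ell^{(a)}_{[j],\,p+q-m^{(a)}_j+1}$ if $p+q\ge m^{(a)}_j-1$ and $0$ otherwise. *)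

theory Defs
  imports
    "HOL-Complex_Analysis.Complex_Analysis"
    "HOL-Library.Poly_Mapping"
    "Jordan_Normal_Form.Determinant"
begin

text \<open>A Laurent polynomial is its finitely supported coefficient function
  \<open>int \<Rightarrow>\<^sub>0 complex\<close>. Its values are only meaningful on the punctured plane.\<close>

definition lp :: "(int \<Rightarrow>\<^sub>0 complex) \<Rightarrow> complex \<Rightarrow> complex" where
  "lp L z = (\<Sum>n\<in>Poly_Mapping.keys L. Poly_Mapping.lookup L n * z powi n)"

definition lp_zeros :: "(int \<Rightarrow>\<^sub>0 complex) \<Rightarrow> complex set" where
  "lp_zeros L = {z. z \<noteq> 0 \<and> lp L z = 0}"

definition prepared :: "(int \<Rightarrow>\<^sub>0 complex) \<Rightarrow> nat \<Rightarrow> bool" where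
  "prepared L N \<longleftrightarrow> N \<ge> 1 \<and> Poly_Mapping.keys L \<subseteq> {- int N..int N} \<and>
     Poly_Mapping.lookup L (int N) \<noteq> 0 \<and> Poly_Mapping.lookup L (- int N) \<noteq> 0"

definition conj_fun :: "(complex \<Rightarrow> complex) \<Rightarrow> complex \<Rightarrow> complex" where
  "conj_fun f z = cnj (f (cnj z))"

definition zeros_enum :: "(int \<Rightarrow>\<^sub>0 complex) \<Rightarrow> (complex \<times> nat) list \<Rightarrow> bool" where
  "zeros_enum L zs \<longleftrightarrow> distinct (map fst zs) \<and> fst ` set zs = lp_zeros L \<and>
     (\<forall>(\<zeta>, m)\<in>set zs. int m = zorder (lp L) \<zeta>)"

definition conj_zeros :: "(complex \<times> nat) list \<Rightarrow> (complex \<times> nat) list" where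
  "conj_zeros zs = map (\<lambda>(\<zeta>, m). (cnj \<zeta>, m)) zs"

definition jet :: "(complex \<times> nat) list \<Rightarrow> (complex \<Rightarrow> complex) \<Rightarrow> complex vec" where
  "jet zs f = vec_of_list
     (concat (map (\<lambda>(\<zeta>, m). map (\<lambda>l. (deriv ^^ l) f \<zeta> / fact l) [0..<m]) zs))"

definition divided_diff :: "(complex \<Rightarrow> complex) \<Rightarrow> complex \<Rightarrow> complex \<Rightarrow> complex" where
  "divided_diff f x y = (if x = y then deriv f x else (f x - f y) / (x - y))"

text \<open>Test functions in the two variables \<open>(z\<^sub>1, z\<^sub>2)\<close>, both in the punctured plane. They are
  coded as total functions; only their restrictions to \<open>cstar2\<close> matter.\<close>

definition cstar2 :: "(complex \<times> complex) set" where
  "cstar2 = (- {0}) \<times> (- {0})"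

definition laurent2 :: "(complex \<times> complex \<Rightarrow> complex) set" where
  "laurent2 = {\<lambda>(z1, z2). \<Sum>(m, n)\<in>Poly_Mapping.keys P. Poly_Mapping.lookup P (m, n) * z1 powi m * cnj z2 powi n
     | P :: int \<times> int \<Rightarrow>\<^sub>0 complex. True}"

definition linear_on ::
  "('a \<Rightarrow> complex) set \<Rightarrow> (('a \<Rightarrow> complex) \<Rightarrow> complex) \<Rightarrow> bool" where
  "linear_on V v \<longleftrightarrow> (\<forall>f\<in>V. \<forall>g\<in>V. v (\<lambda>x. f x + g x) = v f + v g) \<and>
     (\<forall>c. \<forall>f\<in>V. v (\<lambda>x. c * f x) = c * v f)"

definition fun_support :: "(complex \<times> complex \<Rightarrow> complex) \<Rightarrow> (complex \<times> complex) set" where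
  "fun_support f = cstar2 \<inter> closure {x \<in> cstar2. f x \<noteq> 0}"

text \<open>The support of a functional is the complement of the union of the open sets on which it
  vanishes. It is well defined if the functional vanishes on that whole union, which need not
  hold for a space of test functions without partitions of unity.\<close>

definition support ::
  "(complex \<times> complex \<Rightarrow> complex) set \<Rightarrow> ((complex \<times> complex \<Rightarrow> complex) \<Rightarrow> complex) \<Rightarrow>
   (complex \<times> complex) set" where
  "support F v = cstar2 -
     \<Union>{U. open U \<and> U \<subseteq> cstar2 \<and> (\<forall>f\<in>F. fun_support f \<subseteq> U \<longrightarrow> v f = 0)}"

definition has_support ::
  "(complex \<times> complex \<Rightarrow> complex) set \<Rightarrow> ((complex \<times> complex \<Rightarrow> complex) \<Rightarrow> complex) \<Rightarrow> bool" where
  "has_support F v \<longleftrightarrow> (\<forall>f\<in>F. fun_support f \<inter> support F v = {} \<longrightarrow> v f = 0)"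

definition supp1 ::
  "(complex \<times> complex \<Rightarrow> complex) set \<Rightarrow> ((complex \<times> complex \<Rightarrow> complex) \<Rightarrow> complex) \<Rightarrow> complex set"
  where "supp1 F v = fst ` support F v"

definition supp2 ::
  "(complex \<times> complex \<Rightarrow> complex) set \<Rightarrow> ((complex \<times> complex \<Rightarrow> complex) \<Rightarrow> complex) \<Rightarrow> complex set"
  where "supp2 F v = snd ` support F v"

text \<open>Closure of \<open>F\<close> under the vector space operations is part of the two continuity
  assumptions.\<close>

locale test_space =
  fixes F :: "(complex \<times> complex \<Rightarrow> complex) set"
    and T :: "(complex \<times> complex \<Rightarrow> complex) topology"
  assumes topspace_T: "topspace T = F"
    and continuous_add: "continuous_map (prod_topology T T) T (\<lambda>(f, g) x. f x + g x)"
    and continuous_scale: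
      "continuous_map (prod_topology euclidean T) T (\<lambda>(c :: complex, f) x. c * f x)"
    and laurent: "(\<lambda>f. restrict f cstar2) ` laurent2 \<subset> (\<lambda>f. restrict f cstar2) ` F"
    and supports: "\<And>v. linear_on F v \<Longrightarrow> continuous_map T euclidean v \<Longrightarrow> has_support F v"

text \<open>A functional is evaluated on a function admissible only near its support by replacing
  that function by any test function that agrees with it near the support; the value does not
  depend on the choice when the support is well defined.\<close>

definition agrees_near :: "'a::topological_space set \<Rightarrow> ('a \<Rightarrow> 'b) \<Rightarrow> ('a \<Rightarrow> 'b) \<Rightarrow> bool" where
  "agrees_near K f g \<longleftrightarrow> (\<exists>W. open W \<and> K \<subseteq> W \<and> (\<forall>x\<in>W. f x = g x))"

definition admissible where
  "admissible F v f \<longleftrightarrow> (\<exists>g\<in>F. agrees_near (support F v) f g)"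

definition evaluate ::
  "(complex \<times> complex \<Rightarrow> complex) set \<Rightarrow> ((complex \<times> complex \<Rightarrow> complex) \<Rightarrow> complex) \<Rightarrow>
   (complex \<times> complex \<Rightarrow> complex) \<Rightarrow> complex" where
  "evaluate F v f = v (SOME g. g \<in> F \<and> agrees_near (support F v) f g)"

text \<open>Near the support, the functions \<open>\<Phi> w\<close> for \<open>w\<close> close to \<open>w0\<close> are test functions
  depending continuously on \<open>w\<close> at \<open>w0\<close>.\<close>

definition continuous_family ::
  "(complex \<times> complex \<Rightarrow> complex) set \<Rightarrow> (complex \<times> complex \<Rightarrow> complex) topology \<Rightarrow>
   ((complex \<times> complex \<Rightarrow> complex) \<Rightarrow> complex) \<Rightarrow>
   (complex \<Rightarrow> complex \<times> complex \<Rightarrow> complex) \<Rightarrow> complex \<Rightarrow> bool" where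
  "continuous_family F T v \<Phi> w0 \<longleftrightarrow>
     (\<exists>W G. open W \<and> support F v \<subseteq> W \<and>
       (\<forall>\<^sub>F w in nhds w0. G w \<in> F \<and> (\<forall>x\<in>W. G w x = \<Phi> w x)) \<and>
       limitin T G (G w0) (at w0))"

text \<open>A continuous bivariate functional \<open>u\<close> (in \<open>z\<^sub>1\<close> and the conjugate of \<open>z\<^sub>2\<close>).
  The last four assumptions make explicit what it takes for the perturbed forms and the second
  kind functions to be defined, and for the latter to be holomorphic off the (conjugated)
  support: rational functions without poles on the support are admissible, and so are Cauchy
  kernels with poles off the support, continuously in the pole. All this is automatic for
  smooth test functions and compactly supported distributions (multiply by a cut-off).
  The projections of a compact support are closed.\<close>

locale bivariate_functional = test_space F T
  for F :: "(complex \<times> complex \<Rightarrow> complex) set"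
    and T :: "(complex \<times> complex \<Rightarrow> complex) topology" +
  fixes u :: "(complex \<times> complex \<Rightarrow> complex) \<Rightarrow> complex"
  assumes linear: "linear_on F u"
    and continuous: "continuous_map T euclidean u"
    and closed_projections:
      "closedin (top_of_set (- {0})) (supp1 F u)" "closedin (top_of_set (- {0})) (supp2 F u)"
    and rational:
      "\<And>P1 Q1 P2 Q2. lp_zeros Q1 \<inter> supp1 F u = {} \<Longrightarrow> lp_zeros Q2 \<inter> supp2 F u = {} \<Longrightarrow>
         admissible F u (\<lambda>(z1, z2). (lp P1 z1 / lp Q1 z1) * cnj (lp P2 z2 / lp Q2 z2))"
    and cauchy1:
      "\<And>P1 Q1 P2 Q2 w0. lp_zeros Q1 \<inter> supp1 F u = {} \<Longrightarrow> lp_zeros Q2 \<inter> supp2 F u = {} \<Longrightarrow>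
         w0 \<noteq> 0 \<Longrightarrow> w0 \<notin> supp1 F u \<Longrightarrow>
         continuous_family F T u
           (\<lambda>w (z1, z2). (lp P1 z1 / lp Q1 z1) / (w - z1) * cnj (lp P2 z2 / lp Q2 z2)) w0"
    and cauchy2:
      "\<And>P1 Q1 P2 Q2 w0. lp_zeros Q1 \<inter> supp1 F u = {} \<Longrightarrow> lp_zeros Q2 \<inter> supp2 F u = {} \<Longrightarrow>
         w0 \<noteq> 0 \<Longrightarrow> cnj w0 \<notin> supp2 F u \<Longrightarrow>
         continuous_family F T u
           (\<lambda>w (z1, z2). (lp P1 z1 / lp Q1 z1) * (cnj (lp P2 z2 / lp Q2 z2) / (w - cnj z2))) w0"

text \<open>The univariate functionals are arbitrary, not necessarily continuous. They are only ever
  applied to Laurent polynomials, so no larger domain is prescribed.\<close>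

definition laurent_fun :: "(complex \<Rightarrow> complex) set" where
  "laurent_fun = {f. \<exists>L. \<forall>z. z \<noteq> 0 \<longrightarrow> f z = lp L z}"

definition laurent_functional :: "((complex \<Rightarrow> complex) \<Rightarrow> complex) \<Rightarrow> bool" where
  "laurent_functional \<xi> \<longleftrightarrow> linear_on laurent_fun \<xi> \<and>
     (\<forall>f\<in>laurent_fun. \<forall>g. (\<forall>z. z \<noteq> 0 \<longrightarrow> f z = g z) \<longrightarrow> \<xi> f = \<xi> g)"

type_synonym form = "(complex \<Rightarrow> complex) \<Rightarrow> (complex \<Rightarrow> complex) \<Rightarrow> complex"

definition form_of ::
  "(complex \<times> complex \<Rightarrow> complex) set \<Rightarrow> ((complex \<times> complex \<Rightarrow> complex) \<Rightarrow> complex) \<Rightarrow> form" where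
  "form_of F u f g = evaluate F u (\<lambda>(z1, z2). f z1 * cnj (g z2))"

text \<open>\<open>\<xi> i l\<close> is the mass attached to the \<open>l\<close>-th derivative at the \<open>i\<close>-th zero (both counted
  from zero).\<close>

definition form12 where
  "form12 F u LG1 zs \<xi> LC2 f g =
     evaluate F u (\<lambda>(z1, z2). f z1 / lp LG1 z1 * cnj (lp LC2 z2 * g z2)) +
     (\<Sum>i<length zs. \<Sum>l<snd (zs ! i).
        1 / fact l * (deriv ^^ l) f (fst (zs ! i)) * cnj (\<xi> i l (\<lambda>z. lp LC2 z * g z)))"

definition form21 where
  "form21 F u LG2 zs \<xi> LC1 f g =
     evaluate F u (\<lambda>(z1, z2). lp LC1 z1 * f z1 * cnj (g z2 / lp LG2 z2)) +
     (\<Sum>i<length zs. \<Sum>l<snd (zs ! i).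
        1 / fact l * \<xi> i l (\<lambda>z. lp LC1 z * f z) * cnj ((deriv ^^ l) g (fst (zs ! i))))"

definition cmv :: "nat \<Rightarrow> complex \<Rightarrow> complex" where
  "cmv n z = (if even n then z powi int (n div 2) else z powi (- int (n div 2) - 1))"

definition gram :: "form \<Rightarrow> nat \<Rightarrow> nat \<Rightarrow> complex" where
  "gram B k l = B (cmv k) (cmv l)"

definition quasidefinite :: "(nat \<Rightarrow> nat \<Rightarrow> complex) \<Rightarrow> bool" where
  "quasidefinite G \<longleftrightarrow> (\<forall>n\<ge>1. Determinant.det (Matrix.mat n n (\<lambda>(i, j). G i j)) \<noteq> 0)"

definition lower_unitriangular :: "(nat \<Rightarrow> nat \<Rightarrow> complex) \<Rightarrow> bool" where
  "lower_unitriangular A \<longleftrightarrow> (\<forall>i. A i i = 1) \<and> (\<forall>i j. i < j \<longrightarrow> A i j = 0)"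

text \<open>For lower triangular factors the entries of the semi-infinite products are finite sums.\<close>

definition lower_inverse :: "(nat \<Rightarrow> nat \<Rightarrow> complex) \<Rightarrow> (nat \<Rightarrow> nat \<Rightarrow> complex) \<Rightarrow> bool" where
  "lower_inverse A B \<longleftrightarrow>
     (\<forall>i j. (\<Sum>k\<le>i. A i k * B k j) = (if i = j then 1 else 0)) \<and>
     (\<forall>i j. (\<Sum>k\<le>i. B i k * A k j) = (if i = j then 1 else 0))"

text \<open>\<open>G = S1\<^sup>-\<^sup>1 H (S2\<^sup>-\<^sup>1)\<^sup>\<dagger>\<close>, where \<open>R1\<close> and \<open>R2\<close> are the inverses of \<open>S1\<close> and \<open>S2\<close>.\<close>

definition gauss_borel ::
  "(nat \<Rightarrow> nat \<Rightarrow> complex) \<Rightarrow> (nat \<Rightarrow> nat \<Rightarrow> complex) \<Rightarrow> (nat \<Rightarrow> complex) \<Rightarrow>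
   (nat \<Rightarrow> nat \<Rightarrow> complex) \<Rightarrow> bool" where
  "gauss_borel G S1 H S2 \<longleftrightarrow>
     lower_unitriangular S1 \<and> lower_unitriangular S2 \<and> (\<forall>k. H k \<noteq> 0) \<and>
     (\<exists>R1 R2. lower_unitriangular R1 \<and> lower_unitriangular R2 \<and>
        lower_inverse S1 R1 \<and> lower_inverse S2 R2 \<and>
        (\<forall>i j. G i j = (\<Sum>k\<le>min i j. R1 i k * H k * cnj (R2 j k))))"

definition cmv_comb :: "(nat \<Rightarrow> nat \<Rightarrow> complex) \<Rightarrow> nat \<Rightarrow> complex \<Rightarrow> complex" where
  "cmv_comb S k z = (\<Sum>j\<le>k. S k j * cmv j z)"

text \<open>For a quasidefinite Gram matrix the factorization, and hence the system, exists and is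
  unique.\<close>

definition biorthogonal_system ::
  "form \<Rightarrow> (nat \<Rightarrow> complex \<Rightarrow> complex) \<Rightarrow> (nat \<Rightarrow> complex \<Rightarrow> complex) \<Rightarrow> (nat \<Rightarrow> complex) \<Rightarrow> bool" where
  "biorthogonal_system B \<phi>1 \<phi>2 H \<longleftrightarrow>
     (\<exists>S1 S2. gauss_borel (gram B) S1 H S2 \<and> \<phi>1 = cmv_comb S1 \<and> \<phi>2 = cmv_comb S2)"

definition second_kind1 where
  "second_kind1 F u \<phi>1 k z = form_of F u (\<phi>1 k) (\<lambda>z2. 1 / (cnj z - z2))"

definition second_kind2 where
  "second_kind2 F u \<phi>2 k z = cnj (form_of F u (\<lambda>z1. 1 / (cnj z - z1)) (\<phi>2 k))"

text \<open>All three kernels are instances of the following one (with \<open>f\<close>, \<open>g\<close> the biorthogonal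
  polynomials or the second kind functions). The first argument stands for the conjugate of
  \<open>z\<^sub>1\<close>, so that the kernel is holomorphic in both arguments.\<close>

definition kernel ::
  "(nat \<Rightarrow> complex \<Rightarrow> complex) \<Rightarrow> (nat \<Rightarrow> complex) \<Rightarrow> (nat \<Rightarrow> complex \<Rightarrow> complex) \<Rightarrow>
   nat \<Rightarrow> complex \<Rightarrow> complex \<Rightarrow> complex" where
  "kernel f H g m x y = (\<Sum>k<m. conj_fun (f k) x * inverse (H k) * g k y)"

definition masses ::
  "(nat \<Rightarrow> nat \<Rightarrow> (complex \<Rightarrow> complex) \<Rightarrow> complex) \<Rightarrow> (complex \<times> nat) list \<Rightarrow>
   (complex \<Rightarrow> complex) \<Rightarrow> complex vec" where
  "masses \<xi> zs f = vec_of_list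
     (concat (map (\<lambda>i. map (\<lambda>l. \<xi> i l f) [0..<snd (zs ! i)]) [0..<length zs]))"

definition deflated ::
  "(int \<Rightarrow>\<^sub>0 complex) \<Rightarrow> nat \<Rightarrow> (complex \<times> nat) list \<Rightarrow> nat \<Rightarrow> complex \<Rightarrow> complex" where
  "deflated L N zs i z = Poly_Mapping.lookup L (int N) * z powi (- int N) *
     (\<Prod>j\<in>{..<length zs} - {i}. (z - fst (zs ! j)) ^ snd (zs ! j))"

definition taylor_coeff ::
  "(int \<Rightarrow>\<^sub>0 complex) \<Rightarrow> nat \<Rightarrow> (complex \<times> nat) list \<Rightarrow> nat \<Rightarrow> nat \<Rightarrow> complex" where
  "taylor_coeff L N zs j k =
     (deriv ^^ k) (conj_fun (deflated L N zs j)) (cnj (fst (zs ! j))) / fact k"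

definition taylor_mat ::
  "(int \<Rightarrow>\<^sub>0 complex) \<Rightarrow> nat \<Rightarrow> (complex \<times> nat) list \<Rightarrow> complex mat" where
  "taylor_mat L N zs = diag_block_mat
     (map (\<lambda>j. let m = snd (zs ! j) in
        Matrix.mat m m (\<lambda>(p, q). if p + q \<ge> m - 1 then taylor_coeff L N zs j (p + q - (m - 1)) else 0))
      [0..<length zs])"

definition row_mult :: "complex vec \<Rightarrow> complex mat \<Rightarrow> complex vec" where
  "row_mult v A = transpose_mat A *\<^sub>v v"

definition det_rows :: "complex vec list \<Rightarrow> complex" where
  "det_rows rs = Determinant.det (mat_of_rows (length rs) rs)"

end

theory Submission
  imports Defs "HOL-Computational_Algebra.Fundamental_Theorem_Algebra"
begin

text \<open>The form \<open>B\<close> and the perturbed form \<open>Bt\<close> satisfy \<open>Bt f (L\<^sub>\<Gamma> g) = B (L\<^sub>C f) g\<close>, because the masses do not see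
  multiples of \<open>L\<^sub>\<Gamma>\<close>. Hence \<open>L\<^sub>C\<close> times a perturbed orthogonal polynomial is a combination of the
  \<open>\<phi>\<^sub>k\<close> with \<open>k\<close> in a band of width \<open>2 N\<^sub>\<Gamma> + 2 N\<^sub>C\<close>, whose two extreme coefficients are known. The linear
  functionals making up the rows \<open>A\<^sub>k\<close> annihilate this combination: the jets at the zeros of \<open>L\<^sub>C\<close>
  trivially, and the jets of second kind functions corrected by the masses because, after
  pairing with the divided difference of \<open>L\<^sub>\<Gamma>\<close>, they reproduce a pairing of the perturbed form that
  vanishes by orthogonality. Cramer's rule gives the first polynomial and the norm. Applied to the
  perturbed Christoffel--Darboux kernel instead, the same functionals give the row \<open>B\<^sub>l\<close> and thus the
  second polynomial. Part (II) is part (I) for the form \<open>(f, g) \<mapsto> cnj (B g f)\<close>, conjugated.\<close>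

subsection \<open>Determinants given by rows\<close>

text \<open>Orthogonality of the perturbed system can only be used against Laurent polynomials,
  whereas second kind functions pair with a Cauchy kernel. The divided difference of
  \<open>LG\<close> bridges the two: in its second variable it is a Laurent polynomial, spanned by
  the first \<open>2 * NG\<close> CMV monomials, hence orthogonal to the perturbed polynomial of
  index \<open>l\<close> as soon as \<open>2 * NG \<le> l\<close>. Its q-th Taylor coefficient at a
  zero \<zeta> of multiplicity m is (x - \<zeta>)^(m-1-q) times the deflated polynomial at x;
  conjugating these and expanding them around the conjugate zero produces the Hankel blocks that
  multiply the masses. The signs \<open>(-1) ^ l\<close> in the constants come from the CMV order:
  multiplication by a prepared polynomial reaches its highest index through the coefficient of z^N
  for even l and of z^(-N) for odd l. Only continuity of Cauchy transforms in the pole is available;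
  the resolvent identity turns it into holomorphy.\<close>

lemma det_rows_append_laplace:
  fixes rs :: "complex vec list"
  assumes "set rs \<subseteq> carrier_vec n" "length rs + 1 = n" "v \<in> carrier_vec n"
  shows "det_rows (rs @ [v]) =
    (\<Sum>j<n. v $ j * ((-1) ^ (length rs + j) * Determinant.det (mat_delete (mat_of_rows n (rs @ [0\<^sub>v n])) (length rs) j)))"
proof -
  let ?A = "mat_of_rows n (rs @ [v])"
  have A: "?A \<in> carrier_mat n n" using assms(2) mat_of_rows_carrier(1)[of n "rs @ [v]"] by simp
  have l: "length rs < n" using assms(2) by simp
  have "det_rows (rs @ [v]) = Determinant.det ?A"
    using assms(2) by (simp add: det_rows_def)
  also have "\<dots> = (\<Sum>j<n. ?A $$ (length rs, j) * cofactor ?A (length rs) j)"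
    by (rule laplace_expansion_row[OF A l])
  also have "\<dots> = (\<Sum>j<n. v $ j * ((-1) ^ (length rs + j) * Determinant.det (mat_delete (mat_of_rows n (rs @ [0\<^sub>v n])) (length rs) j)))"
  proof (rule sum.cong[OF refl])
    fix j assume j: "j \<in> {..<n}"
    \<comment> \<open>The minors omit the last row, so a zero row may stand in for \<open>v\<close>;
      the cofactors are then visibly independent of \<open>v\<close>.\<close>
    have "mat_delete ?A (length rs) j = mat_delete (mat_of_rows n (rs @ [0\<^sub>v n])) (length rs) j"
      unfolding mat_delete_def using assms(2)
      by (intro eq_matI) (auto simp: mat_of_rows_def nth_append)
    moreover have "?A $$ (length rs, j) = v $ j"
      using j assms by (simp add: mat_of_rows_def)
    ultimately show "?A $$ (length rs, j) * cofactor ?A (length rs) j = v $ j * ((-1) ^ (length rs + j) * Determinant.det (mat_delete (mat_of_rows n (rs @ [0\<^sub>v n])) (length rs) j))"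
      by (simp add: cofactor_def)
  qed
  finally show ?thesis .
qed

text \<open>Laplace expansion is linear in the last row. The scalar \<open>s\<close> avoids
  divisions and covers a linear dependence as the case \<open>s = 0\<close>.\<close>

lemma det_rows_append_linear:
  fixes rs :: "complex vec list" and v :: "complex vec" and r :: "nat \<Rightarrow> complex vec"
  assumes "set rs \<subseteq> carrier_vec n" "length rs + 1 = n" "v \<in> carrier_vec n" "finite I"
    "\<And>k. k \<in> I \<Longrightarrow> r k \<in> carrier_vec n"
    "\<And>i. i < n \<Longrightarrow> s * v $ i = (\<Sum>k\<in>I. c k * r k $ i)"
  shows "s * det_rows (rs @ [v]) = (\<Sum>k\<in>I. c k * det_rows (rs @ [r k]))"
proof -
  define h where "h j = (-1) ^ (length rs + j) * Determinant.det (mat_delete (mat_of_rows n (rs @ [0\<^sub>v n])) (length rs) j)" for j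
  have D: "det_rows (rs @ [w]) = (\<Sum>j<n. w $ j * h j)" if "w \<in> carrier_vec n" for w
    using det_rows_append_laplace[OF assms(1,2) that] by (simp add: h_def)
  have "s * det_rows (rs @ [v]) = (\<Sum>j<n. (s * v $ j) * h j)"
    by (simp add: D assms(3) sum_distrib_left mult.assoc)
  also have "\<dots> = (\<Sum>j<n. \<Sum>k\<in>I. c k * (r k $ j * h j))"
    by (intro sum.cong refl) (simp add: assms(6) sum_distrib_right mult.assoc)
  also have "\<dots> = (\<Sum>k\<in>I. \<Sum>j<n. c k * (r k $ j * h j))" by (rule sum.swap)
  also have "\<dots> = (\<Sum>k\<in>I. c k * det_rows (rs @ [r k]))"
    by (intro sum.cong refl) (simp add: D assms(5) sum_distrib_left)
  finally show ?thesis .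
qed

lemma det_rows_repeated:
  fixes rs :: "complex vec list"
  assumes "set rs \<subseteq> carrier_vec n" "length rs + 1 = n" "r \<in> set rs"
  shows "det_rows (rs @ [r]) = 0"
proof -
  obtain i where i: "i < length rs" "rs ! i = r" using assms(3) by (meson in_set_conv_nth)
  have "Determinant.det (mat_of_rows n (rs @ [r])) = 0"
  proof (rule det_identical_rows[of _ n i "length rs"])
    show "mat_of_rows n (rs @ [r]) \<in> carrier_mat n n"
      using assms(2) mat_of_rows_carrier(1)[of n "rs @ [r]"] by simp
    show "row (mat_of_rows n (rs @ [r])) i = row (mat_of_rows n (rs @ [r])) (length rs)"
      using i assms by (subst (1 2) mat_of_rows_row) (auto simp: nth_append)
  qed (use i assms in auto)
  thus ?thesis using assms(2) by (simp add: det_rows_def)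
qed

text \<open>Expansion along \<open>r\<close>, placed first or last, meets the same minors; only the
  checkerboard sign changes, by the distance of the two positions.\<close>

lemma det_rows_rotate:
  fixes rs :: "complex vec list"
  assumes "set rs \<subseteq> carrier_vec n" "length rs + 1 = n" "r \<in> carrier_vec n"
  shows "det_rows (r # rs) = (-1) ^ length rs * det_rows (rs @ [r])"
proof -
  let ?A = "mat_of_rows n (r # rs)"
  let ?B = "mat_of_rows n (rs @ [0\<^sub>v n])"
  have A: "?A \<in> carrier_mat n n" using assms(2) mat_of_rows_carrier(1)[of n "r # rs"] by simp
  have "det_rows (r # rs) = Determinant.det ?A"
    using assms(2) by (simp add: det_rows_def)
  also have "\<dots> = (\<Sum>j<n. ?A $$ (0, j) * cofactor ?A 0 j)"
    by (rule laplace_expansion_row[OF A]) (use assms in simp)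
  also have "\<dots> = (\<Sum>j<n. (-1) ^ length rs * (r $ j * ((-1) ^ (length rs + j) * Determinant.det (mat_delete ?B (length rs) j))))"
  proof (rule sum.cong[OF refl])
    fix j assume j: "j \<in> {..<n}"
    have "mat_delete ?A 0 j = mat_delete ?B (length rs) j"
      unfolding mat_delete_def using assms(2)
      by (intro eq_matI) (auto simp: mat_of_rows_def nth_append)
    moreover have "?A $$ (0, j) = r $ j"
      using j assms by (simp add: mat_of_rows_def)
    ultimately show "?A $$ (0, j) * cofactor ?A 0 j = (-1) ^ length rs * (r $ j * ((-1) ^ (length rs + j) * Determinant.det (mat_delete ?B (length rs) j)))"
      by (simp add: cofactor_def power_add)
  qed
  also have "\<dots> = (-1) ^ length rs * det_rows (rs @ [r])"
    by (simp add: det_rows_append_laplace[OF assms] sum_distrib_left)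
  finally show ?thesis .
qed

text \<open>The last row vanishes outside the corner, where the checkerboard sign is
  \<open>(-1) ^ (n + n)\<close>.\<close>

lemma det_rows_bordered:
  fixes r :: "nat \<Rightarrow> complex vec"
  assumes "\<And>k. k \<in> set ks \<Longrightarrow> r k \<in> carrier_vec n" "length ks = n"
  shows "det_rows (map (\<lambda>k. r k @\<^sub>v vec_of_list [x k]) ks @ [0\<^sub>v n @\<^sub>v vec_of_list [y]]) =
    y * det_rows (map r ks)"
proof -
  let ?rs = "map (\<lambda>k. r k @\<^sub>v vec_of_list [x k]) ks"
  let ?v = "0\<^sub>v n @\<^sub>v vec_of_list [y]"
  let ?B = "mat_of_rows (Suc n) (?rs @ [0\<^sub>v (Suc n)])"
  have car: "r k @\<^sub>v vec_of_list [x k] \<in> carrier_vec (Suc n)" if "k \<in> set ks" for k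
    using assms(1)[OF that] by (intro carrier_vecI) simp
  have v: "?v \<in> carrier_vec (Suc n)"
    by (intro carrier_vecI) simp
  have vj: "?v $ j = (if j = n then y else 0)" if "j \<le> n" for j
    using that by (auto simp: append_vec_def vec_of_list_index)
  have sum: "(\<Sum>j<Suc n. ?v $ j * h j) = y * h n" for h :: "nat \<Rightarrow> complex"
    by (simp add: vj)
  have "det_rows (?rs @ [?v]) = (\<Sum>j<Suc n. ?v $ j * ((-1) ^ (length ?rs + j) * Determinant.det (mat_delete ?B (length ?rs) j)))"
    by (rule det_rows_append_laplace) (use car v assms in auto)
  also have "\<dots> = y * ((-1) ^ (n + n) * Determinant.det (mat_delete ?B n n))"
    by (simp only: sum length_map assms(2))
  also have "mat_delete ?B n n = mat_of_rows n (map r ks)"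
  proof (rule eq_matI)
    fix i j assume ij: "i < dim_row (mat_of_rows n (map r ks))" "j < dim_col (mat_of_rows n (map r ks))"
    hence "ks ! i \<in> set ks" using assms(2) by auto
    hence "dim_vec (r (ks ! i)) = n" using assms(1) by auto
    thus "mat_delete ?B n n $$ (i, j) = mat_of_rows n (map r ks) $$ (i, j)"
      using ij assms(2) by (auto simp: mat_delete_def mat_of_rows_def nth_append append_vec_def)
  qed (use assms in \<open>auto simp: mat_delete_def\<close>)
  finally show ?thesis using assms(2) by (simp add: det_rows_def flip: mult_2)
qed

context
  fixes A :: "nat \<Rightarrow> complex vec" and \<omega> :: "nat \<Rightarrow> complex" and a n :: nat
  assumes A: "\<And>k. k \<le> a + n \<Longrightarrow> A k \<in> carrier_vec n"
    and relation: "\<And>i. i < n \<Longrightarrow> (\<Sum>k=a..a+n. \<omega> k * A k $ i) = 0"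
    and n: "n > 0"
begin

text \<open>By \<open>relation\<close>, the combination of the bordered rows with weights
  \<open>\<omega>\<close> vanishes except in the border. With it as last row, expansion leaves only
  the summand \<open>k = a + n\<close>, because every other one repeats a row.\<close>

lemma cramer_bordered:
  "\<omega> (a + n) * det_rows (map (\<lambda>k. A k @\<^sub>v vec_of_list [x k]) [a..<a + n + 1]) =
    (\<Sum>k=a..a+n. \<omega> k * x k) * det_rows (map A [a..<a + n])"
proof -
  define r where "r k = A k @\<^sub>v vec_of_list [x k]" for k
  let ?rs = "map r [a..<a + n]"
  let ?y = "\<Sum>k=a..a+n. \<omega> k * x k"
  let ?v = "0\<^sub>v n @\<^sub>v vec_of_list [?y]"
  have r: "r k \<in> carrier_vec (Suc n)" if "k \<le> a + n" for k
    using A[OF that] unfolding r_def by (intro carrier_vecI) simp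
  have "1 * det_rows (?rs @ [?v]) = (\<Sum>k=a..a+n. \<omega> k * det_rows (?rs @ [r k]))"
  proof (rule det_rows_append_linear[of _ "Suc n"])
    fix i assume i: "i < Suc n"
    have "r k $ i = (if i < n then A k $ i else x k)" if "k \<in> {a..a+n}" for k
      using A[of k] that i by (auto simp: r_def append_vec_def less_Suc_eq vec_of_list_index)
    hence "(\<Sum>k=a..a+n. \<omega> k * r k $ i) = (\<Sum>k=a..a+n. \<omega> k * (if i < n then A k $ i else x k))"
      by (intro sum.cong refl) simp
    also have "\<dots> = 1 * ?v $ i"
      using i relation[of i] by (auto simp: append_vec_def less_Suc_eq vec_of_list_index)
    finally show "1 * ?v $ i = (\<Sum>k=a..a+n. \<omega> k * r k $ i)" ..
  qed (use r in \<open>auto intro!: carrier_vecI\<close>)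
  also have "\<dots> = (\<Sum>k=a..a+n. if k = a + n then \<omega> k * det_rows (?rs @ [r k]) else 0)"
  proof (intro sum.cong refl)
    fix k assume "k \<in> {a..a+n}"
    thus "\<omega> k * det_rows (?rs @ [r k]) = (if k = a + n then \<omega> k * det_rows (?rs @ [r k]) else 0)"
      using r by (auto intro!: det_rows_repeated[of _ "Suc n"])
  qed
  also have "\<dots> = \<omega> (a + n) * det_rows (?rs @ [r (a + n)])" by simp
  also have "?rs @ [r (a + n)] = map r [a..<a + n + 1]" by simp
  also have "det_rows (?rs @ [?v]) = ?y * det_rows (map A [a..<a + n])"
    unfolding r_def by (rule det_rows_bordered) (use A in auto)
  finally show ?thesis by (simp add: r_def[abs_def])
qed

text \<open>Keep the inner rows \<open>a + 1, ..., a + n - 1\<close> and put the zero vector,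
  written by means of \<open>relation\<close>, in the last place. Only the two end rows do not
  repeat an inner one; moving row \<open>a\<close> from the last place to the first costs the sign
  \<open>(-1) ^ (n - 1)\<close>.\<close>

lemma cramer_shift:
  "\<omega> (a + n) * det_rows (map A [a + 1..<a + n + 1]) =
    (-1) ^ n * \<omega> a * det_rows (map A [a..<a + n])"
proof -
  let ?rs = "map A [a + 1..<a + n]"
  have len: "length ?rs + 1 = n" and car: "set ?rs \<subseteq> carrier_vec n" using A n by auto
  have "0 * det_rows (?rs @ [0\<^sub>v n]) = (\<Sum>k=a..a+n. \<omega> k * det_rows (?rs @ [A k]))"
    by (rule det_rows_append_linear[OF car len]) (use A relation in auto)
  also have "\<dots> = (\<Sum>k=a..a+n. (if k = a then \<omega> k * det_rows (?rs @ [A k]) else 0) +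
      (if k = a + n then \<omega> k * det_rows (?rs @ [A k]) else 0))"
    using n det_rows_repeated[OF car len] by (intro sum.cong refl) auto
  also have "\<dots> = \<omega> a * det_rows (?rs @ [A a]) + \<omega> (a + n) * det_rows (?rs @ [A (a + n)])"
    by (simp add: sum.distrib)
  also have "det_rows (?rs @ [A a]) = (-1) ^ length ?rs * det_rows (A a # ?rs)"
    using det_rows_rotate[OF car len, of "A a"] A[of a] by simp
  also have "A a # ?rs = map A [a..<a + n]" using n by (simp add: upt_conv_Cons)
  also have "?rs @ [A (a + n)] = map A [a + 1..<a + n + 1]" using n by simp
  also have "(-1 :: complex) ^ length ?rs = - ((-1) ^ n)" using n by (cases n) (auto simp: not_le)
  finally show ?thesis by (simp add: algebra_simps)
qed

end

text \<open>Modulo the rows that are kept, \<open>s * v\<close> is \<open>c (a + n)\<close> times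
  \<open>A (a + n)\<close>.\<close>

lemma det_rows_replace_last:
  fixes A :: "nat \<Rightarrow> complex vec" and v :: "complex vec"
  assumes "\<And>k. k \<le> a + n \<Longrightarrow> A k \<in> carrier_vec n" "n > 0" "v \<in> carrier_vec n"
    "\<And>i. i < n \<Longrightarrow> s * v $ i = (\<Sum>k=a+1..a+n. c k * A k $ i)"
  shows "s * det_rows (map A [a + 1..<a + n] @ [v]) =
    c (a + n) * det_rows (map A [a + 1..<a + n + 1])"
proof -
  let ?rs = "map A [a + 1..<a + n]"
  have len: "length ?rs + 1 = n" and car: "set ?rs \<subseteq> carrier_vec n" using assms by auto
  have "s * det_rows (?rs @ [v]) = (\<Sum>k=a+1..a+n. c k * det_rows (?rs @ [A k]))"
    by (rule det_rows_append_linear[OF car len]) (use assms in auto)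
  also have "\<dots> = (\<Sum>k=a+1..a+n. if k = a + n then c k * det_rows (?rs @ [A k]) else 0)"
    using det_rows_repeated[OF car len] by (intro sum.cong refl) auto
  also have "\<dots> = c (a + n) * det_rows (?rs @ [A (a + n)])" using assms(2) by simp
  also have "?rs @ [A (a + n)] = map A [a + 1..<a + n + 1]" using assms(2) by simp
  finally show ?thesis .
qed

lemma det_rows_cnj:
  assumes "\<And>r. r \<in> set rs \<Longrightarrow> r \<in> carrier_vec (length rs)"
  shows "det_rows (map (map_vec cnj) rs) = cnj (det_rows rs)"
proof -
  interpret comm_ring_hom cnj by unfold_locales auto
  have "dim_vec (rs ! i) = length rs" if "i < length rs" for i
    using assms[of "rs ! i"] that by auto
  hence "mat_of_rows (length rs) (map (map_vec cnj) rs) = map_mat cnj (mat_of_rows (length rs) rs)"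
    by (intro eq_matI) (auto simp: mat_of_rows_def)
  thus ?thesis by (simp add: det_rows_def)
qed

subsection \<open>Laurent polynomials\<close>

lemma lp_eq_sum:
  assumes "finite A" "Poly_Mapping.keys L \<subseteq> A"
  shows "lp L z = (\<Sum>n\<in>A. Poly_Mapping.lookup L n * z powi n)"
  unfolding lp_def using assms by (intro sum.mono_neutral_left) (auto simp: in_keys_iff)

lemma lp_zero [simp]: "lp 0 z = 0"
  by (simp add: lp_def)

lemma lp_add: "lp (P + Q) z = lp P z + lp Q z"
proof -
  let ?A = "Poly_Mapping.keys P \<union> Poly_Mapping.keys Q"
  have "lp (P + Q) z = (\<Sum>n\<in>?A. Poly_Mapping.lookup (P + Q) n * z powi n)"
    by (rule lp_eq_sum) (use Poly_Mapping.keys_add[of P Q] in auto)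
  also have "\<dots> = lp P z + lp Q z"
    by (simp add: lookup_add distrib_right sum.distrib lp_eq_sum[of ?A P] lp_eq_sum[of ?A Q])
  finally show ?thesis .
qed

lemma lp_sum: "lp (\<Sum>i\<in>I. P i) z = (\<Sum>i\<in>I. lp (P i) z)"
  by (induction I rule: infinite_finite_induct) (auto simp: lp_add)

lemma lp_single: "lp (Poly_Mapping.single n c) z = c * z powi n"
  by (subst lp_eq_sum[of "{n}"]) auto

lemma sum_single_lookup:
  "(\<Sum>n\<in>Poly_Mapping.keys L. Poly_Mapping.single n (Poly_Mapping.lookup L n)) = L"
  by (rule poly_mapping_eqI) (auto simp: lookup_sum lookup_single when_def in_keys_iff)

text \<open>At the origin exponents do not add: \<open>0 powi 1 * 0 powi (- 1)\<close> is 0 while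
  \<open>0 powi 0\<close> is 1. Identities involving products are therefore stated off the
  origin.\<close>

lemma lp_mult:
  assumes "z \<noteq> 0"
  shows "lp (P * Q) z = lp P z * lp Q z"
proof -
  let ?s = "\<lambda>L n. Poly_Mapping.single n (Poly_Mapping.lookup L n)"
  have "P * Q = (\<Sum>n\<in>Poly_Mapping.keys P. ?s P n) * (\<Sum>m\<in>Poly_Mapping.keys Q. ?s Q m)"
    by (simp add: sum_single_lookup)
  also have "\<dots> = (\<Sum>n\<in>Poly_Mapping.keys P. \<Sum>m\<in>Poly_Mapping.keys Q. ?s P n * ?s Q m)"
    by (simp add: sum_product)
  finally have "lp (P * Q) z = (\<Sum>n\<in>Poly_Mapping.keys P. \<Sum>m\<in>Poly_Mapping.keys Q.
      (Poly_Mapping.lookup P n * z powi n) * (Poly_Mapping.lookup Q m * z powi m))"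
    using assms by (simp add: lp_sum lp_single mult_single power_int_add mult_ac)
  thus ?thesis by (simp add: lp_def sum_product)
qed

lemma lp_holomorphic [holomorphic_intros]: "0 \<notin> A \<Longrightarrow> lp L holomorphic_on A"
  unfolding lp_def[abs_def] by (intro holomorphic_intros) auto

lemma laurent_funI: "(\<And>z. z \<noteq> 0 \<Longrightarrow> f z = lp L z) \<Longrightarrow> f \<in> laurent_fun"
  by (auto simp: laurent_fun_def)

lemma laurent_fun_lp [simp]: "lp L \<in> laurent_fun" "(\<lambda>z. lp L z) \<in> laurent_fun"
  by (auto simp: laurent_fun_def)

lemma laurent_fun_add: "f \<in> laurent_fun \<Longrightarrow> g \<in> laurent_fun \<Longrightarrow> (\<lambda>z. f z + g z) \<in> laurent_fun"
  by (force simp: laurent_fun_def simp flip: lp_add)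

lemma laurent_fun_mult: "f \<in> laurent_fun \<Longrightarrow> g \<in> laurent_fun \<Longrightarrow> (\<lambda>z. f z * g z) \<in> laurent_fun"
  by (force simp: laurent_fun_def simp flip: lp_mult)

lemma laurent_fun_powi: "(\<lambda>z. z powi n) \<in> laurent_fun"
  by (rule laurent_funI[of _ "Poly_Mapping.single n 1"]) (simp add: lp_single)

lemma laurent_fun_const [simp]: "(\<lambda>z. c) \<in> laurent_fun"
  by (rule laurent_funI[of _ "Poly_Mapping.single 0 c"]) (simp add: lp_single)

lemma laurent_fun_cmult: "f \<in> laurent_fun \<Longrightarrow> (\<lambda>z. c * f z) \<in> laurent_fun"
  by (intro laurent_fun_mult laurent_fun_const)

lemma laurent_fun_sum:
  "(\<And>i. i \<in> I \<Longrightarrow> f i \<in> laurent_fun) \<Longrightarrow> (\<lambda>z. \<Sum>i\<in>I. f i z) \<in> laurent_fun"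
  by (induction I rule: infinite_finite_induct) (auto intro: laurent_fun_add)

lemma laurent_fun_cong:
  "f \<in> laurent_fun \<Longrightarrow> (\<And>z. z \<noteq> 0 \<Longrightarrow> g z = f z) \<Longrightarrow> g \<in> laurent_fun"
  by (auto simp: laurent_fun_def)

lemma laurent_fun_analytic:
  assumes "f \<in> laurent_fun" "z \<noteq> 0"
  shows "f analytic_on {z}"
proof -
  obtain L where L: "\<And>z. z \<noteq> 0 \<Longrightarrow> f z = lp L z" using assms(1) by (auto simp: laurent_fun_def)
  have "f holomorphic_on - {0}"
    by (subst holomorphic_cong[OF refl, of _ _ "lp L"]) (auto simp: L intro!: holomorphic_intros)
  thus ?thesis using assms(2) by (auto simp: analytic_at intro!: exI[of _ "- {0}"])
qed

subsection \<open>The filtration by the CMV basis\<close>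

definition cmv_exponent :: "nat \<Rightarrow> int" where
  "cmv_exponent n = (if even n then int (n div 2) else - int (n div 2) - 1)"

text \<open>Position of z^j in the CMV order of exponents 0, -1, 1, -2, 2, and so on.\<close>

definition cmv_index :: "int \<Rightarrow> nat" where
  "cmv_index j = (if j \<ge> 0 then nat (2 * j) else nat (- 2 * j - 1))"

lemma cmv_eq_powi: "cmv n z = z powi cmv_exponent n"
  by (simp add: cmv_def cmv_exponent_def)

lemma cmv_index_exponent: "cmv_exponent (cmv_index j) = j"
  by (auto simp: cmv_exponent_def cmv_index_def even_nat_iff nat_mult_distrib)

lemma cmv_fun [simp]: "cmv n \<in> laurent_fun"
  by (simp add: cmv_eq_powi[abs_def] laurent_fun_powi)

text \<open>The filtration respected by triangular changes of basis; it takes the place of the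
  polynomials of degree below \<open>n\<close>.\<close>

definition laurent_span :: "nat \<Rightarrow> (complex \<Rightarrow> complex) set" where
  "laurent_span n = {f. \<exists>c. \<forall>z. z \<noteq> 0 \<longrightarrow> f z = (\<Sum>k<n. c k * cmv k z)}"

lemma laurent_span_imp_fun:
  assumes "f \<in> laurent_span n"
  shows "f \<in> laurent_fun"
proof -
  obtain c where "\<And>z. z \<noteq> 0 \<Longrightarrow> f z = (\<Sum>k<n. c k * cmv k z)"
    using assms by (auto simp: laurent_span_def)
  moreover have "(\<lambda>z. \<Sum>k<n. c k * cmv k z) \<in> laurent_fun"
    by (intro laurent_fun_sum laurent_fun_cmult cmv_fun)
  ultimately show ?thesis by (rule laurent_fun_cong[rotated])
qed

lemma laurent_span_mono:
  assumes "f \<in> laurent_span m" "m \<le> n"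
  shows "f \<in> laurent_span n"
proof -
  obtain c where c: "\<And>z. z \<noteq> 0 \<Longrightarrow> f z = (\<Sum>k<m. c k * cmv k z)"
    using assms by (auto simp: laurent_span_def)
  have "(\<Sum>k<m. c k * cmv k z) = (\<Sum>k<n. (if k < m then c k else 0) * cmv k z)" for z
    using assms(2) by (intro sum.mono_neutral_cong_left) auto
  thus ?thesis using c unfolding laurent_span_def by auto
qed

lemma laurent_span_add:
  assumes "f \<in> laurent_span n" "g \<in> laurent_span n"
  shows "(\<lambda>z. f z + g z) \<in> laurent_span n"
proof -
  obtain c d where "\<And>z. z \<noteq> 0 \<Longrightarrow> f z = (\<Sum>k<n. c k * cmv k z)"
      "\<And>z. z \<noteq> 0 \<Longrightarrow> g z = (\<Sum>k<n. d k * cmv k z)"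
    using assms by (auto simp: laurent_span_def)
  thus ?thesis unfolding laurent_span_def
    by (auto intro!: exI[of _ "\<lambda>k. c k + d k"] simp: distrib_right sum.distrib)
qed

lemma laurent_span_cmult:
  assumes "f \<in> laurent_span n"
  shows "(\<lambda>z. a * f z) \<in> laurent_span n"
proof -
  obtain c where "\<And>z. z \<noteq> 0 \<Longrightarrow> f z = (\<Sum>k<n. c k * cmv k z)"
    using assms by (auto simp: laurent_span_def)
  thus ?thesis unfolding laurent_span_def
    by (auto intro!: exI[of _ "\<lambda>k. a * c k"] simp: sum_distrib_left mult.assoc)
qed

lemma laurent_span_zero [simp]: "(\<lambda>z. 0) \<in> laurent_span n"
  by (auto simp: laurent_span_def intro!: exI[of _ "\<lambda>_. 0"])

lemma laurent_span_sum:
  "(\<And>i. i \<in> I \<Longrightarrow> f i \<in> laurent_span n) \<Longrightarrow> (\<lambda>z. \<Sum>i\<in>I. f i z) \<in> laurent_span n"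
  by (induction I rule: infinite_finite_induct) (auto intro: laurent_span_add)

lemma laurent_span_cong:
  "f \<in> laurent_span n \<Longrightarrow> (\<And>z. z \<noteq> 0 \<Longrightarrow> g z = f z) \<Longrightarrow> g \<in> laurent_span n"
  by (auto simp: laurent_span_def)

lemma cmv_in_laurent_span:
  assumes "k < n"
  shows "cmv k \<in> laurent_span n"
proof -
  have "(\<Sum>j<n. (if j = k then 1 else 0) * cmv j z) = cmv k z" for z
    using assms by (subst sum.mono_neutral_cong_right[of _ "{k}"]) auto
  thus ?thesis unfolding laurent_span_def by (auto intro!: exI[of _ "\<lambda>j. if j = k then 1 else 0"])
qed

lemma powi_in_laurent_span:
  assumes "cmv_index j < n"
  shows "(\<lambda>z. z powi j) \<in> laurent_span n"
  using cmv_in_laurent_span[OF assms] by (simp add: cmv_eq_powi[abs_def] cmv_index_exponent)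

lemma prepared_eq_sum:
  "prepared L N \<Longrightarrow> lp L z = (\<Sum>p\<in>{-int N..int N}. Poly_Mapping.lookup L p * z powi p)"
  by (rule lp_eq_sum) (auto simp: prepared_def)

text \<open>For even \<open>l\<close> the exponent of \<open>cmv l\<close> is nonnegative and grows
  fastest by adding \<open>N\<close>; for odd \<open>l\<close> it is negative and the extreme is
  reached by subtracting \<open>N\<close>. Each unit of exponent in the outward direction is two
  units of CMV index.\<close>

lemma cmv_index_shift:
  assumes "p \<in> {-int N..int N}"
  shows "cmv_index (p + cmv_exponent l) \<le> l + 2 * N"
    and "p \<noteq> (-1) ^ l * int N \<Longrightarrow> cmv_index (p + cmv_exponent l) < l + 2 * N"
  using assms by (auto simp: cmv_index_def cmv_exponent_def elim!: evenE oddE)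

lemma cmv_shift_top:
  assumes "N \<ge> 1"
  shows "(-1) ^ l * int N + cmv_exponent l = cmv_exponent (l + 2 * N)"
  by (auto simp: cmv_exponent_def elim!: evenE oddE)

text \<open>Source of the constants with subscript (-1)^l N in the theorem: exactly one monomial of
  the product attains the top CMV index.\<close>

lemma prepared_mult_cmv:
  assumes "prepared L N"
  obtains g where "g \<in> laurent_span (l + 2 * N)"
    "\<And>z. z \<noteq> 0 \<Longrightarrow> lp L z * cmv l z = Poly_Mapping.lookup L ((-1) ^ l * int N) * cmv (l + 2 * N) z + g z"
proof
  let ?t = "(-1) ^ l * int N"
  let ?I = "{-int N..int N}"
  have N: "N \<ge> 1" using assms by (simp add: prepared_def)
  have t: "?t \<in> ?I" by (cases "even l") auto
  let ?g = "\<lambda>z. \<Sum>p\<in>?I - {?t}. Poly_Mapping.lookup L p * z powi (p + cmv_exponent l)"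
  show "?g \<in> laurent_span (l + 2 * N)"
    by (intro laurent_span_sum laurent_span_cmult powi_in_laurent_span cmv_index_shift) auto
  fix z :: complex assume z: "z \<noteq> 0"
  have "lp L z * cmv l z = (\<Sum>p\<in>?I. Poly_Mapping.lookup L p * z powi (p + cmv_exponent l))"
    using z by (simp add: prepared_eq_sum[OF assms] cmv_eq_powi sum_distrib_right power_int_add mult.assoc)
  also have "\<dots> = Poly_Mapping.lookup L ?t * z powi (?t + cmv_exponent l) + ?g z"
    by (rule sum.remove) (use t in auto)
  finally show "lp L z * cmv l z = Poly_Mapping.lookup L ?t * cmv (l + 2 * N) z + ?g z"
    by (simp only: cmv_shift_top[OF N] cmv_eq_powi)
qed

lemma prepared_mult_span:
  assumes "prepared L N" "f \<in> laurent_span n"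
  shows "(\<lambda>z. lp L z * f z) \<in> laurent_span (n + 2 * N)"
proof -
  obtain c where c: "\<And>z. z \<noteq> 0 \<Longrightarrow> f z = (\<Sum>k<n. c k * cmv k z)"
    using assms by (auto simp: laurent_span_def)
  have *: "(\<lambda>z. lp L z * cmv k z) \<in> laurent_span (n + 2 * N)" if "k < n" for k
  proof -
    obtain g where g: "g \<in> laurent_span (k + 2 * N)"
      "\<And>z. z \<noteq> 0 \<Longrightarrow> lp L z * cmv k z = Poly_Mapping.lookup L ((-1) ^ k * int N) * cmv (k + 2 * N) z + g z"
      using prepared_mult_cmv[OF assms(1), of k thesis] by blast
    show ?thesis
      by (rule laurent_span_cong[OF _ g(2)])
         (use g(1) that in \<open>auto intro!: laurent_span_add laurent_span_cmult cmv_in_laurent_span elim: laurent_span_mono\<close>)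
  qed
  have "(\<lambda>z. \<Sum>k<n. c k * (lp L z * cmv k z)) \<in> laurent_span (n + 2 * N)"
    by (intro laurent_span_sum laurent_span_cmult *) auto
  thus ?thesis
    by (rule laurent_span_cong) (simp add: c sum_distrib_left mult_ac)
qed

text \<open>Dividing by x - y leaves exponents of y between -N and N - 1, which are precisely the
  first 2N in the CMV order. The product form of the identity needs no separate case y = x.\<close>

lemma powi_divided_difference:
  assumes "x \<noteq> 0" "p \<in> {-int N..int N}"
  obtains d where "d \<in> laurent_span (2 * N)"
    "\<And>y. y \<noteq> 0 \<Longrightarrow> (x - y) * d y = x powi p - y powi p"
proof (cases "p \<ge> 0")
  case True
  define n where "n = nat p"
  have p: "p = int n" using True by (simp add: n_def)
  show ?thesis
  proof
    show "(\<lambda>y. \<Sum>i<n. x ^ i * y powi int (n - Suc i)) \<in> laurent_span (2 * N)"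
      using assms(2) p by (intro laurent_span_sum laurent_span_cmult powi_in_laurent_span) (auto simp: cmv_index_def)
    show "(x - y) * (\<Sum>i<n. x ^ i * y powi int (n - Suc i)) = x powi p - y powi p" for y
      by (simp add: p power_diff_sumr2 mult.commute del: of_nat_diff)
  qed
next
  case False
  define n where "n = nat (-p)"
  have p: "p = - int n" using False by (simp add: n_def)
  show ?thesis
  proof
    \<comment> \<open>This sum is found from x^(-n) - y^(-n) = - (x y)^(-n) (x^n - y^n) and the
      geometric sum for the positive power.\<close>
    show "(\<lambda>y. \<Sum>i<n. (- (x powi (int i - int n))) * y powi (- 1 - int i)) \<in> laurent_span (2 * N)"
      using assms(2) p by (intro laurent_span_sum laurent_span_cmult powi_in_laurent_span) (auto simp: cmv_index_def)
    fix y :: complex assume y: "y \<noteq> 0"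
    have "(\<Sum>i<n. (- (x powi (int i - int n))) * y powi (- 1 - int i)) =
        - (x powi (- int n) * y powi (- int n)) * (\<Sum>i<n. y ^ (n - Suc i) * x ^ i)"
    proof (subst sum_distrib_left, rule sum.cong[OF refl])
      fix i assume i: "i \<in> {..<n}"
      have e: "y powi (- 1 - int i) = y powi (- int n) * y ^ (n - Suc i)"
        using i y by (subst power_int_of_nat[symmetric], subst power_int_add[symmetric]) (auto intro!: arg_cong[where f="power_int y"])
      have "x powi (int i - int n) = x powi (- int n) * x ^ i"
        using assms(1) by (subst power_int_of_nat[symmetric], subst power_int_add[symmetric]) auto
      thus "(- (x powi (int i - int n))) * y powi (- 1 - int i) =
        - (x powi (- int n) * y powi (- int n)) * (y ^ (n - Suc i) * x ^ i)" by (simp add: e)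
    qed
    hence "(x - y) * (\<Sum>i<n. (- (x powi (int i - int n))) * y powi (- 1 - int i)) =
        - (x powi (- int n) * y powi (- int n)) * (x ^ n - y ^ n)"
      by (simp add: power_diff_sumr2 mult_ac)
    also have "\<dots> = x powi p - y powi p"
      using assms(1) y by (simp add: p power_int_minus field_simps)
    finally show "(x - y) * (\<Sum>i<n. (- (x powi (int i - int n))) * y powi (- 1 - int i)) = x powi p - y powi p" .
  qed
qed

text \<open>The bound \<open>2 * N\<close> is what later meets the assumption
  \<open>2 * NG \<le> l\<close>: below index \<open>l\<close> the perturbed polynomial is orthogonal
  to everything.\<close>

lemma prepared_divided_difference:
  assumes "prepared L N" "x \<noteq> 0"
  obtains d where "d \<in> laurent_span (2 * N)"
    "\<And>y. y \<noteq> 0 \<Longrightarrow> (x - y) * d y = lp L x - lp L y"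
proof -
  have "\<exists>d. d \<in> laurent_span (2 * N) \<and> (\<forall>y. y \<noteq> 0 \<longrightarrow> (x - y) * d y = x powi p - y powi p)"
    if "p \<in> {-int N..int N}" for p
    using powi_divided_difference[OF assms(2) that] by blast
  then obtain d where d: "\<And>p. p \<in> {-int N..int N} \<Longrightarrow> d p \<in> laurent_span (2 * N)"
    "\<And>p y. p \<in> {-int N..int N} \<Longrightarrow> y \<noteq> 0 \<Longrightarrow> (x - y) * d p y = x powi p - y powi p"
    by metis
  show ?thesis
  proof
    show "(\<lambda>y. \<Sum>p\<in>{-int N..int N}. Poly_Mapping.lookup L p * d p y) \<in> laurent_span (2 * N)"
      by (intro laurent_span_sum laurent_span_cmult d)
    show "(x - y) * (\<Sum>p\<in>{-int N..int N}. Poly_Mapping.lookup L p * d p y) = lp L x - lp L y"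
      if "y \<noteq> 0" for y
      by (simp add: prepared_eq_sum[OF assms(1)] sum_distrib_left mult.left_commute[of "x - y"] d that right_diff_distrib sum_subtractf)
  qed
qed

subsection \<open>Taylor coefficients and jets\<close>

lemma fps_nth_fps_expansion_eq: "fps_nth (fps_expansion f z) n = (deriv ^^ n) f z / fact n"
  by (simp add: fps_expansion_def)

lemma fps_expansion_eqI:
  assumes "(\<lambda>w. f (z + w)) has_fps_expansion F"
  shows "fps_expansion f z = F"
proof (rule fps_ext)
  fix n
  have "(deriv ^^ n) f z = (deriv ^^ n) (\<lambda>w. f (z + w)) 0"
    by (subst higher_deriv_shift_0) (simp add: o_def)
  thus "fps_nth (fps_expansion f z) n = fps_nth F n"
    using fps_nth_fps_expansion[OF assms, of n] by (simp add: fps_nth_fps_expansion_eq)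
qed

lemma fps_expansion_add:
  assumes "f analytic_on {z}" "g analytic_on {z}"
  shows "fps_expansion (\<lambda>w. f w + g w) z = fps_expansion f z + fps_expansion g z"
  by (rule fps_expansion_eqI)
     (use assms in \<open>auto intro!: has_fps_expansion_add analytic_at_imp_has_fps_expansion\<close>)

lemma fps_expansion_mult:
  assumes "f analytic_on {z}" "g analytic_on {z}"
  shows "fps_expansion (\<lambda>w. f w * g w) z = fps_expansion f z * fps_expansion g z"
  by (rule fps_expansion_eqI)
     (use assms in \<open>auto intro!: has_fps_expansion_mult analytic_at_imp_has_fps_expansion\<close>)

lemma fps_expansion_const: "fps_expansion (\<lambda>w. c) z = fps_const c"
  by (rule fps_expansion_eqI) auto

lemma fps_expansion_cmult:
  assumes "f analytic_on {z}"
  shows "fps_expansion (\<lambda>w. c * f w) z = fps_const c * fps_expansion f z"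
  using assms by (simp add: fps_expansion_mult fps_expansion_const)

lemma fps_expansion_sum:
  assumes "\<And>i. i \<in> I \<Longrightarrow> f i analytic_on {z}"
  shows "fps_expansion (\<lambda>w. \<Sum>i\<in>I. f i w) z = (\<Sum>i\<in>I. fps_expansion (f i) z)"
  by (rule fps_expansion_eqI)
     (use assms in \<open>auto intro!: has_fps_expansion_sum analytic_at_imp_has_fps_expansion\<close>)

lemma fps_expansion_linear_power: "fps_expansion (\<lambda>w. (w - z) ^ m) z = fps_X ^ m"
  by (rule fps_expansion_eqI) (auto intro!: has_fps_expansion_fps_X_power)

text \<open>Agreement near \<open>z\<close> suffices. This matters because Laurent identities are
  known only off the origin, and those of second kind functions only for poles off the conjugated
  support.\<close>

lemma taylor_sum:
  assumes "\<And>i. i \<in> I \<Longrightarrow> f i analytic_on {z}"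
    "\<forall>\<^sub>F w in nhds z. g w = (\<Sum>i\<in>I. c i * f i w)"
  shows "fps_nth (fps_expansion g z) n = (\<Sum>i\<in>I. c i * fps_nth (fps_expansion (f i) z) n)"
proof -
  have "fps_expansion g z = fps_expansion (\<lambda>w. \<Sum>i\<in>I. c i * f i w) z"
    using assms(2) by (rule fps_expansion_cong)
  also have "\<dots> = (\<Sum>i\<in>I. fps_const (c i) * fps_expansion (f i) z)"
    using assms(1) by (subst fps_expansion_sum) (auto intro!: analytic_intros sum.cong simp: fps_expansion_cmult)
  finally show ?thesis by (simp add: fps_sum_nth)
qed

lemma taylor_factor:
  assumes "g analytic_on {z}" "\<forall>\<^sub>F w in nhds z. f w = (w - z) ^ m * g w"
  shows "fps_nth (fps_expansion f z) n = (if n < m then 0 else fps_nth (fps_expansion g z) (n - m))"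
proof -
  have "fps_expansion f z = fps_expansion (\<lambda>w. (w - z) ^ m * g w) z"
    using assms(2) by (rule fps_expansion_cong)
  also have "\<dots> = fps_X ^ m * fps_expansion g z"
    using assms(1) by (subst fps_expansion_mult) (auto intro!: analytic_intros simp: fps_expansion_linear_power)
  finally show ?thesis by (simp add: fps_X_power_mult_nth)
qed

lemma conj_fun_eq: "conj_fun f = cnj \<circ> f \<circ> cnj"
  by (auto simp: conj_fun_def fun_eq_iff)

lemma open_cnj_image: "open A \<Longrightarrow> open (cnj ` A)"
proof -
  assume "open A"
  moreover have "cnj ` A = cnj -` A" by (force simp: image_iff)
  ultimately show ?thesis by (simp add: open_vimage continuous_on_cnj)
qed

lemma conj_fun_analytic:
  assumes "f analytic_on {z}"
  shows "conj_fun f analytic_on {cnj z}"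
proof -
  obtain A where A: "open A" "z \<in> A" "f holomorphic_on A"
    using assms by (auto simp: analytic_at)
  have "conj_fun f holomorphic_on cnj ` A"
    unfolding conj_fun_eq using A by (intro holomorphic_on_compose_cnj_cnj open_cnj_image) (auto simp: image_image)
  thus ?thesis using A open_cnj_image[OF A(1)] by (auto simp: analytic_at)
qed

text \<open>An open set instead of a single point lets the induction differentiate: the identity for
  \<open>n\<close> must hold on a whole neighbourhood.\<close>

lemma higher_deriv_conj_fun:
  assumes "open A" "f holomorphic_on A" "z \<in> A"
  shows "(deriv ^^ n) (conj_fun f) (cnj z) = cnj ((deriv ^^ n) f z)"
  using assms(3)
proof (induction n arbitrary: z)
  case 0
  thus ?case by (simp add: conj_fun_def)
next
  case (Suc n)
  let ?g = "(deriv ^^ n) f"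
  have "(?g has_field_derivative deriv ?g z) (at z)"
    using assms Suc.prems by (intro holomorphic_derivI[of _ A] holomorphic_higher_deriv) auto
  hence "((cnj \<circ> ?g \<circ> cnj) has_field_derivative cnj (deriv ?g z)) (at (cnj z))"
    by (intro has_field_derivative_cnj_cnj) simp
  moreover have "\<forall>\<^sub>F w in nhds (cnj z). (deriv ^^ n) (conj_fun f) w = (cnj \<circ> ?g \<circ> cnj) w"
  proof (rule eventually_nhds_in_open[OF open_cnj_image[OF assms(1)], THEN eventually_mono])
    show "cnj z \<in> cnj ` A" using Suc.prems by auto
    show "(deriv ^^ n) (conj_fun f) w = (cnj \<circ> ?g \<circ> cnj) w" if "w \<in> cnj ` A" for w
      using that Suc.IH by auto
  qed
  ultimately have "((deriv ^^ n) (conj_fun f) has_field_derivative cnj (deriv ?g z)) (at (cnj z))"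
    using DERIV_cong_ev[OF refl _ refl] by blast
  thus ?case by (simp add: DERIV_imp_deriv)
qed

lemma taylor_conj_fun:
  assumes "f analytic_on {z}"
  shows "fps_nth (fps_expansion (conj_fun f) (cnj z)) n = cnj (fps_nth (fps_expansion f z) n)"
proof -
  obtain A where "open A" "z \<in> A" "f holomorphic_on A"
    using assms by (auto simp: analytic_at)
  thus ?thesis by (simp add: fps_nth_fps_expansion_eq higher_deriv_conj_fun)
qed

text \<open>Entry number \<open>r\<close> of a jet or of a mass vector belongs to
  \<open>slots zs ! r\<close>, the pair of the number of a zero and a derivative order. Conjugating
  the zeros leaves this list unchanged, so both kinds of vectors share one numbering.\<close>

definition slots :: "(complex \<times> nat) list \<Rightarrow> (nat \<times> nat) list" where
  "slots zs = concat (map (\<lambda>i. map (Pair i) [0..<snd (zs ! i)]) [0..<length zs])"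

lemma set_slots: "(i, l) \<in> set (slots zs) \<longleftrightarrow> i < length zs \<and> l < snd (zs ! i)"
  by (auto simp: slots_def image_iff)

lemma slots_conj_zeros [simp]: "slots (conj_zeros zs) = slots zs"
  by (auto simp: slots_def conj_zeros_def split_beta intro!: arg_cong[where f=concat])

lemma fst_conj_zeros: "i < length zs \<Longrightarrow> fst (conj_zeros zs ! i) = cnj (fst (zs ! i))"
  by (simp add: conj_zeros_def split_beta)

lemma length_slots: "length (slots zs) = (\<Sum>i<length zs. snd (zs ! i))"
  by (simp add: slots_def length_concat o_def sum_list_distinct_conv_sum_set atLeast0LessThan)

lemma concat_map_slots:
  "concat (map (\<lambda>i. map (h i) [0..<snd (zs ! i)]) [0..<length zs]) = map (\<lambda>(i, l). h i l) (slots zs)"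
  by (simp add: slots_def map_concat o_def)

lemma jet_eq_slots:
  "jet zs f = vec_of_list (map (\<lambda>(i, l). fps_nth (fps_expansion f (fst (zs ! i))) l) (slots zs))"
proof -
  have "map (\<lambda>(\<zeta>, m). map (\<lambda>l. (deriv ^^ l) f \<zeta> / fact l) [0..<m]) zs =
      map (\<lambda>i. map (\<lambda>l. fps_nth (fps_expansion f (fst (zs ! i))) l) [0..<snd (zs ! i)]) [0..<length zs]"
    by (intro nth_equalityI) (auto simp: split_beta fps_nth_fps_expansion_eq)
  thus ?thesis by (simp add: jet_def concat_map_slots)
qed

lemma masses_eq_slots: "masses \<xi> zs f = vec_of_list (map (\<lambda>(i, l). \<xi> i l f) (slots zs))"
  by (simp add: masses_def concat_map_slots[symmetric])

lemma dim_jet [simp]: "dim_vec (jet zs f) = length (slots zs)"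
  by (simp add: jet_eq_slots)

lemma dim_masses [simp]: "dim_vec (masses \<xi> zs f) = length (slots zs)"
  by (simp add: masses_eq_slots)

lemma jet_nth:
  assumes "r < length (slots zs)" "slots zs ! r = (i, l)"
  shows "vec_index (jet zs f) r = fps_nth (fps_expansion f (fst (zs ! i))) l"
  using assms by (simp add: jet_eq_slots vec_of_list_index)

lemma masses_nth:
  assumes "r < length (slots zs)" "slots zs ! r = (i, l)"
  shows "vec_index (masses \<xi> zs f) r = \<xi> i l f"
  using assms by (simp add: masses_eq_slots vec_of_list_index)

lemma row_mult_block:
  fixes M :: "complex mat"
  assumes "M \<in> carrier_mat d d"
  shows "row_mult (vec_of_list (map v [0..<d])) M =
    vec_of_list (map (\<lambda>q. \<Sum>p<d. v p * M $$ (p, q)) [0..<d])"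
  unfolding row_mult_def using assms
  by (intro eq_vecI) (auto simp: vec_of_list_index scalar_prod_def atLeast0LessThan mult.commute intro!: sum.cong)

lemma vec_of_list_append': "vec_of_list (xs @ ys) = vec_of_list xs @\<^sub>v vec_of_list ys"
  by (intro eq_vecI) (auto simp: vec_of_list_index nth_append)

lemma row_mult_diag_block:
  fixes M :: "nat \<Rightarrow> complex mat"
  assumes "\<And>j. j \<in> set js \<Longrightarrow> M j \<in> carrier_mat (d j) (d j)"
  shows "row_mult (vec_of_list (concat (map (\<lambda>j. map (v j) [0..<d j]) js))) (diag_block_mat (map M js)) =
    vec_of_list (concat (map (\<lambda>j. map (\<lambda>q. \<Sum>p<d j. v j p * M j $$ (p, q)) [0..<d j]) js))"
  using assms
proof (induction js)
  case Nil
  show ?case by (intro eq_vecI) (auto simp: row_mult_def)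
next
  case (Cons j js)
  let ?w = "\<lambda>js. concat (map (\<lambda>j. map (v j) [0..<d j]) js)"
  let ?D = "diag_block_mat (map M js)"
  let ?s = "sum_list (map d js)"
  have M: "M j \<in> carrier_mat (d j) (d j)" using Cons.prems by simp
  have dims: "map dim_row (map M js) = map d js" "map dim_col (map M js) = map d js"
    using Cons.prems by auto
  have D: "?D \<in> carrier_mat ?s ?s"
    by (rule carrier_matI) (simp_all only: dim_diag_block_mat dims)
  have w: "vec_of_list (?w js) \<in> carrier_vec ?s"
    by (rule carrier_vecI) (simp add: length_concat o_def)
  have "row_mult (vec_of_list (?w (j # js))) (diag_block_mat (map M (j # js))) =
     (four_block_mat (M j) (0\<^sub>m (d j) ?s) (0\<^sub>m ?s (d j)) ?D)\<^sup>T *\<^sub>v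
       (vec_of_list (map (v j) [0..<d j]) @\<^sub>v vec_of_list (?w js))"
    using M D by (simp add: row_mult_def vec_of_list_append' Let_def)
  also have "(four_block_mat (M j) (0\<^sub>m (d j) ?s) (0\<^sub>m ?s (d j)) ?D)\<^sup>T =
      four_block_mat (M j)\<^sup>T (0\<^sub>m (d j) ?s) (0\<^sub>m ?s (d j)) ?D\<^sup>T"
    by (subst transpose_four_block_mat[OF M _ _ D]) auto
  also have "\<dots> *\<^sub>v (vec_of_list (map (v j) [0..<d j]) @\<^sub>v vec_of_list (?w js)) =
     row_mult (vec_of_list (map (v j) [0..<d j])) (M j) @\<^sub>v row_mult (vec_of_list (?w js)) ?D"
  proof (subst four_block_mat_mult_vec[of _ "d j" "d j" _ ?s _ ?s])
    have "0\<^sub>m (d j) ?s *\<^sub>v vec_of_list (?w js) = 0\<^sub>v (d j)"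
      "0\<^sub>m ?s (d j) *\<^sub>v vec_of_list (map (v j) [0..<d j]) = 0\<^sub>v ?s"
      using w carrier_vecI[of "vec_of_list (map (v j) [0..<d j])" "d j"]
      by (auto intro!: eq_vecI simp del: vec_of_list_map)
    thus "((M j)\<^sup>T *\<^sub>v vec_of_list (map (v j) [0..<d j]) + 0\<^sub>m (d j) ?s *\<^sub>v vec_of_list (?w js)) @\<^sub>v
        (0\<^sub>m ?s (d j) *\<^sub>v vec_of_list (map (v j) [0..<d j]) + ?D\<^sup>T *\<^sub>v vec_of_list (?w js)) =
      row_mult (vec_of_list (map (v j) [0..<d j])) (M j) @\<^sub>v row_mult (vec_of_list (?w js)) ?D"
      using M D by (simp add: row_mult_def del: vec_of_list_map) (auto intro!: arg_cong2[where f = append_vec] eq_vecI)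
  qed (use M D w in \<open>auto intro!: carrier_vecI\<close>)
  also have "row_mult (vec_of_list (?w js)) ?D =
      vec_of_list (concat (map (\<lambda>j. map (\<lambda>q. \<Sum>p<d j. v j p * M j $$ (p, q)) [0..<d j]) js))"
    by (rule Cons.IH) (use Cons.prems in auto)
  finally show ?case
    by (simp add: row_mult_block[OF M] vec_of_list_append' del: vec_of_list_map diag_block_mat.simps)
qed

text \<open>Block diagonality confines the entry for slot \<open>(j, q)\<close> to the masses at
  zero number \<open>j\<close>; each block is a Hankel matrix that vanishes above the
  antidiagonal.\<close>

lemma masses_mult_taylor:
  "row_mult (vec_of_list (map (\<lambda>(i, l). v i l) (slots zs))) (taylor_mat L N zs) =
    vec_of_list (map (\<lambda>(j, q). \<Sum>p<snd (zs ! j). v j p *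
      (if p + q \<ge> snd (zs ! j) - 1 then taylor_coeff L N zs j (p + q - (snd (zs ! j) - 1)) else 0)) (slots zs))"
  (is "_ = vec_of_list (map (\<lambda>(j, q). \<Sum>p<?m j. v j p * ?e j p q) _)")
proof -
  let ?M = "\<lambda>j. Matrix.mat (?m j) (?m j) (\<lambda>(p, q). ?e j p q)"
  have "row_mult (vec_of_list (concat (map (\<lambda>j. map (v j) [0..<?m j]) [0..<length zs])))
      (diag_block_mat (map ?M [0..<length zs])) =
    vec_of_list (concat (map (\<lambda>j. map (\<lambda>q. \<Sum>p<?m j. v j p * ?M j $$ (p, q)) [0..<?m j]) [0..<length zs]))"
    by (rule row_mult_diag_block) auto
  also have "concat (map (\<lambda>j. map (\<lambda>q. \<Sum>p<?m j. v j p * ?M j $$ (p, q)) [0..<?m j]) [0..<length zs]) =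
      concat (map (\<lambda>j. map (\<lambda>q. \<Sum>p<?m j. v j p * ?e j p q) [0..<?m j]) [0..<length zs])"
    by (intro arg_cong[where f = concat] map_cong sum.cong refl) auto
  finally show ?thesis
    by (simp add: taylor_mat_def Let_def concat_map_slots)
qed

lemma dim_taylor_mat:
  "dim_row (taylor_mat L N zs) = length (slots zs)" "dim_col (taylor_mat L N zs) = length (slots zs)"
  by (simp_all add: taylor_mat_def dim_diag_block_mat Let_def o_def length_slots
      sum_list_distinct_conv_sum_set atLeast0LessThan)

subsection \<open>Zeros of a prepared Laurent polynomial\<close>

context
  fixes L :: "int \<Rightarrow>\<^sub>0 complex" and N :: nat and zs :: "(complex \<times> nat) list"
  assumes prepared: "prepared L N" and enum: "zeros_enum L zs"
begin

text \<open>Multiplication by z^N clears the negative exponents. As both end coefficients are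
  nonzero, the degree is exactly \<open>2 * N\<close> and no root is lost at the origin.\<close>

lemma prepared_as_poly:
  obtains p :: "complex poly" where "Polynomial.degree p = 2 * N"
    "Polynomial.lead_coeff p = Poly_Mapping.lookup L (int N)" "p \<noteq> 0" "poly p 0 \<noteq> 0"
    "\<And>z. z \<noteq> 0 \<Longrightarrow> lp L z = z powi (- int N) * poly p z"
proof
  define p where "p = (\<Sum>i\<le>2 * N. Polynomial.monom (Poly_Mapping.lookup L (int i - int N)) i)"
  have coeff: "Polynomial.coeff p i = (if i \<le> 2 * N then Poly_Mapping.lookup L (int i - int N) else 0)" for i
    by (simp add: p_def coeff_sum)
  have top: "Poly_Mapping.lookup L (int N) \<noteq> 0" "Poly_Mapping.lookup L (- int N) \<noteq> 0"
    using prepared by (auto simp: prepared_def)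
  show deg: "Polynomial.degree p = 2 * N"
  proof (rule antisym)
    show "Polynomial.degree p \<le> 2 * N" by (rule degree_le) (simp add: coeff)
    show "2 * N \<le> Polynomial.degree p" by (rule le_degree) (use top in \<open>simp add: coeff\<close>)
  qed
  show lead: "Polynomial.lead_coeff p = Poly_Mapping.lookup L (int N)" by (simp add: deg coeff)
  show "p \<noteq> 0" using lead top by auto
  show "poly p 0 \<noteq> 0" using top by (simp add: poly_0_coeff_0 coeff)
  fix z :: complex assume z: "z \<noteq> 0"
  have "lp L z = (\<Sum>i\<le>2 * N. Poly_Mapping.lookup L (int i - int N) * z powi (int i - int N))"
    unfolding prepared_eq_sum[OF prepared]
    by (rule sum.reindex_bij_witness[of _ "\<lambda>i. int i - int N" "\<lambda>j. nat (j + int N)"]) auto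
  also have "\<dots> = z powi (- int N) * poly p z"
    using z by (simp add: p_def poly_sum poly_monom sum_distrib_left power_int_diff power_int_minus field_simps)
  finally show "lp L z = z powi (- int N) * poly p z" .
qed

lemma zeros_props:
  assumes "j < length zs"
  shows zero_nonzero: "fst (zs ! j) \<noteq> 0" and zero_root: "lp L (fst (zs ! j)) = 0"
    and zero_order: "int (snd (zs ! j)) = zorder (lp L) (fst (zs ! j))"
proof -
  have "zs ! j \<in> set zs" using assms by simp
  hence "fst (zs ! j) \<in> lp_zeros L" "int (snd (zs ! j)) = zorder (lp L) (fst (zs ! j))"
    using enum by (auto simp: zeros_enum_def)
  thus "fst (zs ! j) \<noteq> 0" "lp L (fst (zs ! j)) = 0" "int (snd (zs ! j)) = zorder (lp L) (fst (zs ! j))"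
    by (auto simp: lp_zeros_def)
qed

lemma zeros_distinct:
  assumes "i < length zs" "j < length zs" "i \<noteq> j"
  shows "fst (zs ! i) \<noteq> fst (zs ! j)"
  using assms enum by (auto simp: zeros_enum_def distinct_conv_nth)

lemma zeros_bij: "bij_betw (\<lambda>j. fst (zs ! j)) {..<length zs} (lp_zeros L)"
proof (rule bij_betw_imageI)
  show "inj_on (\<lambda>j. fst (zs ! j)) {..<length zs}" by (rule inj_onI) (use zeros_distinct in blast)
  have "(\<lambda>j. fst (zs ! j)) ` {..<length zs} = fst ` set zs" by (auto simp: set_conv_nth)
  thus "(\<lambda>j. fst (zs ! j)) ` {..<length zs} = lp_zeros L" using enum by (simp add: zeros_enum_def)
qed

text \<open>Neither z^(-N) nor the cofactor of the full power of z - a vanishes at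
  \<open>a\<close>.\<close>

lemma zorder_eq_order:
  assumes p: "p \<noteq> 0" "\<And>z. z \<noteq> 0 \<Longrightarrow> lp L z = z powi (- int N) * poly p z" and a: "a \<noteq> 0"
  shows "zorder (lp L) a = int (Polynomial.order a p)"
proof -
  obtain q where q: "p = [:- a, 1:] ^ Polynomial.order a p * q" "\<not> [:- a, 1:] dvd q"
    using order_decomp[OF p(1)] by blast
  show ?thesis
  proof (rule zorder_eqI[of "- {0}"])
    show "(\<lambda>z. z powi (- int N) * poly q z) holomorphic_on - {0}" by (intro holomorphic_intros) auto
    show "a powi (- int N) * poly q a \<noteq> 0" using a q(2) by (simp add: poly_eq_0_iff_dvd)
    show "lp L w = w powi (- int N) * poly q w * (w - a) powi int (Polynomial.order a p)"
      if "w \<in> - {0}" for w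
      using that by (subst p(2), simp, subst q(1)) (simp add: poly_power mult_ac)
  qed (use a in auto)
qed

text \<open>The complex polynomial splits completely, with multiplicities measured by
  \<open>zorder\<close>. The total \<open>2 * N\<close> is the length of every jet and makes the
  determinants of the theorem square.\<close>

lemma prepared_factorization:
  shows sum_multiplicities: "(\<Sum>j<length zs. snd (zs ! j)) = 2 * N"
    and lp_eq_prod: "z \<noteq> 0 \<Longrightarrow> lp L z = Poly_Mapping.lookup L (int N) * z powi (- int N) * (\<Prod>j<length zs. (z - fst (zs ! j)) ^ snd (zs ! j))"
proof -
  obtain p where p: "Polynomial.degree p = 2 * N" "Polynomial.lead_coeff p = Poly_Mapping.lookup L (int N)"
    "p \<noteq> 0" "poly p 0 \<noteq> 0" "\<And>z. z \<noteq> 0 \<Longrightarrow> lp L z = z powi (- int N) * poly p z"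
    using prepared_as_poly by blast
  have "poly p x = 0 \<longleftrightarrow> x \<noteq> 0 \<and> lp L x = 0" for x
    using p(4) p(5)[of x] by (cases "x = 0") auto
  hence roots: "{z. poly p z = 0} = lp_zeros L"
    by (simp add: lp_zeros_def)
  have ord: "Polynomial.order (fst (zs ! j)) p = snd (zs ! j)" if "j < length zs" for j
    using zorder_eq_order[OF p(3,5) zero_nonzero[OF that]] zero_order[OF that] by simp
  have "p = Polynomial.smult (Polynomial.lead_coeff p) (\<Prod>z\<in>lp_zeros L. [:- z, 1:] ^ Polynomial.order z p)"
    using complex_poly_decompose[of p] by (simp add: roots)
  also have "(\<Prod>z\<in>lp_zeros L. [:- z, 1:] ^ Polynomial.order z p) =
      (\<Prod>j<length zs. [:- fst (zs ! j), 1:] ^ Polynomial.order (fst (zs ! j)) p)"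
    by (rule prod.reindex_bij_betw[OF zeros_bij, symmetric])
  also have "\<dots> = (\<Prod>j<length zs. [:- fst (zs ! j), 1:] ^ snd (zs ! j))"
    by (intro prod.cong refl) (simp add: ord)
  finally have eq: "p = Polynomial.smult (Poly_Mapping.lookup L (int N)) (\<Prod>j<length zs. [:- fst (zs ! j), 1:] ^ snd (zs ! j))"
    by (simp only: p(2))
  have "Poly_Mapping.lookup L (int N) \<noteq> 0" using prepared by (simp add: prepared_def)
  hence "Polynomial.degree p = Polynomial.degree (\<Prod>j<length zs. [:- fst (zs ! j), 1:] ^ snd (zs ! j))"
    by (subst eq) simp
  also have "\<dots> = (\<Sum>j<length zs. snd (zs ! j))"
    by (subst degree_prod_sum_eq) (auto simp: degree_power_eq)
  finally show "(\<Sum>j<length zs. snd (zs ! j)) = 2 * N" using p(1) by simp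
  show "lp L z = Poly_Mapping.lookup L (int N) * z powi (- int N) * (\<Prod>j<length zs. (z - fst (zs ! j)) ^ snd (zs ! j))" if "z \<noteq> 0"
    unfolding p(5)[OF that] by (subst eq) (simp add: poly_prod poly_power mult_ac)
qed

lemma length_slots_zeros: "length (slots zs) = 2 * N"
  by (simp add: length_slots sum_multiplicities)

lemma lp_eq_deflated:
  assumes "j < length zs" "z \<noteq> 0"
  shows "lp L z = (z - fst (zs ! j)) ^ snd (zs ! j) * deflated L N zs j z"
  unfolding lp_eq_prod[OF assms(2)] deflated_def
  using assms(1) by (subst prod.remove[of _ j]) (auto simp: mult_ac)

lemma deflated_analytic: "z \<noteq> 0 \<Longrightarrow> deflated L N zs i analytic_on {z}"
  unfolding deflated_def[abs_def] by (intro analytic_intros) auto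

text \<open>At a zero other than the deflated one the full factor survives. Masses at different
  zeros therefore do not mix below the multiplicity, which is why the matrix of Taylor coefficients
  is block diagonal.\<close>

lemma deflated_factor:
  assumes "i < length zs" "j < length zs" "i \<noteq> j"
  obtains g where "\<And>z. z \<noteq> 0 \<Longrightarrow> g analytic_on {z}"
    "\<And>z. deflated L N zs i z = (z - fst (zs ! j)) ^ snd (zs ! j) * g z"
proof
  let ?g = "\<lambda>z. Poly_Mapping.lookup L (int N) * z powi (- int N) *
     (\<Prod>k\<in>{..<length zs} - {i} - {j}. (z - fst (zs ! k)) ^ snd (zs ! k))"
  show "?g analytic_on {z}" if "z \<noteq> 0" for z
    using that by (intro analytic_intros) auto
  show "deflated L N zs i z = (z - fst (zs ! j)) ^ snd (zs ! j) * ?g z" for z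
    unfolding deflated_def using assms by (subst prod.remove[of _ j]) (auto simp: mult_ac)
qed

text \<open>In power series at the zero, with t = x - \<open>fst (zs ! j)\<close>, the identity
  reads (t - X) D = L(x) - X^m M, where M expands the deflated polynomial. Below order m this means
  t D_0 = L(x) and t D_n = D_(n-1), and L(x) is t^m times the deflated polynomial at x.\<close>

lemma divided_difference_taylor:
  assumes j: "j < length zs" and l: "l < snd (zs ! j)" and d: "d \<in> laurent_fun"
    and x: "x \<noteq> 0" "\<And>y. y \<noteq> 0 \<Longrightarrow> (x - y) * d y = lp L x - lp L y"
  shows "fps_nth (fps_expansion d (fst (zs ! j))) l =
    (x - fst (zs ! j)) ^ (snd (zs ! j) - 1 - l) * deflated L N zs j x"
proof -
  let ?z = "fst (zs ! j)"
  let ?m = "snd (zs ! j)"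
  let ?t = "x - ?z"
  let ?D = "fps_expansion d ?z"
  let ?M = "fps_expansion (deflated L N zs j) ?z"
  have z: "?z \<noteq> 0" by (rule zero_nonzero[OF j])
  have ev: "\<forall>\<^sub>F y in nhds ?z. y \<noteq> 0"
    using eventually_nhds_in_open[of "- {0}" ?z] z by auto
  have "(fps_const ?t - fps_X) * ?D = fps_expansion (\<lambda>y. (x - y) * d y) ?z"
  proof (subst fps_expansion_mult)
    show "d analytic_on {?z}" by (rule laurent_fun_analytic[OF d z])
    have "fps_expansion (\<lambda>y. x - y) ?z = fps_const ?t - fps_X"
    proof (rule fps_expansion_eqI)
      have "(\<lambda>w. ?t - w) has_fps_expansion fps_const ?t - fps_X"
        by (intro has_fps_expansion_diff has_fps_expansion_const has_fps_expansion_fps_X)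
      thus "(\<lambda>w. x - (?z + w)) has_fps_expansion fps_const ?t - fps_X"
        by (simp add: diff_diff_eq)
    qed
    thus "(fps_const ?t - fps_X) * ?D = fps_expansion (\<lambda>y. x - y) ?z * ?D" by simp
  qed (auto intro!: analytic_intros)
  also have "\<dots> = fps_expansion (\<lambda>y. lp L x + (- 1) * ((y - ?z) ^ ?m * deflated L N zs j y)) ?z"
    by (rule fps_expansion_cong, rule eventually_mono[OF ev]) (simp add: x(2) lp_eq_deflated[OF j])
  also have "\<dots> = fps_const (lp L x) + fps_const (- 1) * (fps_X ^ ?m * ?M)"
    using deflated_analytic[OF z, of j]
    by (subst fps_expansion_add, (auto intro!: analytic_intros)[2], subst fps_expansion_cmult,
        (auto intro!: analytic_intros)[1], subst fps_expansion_mult)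
       (auto intro!: analytic_intros simp: fps_expansion_const fps_expansion_linear_power)
  finally have eq: "(fps_const ?t - fps_X) * ?D = fps_const (lp L x) + fps_const (- 1) * (fps_X ^ ?m * ?M)" .
  have coeff: "?t * fps_nth ?D n - (if n = 0 then 0 else fps_nth ?D (n - 1)) =
      (if n = 0 then lp L x else 0) - (if n < ?m then 0 else fps_nth ?M (n - ?m))" for n
    using arg_cong[OF eq, of "\<lambda>F. fps_nth F n"]
    by (auto simp: left_diff_distrib fps_X_power_mult_nth)
  show ?thesis
  proof (cases "?t = 0")
    case True
    \<comment> \<open>Division by t is impossible here, but the identity becomes D = X^(m-1) M.
      Below order m only the coefficient at m - 1 can be nonzero, in accordance with
      \<open>0 ^ 0 = 1\<close>.\<close>
    have "lp L x = 0" using True zero_root[OF j] by simp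
    hence "fps_nth ?D l = (if Suc l < ?m then 0 else fps_nth ?M (Suc l - ?m))"
      using coeff[of "Suc l"] True by simp
    also have "\<dots> = ?t ^ (?m - 1 - l) * deflated L N zs j x"
      using True l by (auto simp: fps_nth_fps_expansion_eq)
    finally show ?thesis .
  next
    case False
    have "fps_nth ?D l = ?t ^ (?m - 1 - l) * deflated L N zs j x"
      using l
    proof (induction l)
      case 0
      have "?t * fps_nth ?D 0 = lp L x" using coeff[of 0] 0 by simp
      also have "\<dots> = ?t * (?t ^ (?m - 1) * deflated L N zs j x)"
        using lp_eq_deflated[OF j x(1)] 0 by (cases ?m) auto
      finally show ?case using False by simp
    next
      case (Suc l)
      have "?t * fps_nth ?D (Suc l) = fps_nth ?D l" using coeff[of "Suc l"] Suc.prems by simp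
      also have "\<dots> = ?t ^ (?m - 1 - l) * deflated L N zs j x" using Suc by simp
      also have "?m - 1 - l = Suc (?m - 1 - Suc l)" using Suc.prems by simp
      finally show ?case using False by simp
    qed
    thus ?thesis .
  qed
qed

end

subsection \<open>Sesquilinear forms on Laurent polynomials\<close>

text \<open>Forms act on total functions although only values off the origin have a meaning;
  \<open>form_cong\<close> removes the dependence on the value at 0.\<close>

locale laurent_form =
  fixes Q :: form
  assumes form_cong: "f \<in> laurent_fun \<Longrightarrow> g \<in> laurent_fun \<Longrightarrow> (\<And>z. z \<noteq> 0 \<Longrightarrow> f z = f' z) \<Longrightarrow> (\<And>z. z \<noteq> 0 \<Longrightarrow> g z = g' z) \<Longrightarrow> Q f g = Q f' g'"
    and form_add_left: "f \<in> laurent_fun \<Longrightarrow> f' \<in> laurent_fun \<Longrightarrow> g \<in> laurent_fun \<Longrightarrow>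
      Q (\<lambda>z. f z + f' z) g = Q f g + Q f' g"
    and form_cmult_left: "f \<in> laurent_fun \<Longrightarrow> g \<in> laurent_fun \<Longrightarrow> Q (\<lambda>z. c * f z) g = c * Q f g"
    and form_add_right: "f \<in> laurent_fun \<Longrightarrow> g \<in> laurent_fun \<Longrightarrow> g' \<in> laurent_fun \<Longrightarrow>
      Q f (\<lambda>z. g z + g' z) = Q f g + Q f g'"
    and form_cmult_right: "f \<in> laurent_fun \<Longrightarrow> g \<in> laurent_fun \<Longrightarrow> Q f (\<lambda>z. c * g z) = cnj c * Q f g"
begin

lemma form_zero_left: "g \<in> laurent_fun \<Longrightarrow> Q (\<lambda>z. 0) g = 0"
  using form_cmult_left[of "\<lambda>z. 0" g 0] by simp

lemma form_zero_right: "f \<in> laurent_fun \<Longrightarrow> Q f (\<lambda>z. 0) = 0"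
  using form_cmult_right[of f "\<lambda>z. 0" 0] by simp

lemma form_sum_left:
  assumes "\<And>i. i \<in> I \<Longrightarrow> f i \<in> laurent_fun" "g \<in> laurent_fun"
  shows "Q (\<lambda>z. \<Sum>i\<in>I. c i * f i z) g = (\<Sum>i\<in>I. c i * Q (f i) g)"
  using assms(1)
proof (induction I rule: infinite_finite_induct)
  case (insert i I)
  thus ?case using assms(2)
    by (simp add: form_add_left form_cmult_left laurent_fun_cmult laurent_fun_sum)
qed (use assms(2) in \<open>auto simp: form_zero_left\<close>)

lemma form_sum_right:
  assumes "\<And>i. i \<in> I \<Longrightarrow> g i \<in> laurent_fun" "f \<in> laurent_fun"
  shows "Q f (\<lambda>z. \<Sum>i\<in>I. c i * g i z) = (\<Sum>i\<in>I. cnj (c i) * Q f (g i))"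
  using assms(1)
proof (induction I rule: infinite_finite_induct)
  case (insert i I)
  thus ?case using assms(2)
    by (simp add: form_add_right form_cmult_right laurent_fun_cmult laurent_fun_sum)
qed (use assms(2) in \<open>auto simp: form_zero_right\<close>)

end

lemma cmv_comb_monic:
  assumes "lower_unitriangular A"
  obtains g where "g \<in> laurent_span k" "\<And>z. cmv_comb A k z = cmv k z + g z"
proof
  show "(\<lambda>z. \<Sum>j<k. A k j * cmv j z) \<in> laurent_span k" by (auto simp: laurent_span_def)
  show "cmv_comb A k z = cmv k z + (\<Sum>j<k. A k j * cmv j z)" for z
    using assms by (simp add: cmv_comb_def lower_unitriangular_def lessThan_Suc_atMost[symmetric])
qed

lemma cmv_comb_span:
  assumes "k < n"
  shows "cmv_comb A k \<in> laurent_span n"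
  unfolding cmv_comb_def[abs_def]
  using assms by (intro laurent_span_sum laurent_span_cmult cmv_in_laurent_span) auto

text \<open>Elimination from the top: subtracting the right multiple of the monic
  \<open>cmv_comb A n\<close> lowers the filtration by one.\<close>

lemma laurent_span_cmv_comb:
  assumes A: "lower_unitriangular A" and f: "f \<in> laurent_span n"
  obtains c where "\<And>z. z \<noteq> 0 \<Longrightarrow> f z = (\<Sum>k<n. c k * cmv_comb A k z)"
proof -
  have "\<exists>c. \<forall>z. z \<noteq> 0 \<longrightarrow> f z = (\<Sum>k<n. c k * cmv_comb A k z)"
    using f
  proof (induction n arbitrary: f)
    case 0
    thus ?case by (auto simp: laurent_span_def)
  next
    case (Suc n)
    then obtain a where a: "\<And>z. z \<noteq> 0 \<Longrightarrow> f z = (\<Sum>k<n. a k * cmv k z) + a n * cmv n z"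
      by (auto simp: laurent_span_def)
    obtain g where g: "g \<in> laurent_span n" "\<And>z. cmv_comb A n z = cmv n z + g z"
      using cmv_comb_monic[OF A] by blast
    have "(\<lambda>z. (\<Sum>k<n. a k * cmv k z) + (- a n) * g z) \<in> laurent_span n"
      by (intro laurent_span_add laurent_span_cmult g(1)) (auto simp: laurent_span_def)
    then obtain c where c: "\<And>z. z \<noteq> 0 \<Longrightarrow> (\<Sum>k<n. a k * cmv k z) + (- a n) * g z = (\<Sum>k<n. c k * cmv_comb A k z)"
      using Suc.IH by blast
    have "f z = (\<Sum>k<Suc n. (c(n := a n)) k * cmv_comb A k z)" if "z \<noteq> 0" for z
      using a[OF that] c[OF that] by (simp add: g(2) algebra_simps)
    thus ?case by blast
  qed
  thus ?thesis using that by blast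
qed

locale biorthogonal_form = laurent_form +
  fixes \<phi>1 \<phi>2 :: "nat \<Rightarrow> complex \<Rightarrow> complex" and H :: "nat \<Rightarrow> complex"
  assumes system: "biorthogonal_system Q \<phi>1 \<phi>2 H"
begin

lemma system_obtain:
  obtains S1 S2 R1 R2 where "lower_unitriangular S1" "lower_unitriangular S2"
    "lower_unitriangular R1" "lower_unitriangular R2" "lower_inverse S1 R1" "lower_inverse S2 R2"
    "\<And>i j. gram Q i j = (\<Sum>k\<le>min i j. R1 i k * H k * cnj (R2 j k))"
    "\<phi>1 = cmv_comb S1" "\<phi>2 = cmv_comb S2"
  using system unfolding biorthogonal_system_def gauss_borel_def by blast

lemma norm_nonzero: "H k \<noteq> 0"
  using system by (auto simp: biorthogonal_system_def gauss_borel_def)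

lemma monic:
  obtains g1 g2 where "g1 \<in> laurent_span k" "\<And>z. \<phi>1 k z = cmv k z + g1 z"
    "g2 \<in> laurent_span k" "\<And>z. \<phi>2 k z = cmv k z + g2 z"
  by (rule system_obtain) (metis cmv_comb_monic)

lemma in_span: "k < n \<Longrightarrow> \<phi>1 k \<in> laurent_span n" "k < n \<Longrightarrow> \<phi>2 k \<in> laurent_span n"
  by (rule system_obtain; simp add: cmv_comb_span)+

lemma in_laurent_fun [simp]: "\<phi>1 k \<in> laurent_fun" "\<phi>2 k \<in> laurent_fun"
  using in_span[of k "Suc k"] laurent_span_imp_fun by auto

text \<open>This is the matrix identity S1 G S2^\<dagger> = H written with finite sums.\<close>

lemma biorthogonal: "Q (\<phi>1 i) (\<phi>2 j) = (if i = j then H i else 0)"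
proof (rule system_obtain)
  fix S1 S2 R1 R2
  assume S: "lower_unitriangular S1" "lower_unitriangular S2"
    and R: "lower_unitriangular R1" "lower_unitriangular R2"
    and inv: "lower_inverse S1 R1" "lower_inverse S2 R2"
    and G: "\<And>i j. gram Q i j = (\<Sum>k\<le>min i j. R1 i k * H k * cnj (R2 j k))"
    and \<phi>: "\<phi>1 = cmv_comb S1" "\<phi>2 = cmv_comb S2"
  \<comment> \<open>A summation range common to all \<open>a\<close> and \<open>b\<close> is needed
    to interchange sums; the terms added beyond \<open>min a b\<close> vanish by triangularity of
    \<open>R1\<close> and \<open>R2\<close>.\<close>
  have G': "Q (cmv a) (cmv b) = (\<Sum>k\<le>i + j. R1 a k * H k * cnj (R2 b k))" if "a \<le> i" "b \<le> j" for a b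
    unfolding G[unfolded gram_def] using R that
    by (intro sum.mono_neutral_left) (auto simp: lower_unitriangular_def not_le)
  have "Q (\<phi>1 i) (\<phi>2 j) = (\<Sum>a\<le>i. S1 i a * Q (cmv a) (\<lambda>z. cmv_comb S2 j z))"
    unfolding \<phi> cmv_comb_def[of S1, abs_def] by (rule form_sum_left) (use \<phi> in_laurent_fun in auto)
  also have "\<dots> = (\<Sum>a\<le>i. S1 i a * (\<Sum>b\<le>j. cnj (S2 j b) * Q (cmv a) (cmv b)))"
    unfolding cmv_comb_def by (subst form_sum_right) auto
  also have "\<dots> = (\<Sum>a\<le>i. S1 i a * (\<Sum>b\<le>j. cnj (S2 j b) * (\<Sum>k\<le>i + j. R1 a k * H k * cnj (R2 b k))))"
    by (intro sum.cong refl arg_cong2[where f = times]) (auto simp: G')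
  also have "\<dots> = (\<Sum>a\<le>i. \<Sum>k\<le>i + j. \<Sum>b\<le>j. H k * (S1 i a * R1 a k) * (cnj (S2 j b) * cnj (R2 b k)))"
    by (intro sum.cong refl, simp only: sum_distrib_left, subst sum.swap) (simp add: mult_ac)
  also have "\<dots> = (\<Sum>k\<le>i + j. \<Sum>a\<le>i. \<Sum>b\<le>j. H k * (S1 i a * R1 a k) * (cnj (S2 j b) * cnj (R2 b k)))"
    by (rule sum.swap)
  also have "\<dots> = (\<Sum>k\<le>i + j. H k * (\<Sum>a\<le>i. S1 i a * R1 a k) * cnj (\<Sum>b\<le>j. S2 j b * R2 b k))"
    by (intro sum.cong refl) (simp add: sum_distrib_left sum_distrib_right mult.assoc, rule sum.swap)
  also have "\<dots> = (\<Sum>k\<le>i + j. H k * (if i = k then 1 else 0) * cnj (if j = k then 1 else 0))"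
    using inv by (simp add: lower_inverse_def)
  also have "\<dots> = (\<Sum>k\<le>i + j. if k = i then (if i = j then H i else 0) else 0)"
    by (intro sum.cong refl) auto
  also have "\<dots> = (if i = j then H i else 0)"
    by (subst sum.delta) auto
  finally show ?thesis .
qed

lemma expand1:
  assumes "f \<in> laurent_span n" "z \<noteq> 0"
  shows "f z = (\<Sum>k<n. Q f (\<phi>2 k) / H k * \<phi>1 k z)"
proof -
  obtain c where c: "\<And>z. z \<noteq> 0 \<Longrightarrow> f z = (\<Sum>k<n. c k * \<phi>1 k z)"
    by (rule system_obtain) (metis laurent_span_cmv_comb[OF _ assms(1)])
  have "Q f (\<phi>2 k) = c k * H k" if "k < n" for k
  proof -
    have "Q f (\<phi>2 k) = Q (\<lambda>z. \<Sum>i<n. c i * \<phi>1 i z) (\<phi>2 k)" by (rule form_cong) (use assms(1) laurent_span_imp_fun in \<open>auto simp: c\<close>)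
    also have "\<dots> = (\<Sum>i<n. c i * (if i = k then H i else 0))" by (simp add: form_sum_left biorthogonal)
    also have "\<dots> = c k * H k" using that by (simp add: if_distrib cong: if_cong)
    finally show ?thesis .
  qed
  thus ?thesis using assms(2) norm_nonzero by (simp add: c)
qed

lemma expand2:
  assumes "g \<in> laurent_span n" "z \<noteq> 0"
  shows "g z = (\<Sum>k<n. cnj (Q (\<phi>1 k) g / H k) * \<phi>2 k z)"
proof -
  obtain c where c: "\<And>z. z \<noteq> 0 \<Longrightarrow> g z = (\<Sum>k<n. c k * \<phi>2 k z)"
    by (rule system_obtain) (metis laurent_span_cmv_comb[OF _ assms(1)])
  have "Q (\<phi>1 k) g = cnj (c k) * H k" if "k < n" for k
  proof -
    have "Q (\<phi>1 k) g = Q (\<phi>1 k) (\<lambda>z. \<Sum>i<n. c i * \<phi>2 i z)" by (rule form_cong) (use assms(1) laurent_span_imp_fun in \<open>auto simp: c\<close>)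
    also have "\<dots> = (\<Sum>i<n. cnj (c i) * (if k = i then H k else 0))" by (simp add: form_sum_right biorthogonal)
    also have "\<dots> = cnj (c k) * H k" using that by (simp add: if_distrib cong: if_cong)
    finally show ?thesis .
  qed
  thus ?thesis using assms(2) norm_nonzero by (simp add: c)
qed

lemma orthogonal1:
  assumes "f \<in> laurent_span k"
  shows "Q f (\<phi>2 k) = 0"
proof -
  have "Q f (\<phi>2 k) = Q (\<lambda>z. \<Sum>i<k. Q f (\<phi>2 i) / H i * \<phi>1 i z) (\<phi>2 k)"
    by (rule form_cong) (use expand1[OF assms] laurent_span_imp_fun[OF assms] in auto)
  also have "\<dots> = 0" by (simp add: form_sum_left biorthogonal del: times_divide_eq_left)
  finally show ?thesis .
qed

lemma orthogonal2:
  assumes "g \<in> laurent_span k"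
  shows "Q (\<phi>1 k) g = 0"
proof -
  have "Q (\<phi>1 k) g = Q (\<phi>1 k) (\<lambda>z. \<Sum>i<k. cnj (Q (\<phi>1 i) g / H i) * \<phi>2 i z)"
    by (rule form_cong) (use expand2[OF assms] laurent_span_imp_fun[OF assms] in auto)
  also have "\<dots> = 0" by (simp add: form_sum_right biorthogonal del: complex_cnj_divide)
  finally show ?thesis .
qed

text \<open>Subtracting \<open>c\<close> times the monic \<open>\<phi>1 k\<close> leaves a remainder
  in \<open>laurent_span k\<close>, to which \<open>\<phi>2 k\<close> is orthogonal.\<close>

lemma leading1:
  assumes "g \<in> laurent_span k" "\<And>z. z \<noteq> 0 \<Longrightarrow> f z = c * cmv k z + g z"
  shows "Q f (\<phi>2 k) = c * H k"
proof -
  obtain h where h: "h \<in> laurent_span k" "\<And>z. \<phi>1 k z = cmv k z + h z" using monic by metis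
  let ?r = "\<lambda>z. g z + (- c) * h z"
  have r: "?r \<in> laurent_span k" by (intro laurent_span_add laurent_span_cmult assms h)
  have "f \<in> laurent_fun"
    by (rule laurent_fun_cong[OF _ assms(2)])
       (auto intro!: laurent_fun_add laurent_fun_cmult laurent_span_imp_fun[OF assms(1)])
  hence "Q f (\<phi>2 k) = Q (\<lambda>z. c * \<phi>1 k z + ?r z) (\<phi>2 k)"
    by (intro form_cong) (auto simp: assms(2) h(2) algebra_simps)
  also have "\<dots> = c * H k"
    using laurent_span_imp_fun[OF r] orthogonal1[OF r]
    by (subst form_add_left) (auto simp: form_cmult_left biorthogonal laurent_fun_cmult)
  finally show ?thesis .
qed

lemma leading2:
  assumes "f \<in> laurent_span k" "\<And>z. z \<noteq> 0 \<Longrightarrow> g z = c * cmv k z + f z"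
  shows "Q (\<phi>1 k) g = cnj c * H k"
proof -
  obtain h where h: "h \<in> laurent_span k" "\<And>z. \<phi>2 k z = cmv k z + h z" using monic by metis
  let ?r = "\<lambda>z. f z + (- c) * h z"
  have r: "?r \<in> laurent_span k" by (intro laurent_span_add laurent_span_cmult assms h)
  have "g \<in> laurent_fun"
    by (rule laurent_fun_cong[OF _ assms(2)])
       (auto intro!: laurent_fun_add laurent_fun_cmult laurent_span_imp_fun[OF assms(1)])
  hence "Q (\<phi>1 k) g = Q (\<phi>1 k) (\<lambda>z. c * \<phi>2 k z + ?r z)"
    by (intro form_cong) (auto simp: assms(2) h(2) algebra_simps)
  also have "\<dots> = cnj c * H k"
    using laurent_span_imp_fun[OF r] orthogonal2[OF r]
    by (subst form_add_right) (auto simp: form_cmult_right biorthogonal laurent_fun_cmult)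
  finally show ?thesis .
qed

end

subsection \<open>Forms admitting rational functions in the second slot\<close>

definition rational_off :: "complex set \<Rightarrow> (complex \<Rightarrow> complex) set" where
  "rational_off S = {g. \<exists>P Q. lp_zeros Q \<inter> S = {} \<and> (\<forall>z. z \<noteq> 0 \<longrightarrow> g z = lp P z / lp Q z)}"

lemma rational_offI:
  "lp_zeros Q \<inter> S = {} \<Longrightarrow> (\<And>z. z \<noteq> 0 \<Longrightarrow> g z = lp P z / lp Q z) \<Longrightarrow> g \<in> rational_off S"
  by (auto simp: rational_off_def)

lemma lp_one [simp]: "lp 1 z = 1"
  using lp_single[of 0 1 z] by simp

lemma rational_off_laurent:
  assumes "g \<in> laurent_fun"
  shows "g \<in> rational_off S"
proof -
  obtain L where "\<And>z. z \<noteq> 0 \<Longrightarrow> g z = lp L z" using assms by (auto simp: laurent_fun_def)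
  thus ?thesis by (intro rational_offI[of 1 S g L]) (auto simp: lp_zeros_def)
qed

lemma rational_off_divide:
  assumes "g \<in> rational_off S" "lp_zeros L \<inter> S = {}"
  shows "(\<lambda>z. g z / lp L z) \<in> rational_off S"
proof -
  obtain P Q where PQ: "lp_zeros Q \<inter> S = {}" "\<And>z. z \<noteq> 0 \<Longrightarrow> g z = lp P z / lp Q z"
    using assms by (auto simp: rational_off_def)
  have "lp_zeros (Q * L) = lp_zeros Q \<union> lp_zeros L" by (auto simp: lp_zeros_def lp_mult)
  hence "lp_zeros (Q * L) \<inter> S = {}" using PQ(1) assms(2) by blast
  thus ?thesis by (rule rational_offI[of _ _ _ P]) (simp add: PQ(2) lp_mult)
qed

lemma rational_off_pole:
  assumes "g \<in> rational_off S" "a \<notin> S"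
  shows "(\<lambda>z. g z / (a - z)) \<in> rational_off S"
proof -
  let ?L = "Poly_Mapping.single 0 a + Poly_Mapping.single 1 (- 1) :: int \<Rightarrow>\<^sub>0 complex"
  have L: "lp ?L z = a - z" for z by (simp add: lp_add lp_single)
  hence "lp_zeros ?L \<subseteq> {a}" by (auto simp: lp_zeros_def)
  hence "lp_zeros ?L \<inter> S = {}" using assms(2) by blast
  from rational_off_divide[OF assms(1) this] show ?thesis by (simp add: L)
qed

text \<open>What the proof needs of the functional, in a form shared by the pairing itself and by
  its conjugate with exchanged slots. Only the second slot takes functions with poles, so values
  there count only near \<open>S\<close>. It is antilinear, and the pole is written
  \<open>cnj w\<close> to make the transform holomorphic in \<open>w\<close>.\<close>

locale second_slot_form =
  fixes B :: form and S :: "complex set"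
  assumes closed: "closedin (top_of_set (- {0})) S"
    and cong: "(\<And>z. z \<noteq> 0 \<Longrightarrow> f z = f' z) \<Longrightarrow> open W \<Longrightarrow> S \<subseteq> W \<Longrightarrow> (\<And>z. z \<in> W \<Longrightarrow> g z = g' z) \<Longrightarrow>
      B f g = B f' g'"
    and add_left: "f \<in> laurent_fun \<Longrightarrow> f' \<in> laurent_fun \<Longrightarrow> g \<in> rational_off S \<Longrightarrow>
      B (\<lambda>z. f z + f' z) g = B f g + B f' g"
    and cmult_left: "f \<in> laurent_fun \<Longrightarrow> g \<in> rational_off S \<Longrightarrow> B (\<lambda>z. c * f z) g = c * B f g"
    and add_right: "f \<in> laurent_fun \<Longrightarrow> g \<in> rational_off S \<Longrightarrow> g' \<in> rational_off S \<Longrightarrow>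
      B f (\<lambda>z. g z + g' z) = B f g + B f g'"
    and cmult_right: "f \<in> laurent_fun \<Longrightarrow> g \<in> rational_off S \<Longrightarrow> B f (\<lambda>z. c * g z) = cnj c * B f g"
    and cauchy: "f \<in> laurent_fun \<Longrightarrow> g \<in> rational_off S \<Longrightarrow> w0 \<noteq> 0 \<Longrightarrow> cnj w0 \<notin> S \<Longrightarrow>
      isCont (\<lambda>w. B f (\<lambda>z. g z / (cnj w - z))) w0"
begin

lemma support_subset: "S \<subseteq> - {0}"
  using closedin_subset[OF closed] by simp

definition pole_region :: "complex set" where
  "pole_region = {w. w \<noteq> 0 \<and> cnj w \<notin> S}"

lemma open_pole_region: "open pole_region"
proof -
  have "openin (top_of_set (- {0})) (- {0} - S)"
    using closed by (simp add: openin_diff)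
  hence "open (- {0} - S)" by (subst (asm) openin_open_eq) auto
  hence "open (cnj -` (- {0} - S))" by (intro open_vimage continuous_on_cnj continuous_on_id)
  also have "cnj -` (- {0} - S) = pole_region" by (auto simp: pole_region_def)
  finally show ?thesis .
qed

sublocale laurent_form B
proof
  show "B f g = B f' g'" if "\<And>z. z \<noteq> 0 \<Longrightarrow> f z = f' z" "\<And>z. z \<noteq> 0 \<Longrightarrow> g z = g' z" for f f' g g'
    by (rule cong[of _ _ "- {0}"]) (use that support_subset in auto)
qed (auto intro: add_left cmult_left add_right cmult_right rational_off_laurent)

text \<open>The difference quotient is itself minus a Cauchy transform, that of g(z) / (cnj w0 - z).
  This is again rational without poles on \<open>S\<close>, so the continuity assumption applies to
  it and gives the limit.\<close>

lemma cauchy_transform_derivative: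
  assumes f: "f \<in> laurent_fun" and g: "g \<in> rational_off S" and w0: "w0 \<in> pole_region"
  shows "((\<lambda>w. B f (\<lambda>z. g z / (cnj w - z))) has_field_derivative
    - B f (\<lambda>z. g z / (cnj w0 - z) / (cnj w0 - z))) (at w0)"
proof -
  let ?E = "\<lambda>w. B f (\<lambda>z. g z / (cnj w - z))"
  let ?g0 = "\<lambda>z. g z / (cnj w0 - z)"
  let ?h = "\<lambda>w. B f (\<lambda>z. ?g0 z / (cnj w - z))"
  have g0: "?g0 \<in> rational_off S" using g w0 by (intro rational_off_pole) (auto simp: pole_region_def)
  \<comment> \<open>The resolvent identity 1/a = 1/b + (b - a)/(a b) for a =
    \<open>cnj w - z\<close> and b = \<open>cnj w0 - z\<close>; antilinearity turns the factor
    \<open>cnj (w0 - w)\<close> into \<open>w0 - w\<close>.\<close>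
  have E: "?E w = ?E w0 + (w0 - w) * ?h w" if w: "w \<in> pole_region" for w
  proof -
    have "?E w = B f (\<lambda>z. ?g0 z + cnj (w0 - w) * (?g0 z / (cnj w - z)))"
    proof (rule cong[of _ _ "- {cnj w, cnj w0}"])
      show "S \<subseteq> - {cnj w, cnj w0}" using w w0 by (auto simp: pole_region_def)
      show "g z / (cnj w - z) = ?g0 z + cnj (w0 - w) * (?g0 z / (cnj w - z))"
        if "z \<in> - {cnj w, cnj w0}" for z
      proof -
        have *: "x / a = x / b + (b - a) * (x / b / a)" if "a \<noteq> 0" "b \<noteq> 0" for x a b :: complex
          using that by (simp add: field_simps)
        have "cnj w - z \<noteq> 0" "cnj w0 - z \<noteq> 0" using that by auto
        from *[OF this, of "g z"] show ?thesis by simp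
      qed
    qed auto
    also have "\<dots> = ?E w0 + B f (\<lambda>z. cnj (w0 - w) * (?g0 z / (cnj w - z)))"
    proof (rule add_right[OF f g0])
      have "(\<lambda>z. cnj (w0 - w) * g z) \<in> rational_off S"
      proof -
        obtain P R where "lp_zeros R \<inter> S = {}" "\<And>z. z \<noteq> 0 \<Longrightarrow> g z = lp P z / lp R z"
          using g by (auto simp: rational_off_def)
        thus ?thesis
          by (intro rational_offI[of R S _ "Poly_Mapping.single 0 (cnj (w0 - w)) * P"])
             (auto simp: lp_mult lp_single)
      qed
      hence "(\<lambda>z. cnj (w0 - w) * g z / (cnj w0 - z) / (cnj w - z)) \<in> rational_off S"
        using w w0 by (intro rational_off_pole) (auto simp: pole_region_def)
      thus "(\<lambda>z. cnj (w0 - w) * (?g0 z / (cnj w - z))) \<in> rational_off S" by simp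
    qed
    also have "B f (\<lambda>z. cnj (w0 - w) * (?g0 z / (cnj w - z))) = (w0 - w) * ?h w"
      using w by (subst cmult_right[OF f rational_off_pole[OF g0]]) (auto simp: pole_region_def)
    finally show ?thesis .
  qed
  have "(?h \<longlongrightarrow> ?h w0) (at w0)"
    using cauchy[OF f g0] w0 by (auto simp: pole_region_def isCont_def)
  hence "((\<lambda>w. - ?h w) \<longlongrightarrow> - ?h w0) (at w0)" by (rule tendsto_minus)
  moreover have "\<forall>\<^sub>F w in at w0. - ?h w = (?E w - ?E w0) / (w - w0)"
    using eventually_at_in_open[OF open_pole_region w0]
  proof eventually_elim
    case (elim w)
    thus ?case using E[of w] by (auto simp: field_simps)
  qed
  ultimately show ?thesis
    unfolding has_field_derivative_iff by (rule Lim_transform_eventually)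
qed

lemma cauchy_transform_analytic:
  assumes "f \<in> laurent_fun" "g \<in> rational_off S" "w0 \<in> pole_region"
  shows "(\<lambda>w. B f (\<lambda>z. g z / (cnj w - z))) analytic_on {w0}"
proof -
  have "(\<lambda>w. B f (\<lambda>z. g z / (cnj w - z))) holomorphic_on pole_region"
    using cauchy_transform_derivative[OF assms(1,2)] open_pole_region
    by (auto simp: holomorphic_on_open)
  thus ?thesis using open_pole_region assms(3) by (auto simp: analytic_at)
qed

lemma eventually_pole_region: "w0 \<in> pole_region \<Longrightarrow> \<forall>\<^sub>F w in nhds w0. w \<in> pole_region"
  by (rule eventually_nhds_in_open[OF open_pole_region])

definition second_kind :: "(complex \<Rightarrow> complex) \<Rightarrow> complex \<Rightarrow> complex" where
  "second_kind f w = B f (\<lambda>z. 1 / (cnj w - z))"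

lemma second_kind_analytic: "f \<in> laurent_fun \<Longrightarrow> w \<in> pole_region \<Longrightarrow> second_kind f analytic_on {w}"
  unfolding second_kind_def by (rule cauchy_transform_analytic) (auto intro: rational_off_laurent)

lemma sum_left:
  assumes "\<And>i. i \<in> I \<Longrightarrow> f i \<in> laurent_fun" "g \<in> rational_off S"
  shows "B (\<lambda>z. \<Sum>i\<in>I. c i * f i z) g = (\<Sum>i\<in>I. c i * B (f i) g)"
  using assms(1)
proof (induction I rule: infinite_finite_induct)
  case (insert i I)
  thus ?case using assms(2)
    by (simp add: add_left cmult_left laurent_fun_cmult laurent_fun_sum)
qed (use cmult_left[of "\<lambda>z. 0" g 0] assms(2) in auto)

lemma second_kind_sum:
  assumes "\<And>i. i \<in> I \<Longrightarrow> f i \<in> laurent_fun" "\<And>z. z \<noteq> 0 \<Longrightarrow> g z = (\<Sum>i\<in>I. c i * f i z)" "w \<in> pole_region"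
  shows "second_kind g w = (\<Sum>i\<in>I. c i * second_kind (f i) w)"
proof -
  have r: "(\<lambda>z. 1 / (cnj w - z)) \<in> rational_off S"
    using assms(3) by (intro rational_off_pole rational_off_laurent) (auto simp: pole_region_def)
  have "second_kind g w = B (\<lambda>z. \<Sum>i\<in>I. c i * f i z) (\<lambda>z. 1 / (cnj w - z))"
    unfolding second_kind_def by (rule cong[of _ _ UNIV]) (use assms in auto)
  also have "\<dots> = (\<Sum>i\<in>I. c i * second_kind (f i) w)"
    unfolding second_kind_def by (rule sum_left[OF assms(1) r])
  finally show ?thesis .
qed

end

subsection \<open>Geronimus--Uvarov perturbation of the first slot\<close>

locale perturbation = second_slot_form B S for B S +
  fixes LG LC :: "int \<Rightarrow>\<^sub>0 complex" and NG NC :: nat and zG zC :: "(complex \<times> nat) list"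
    and \<xi> :: "nat \<Rightarrow> nat \<Rightarrow> (complex \<Rightarrow> complex) \<Rightarrow> complex" and Bt :: form
  assumes prepG: "prepared LG NG" and prepC: "prepared LC NC"
    and enumG: "zeros_enum LG zG" and enumC: "zeros_enum LC zC"
    and disjoint: "lp_zeros LG \<inter> S = {}"
    and functional: "\<And>i l. i < length zG \<Longrightarrow> l < snd (zG ! i) \<Longrightarrow> laurent_functional (\<xi> i l)"
    and Bt_eq: "\<And>f g. Bt f g = B (\<lambda>z. lp LC z * f z) (\<lambda>z. g z / lp LG z) +
      (\<Sum>i<length zG. \<Sum>l<snd (zG ! i).
        1 / fact l * \<xi> i l (\<lambda>z. lp LC z * f z) * cnj ((deriv ^^ l) g (fst (zG ! i))))"
begin

lemma functional_cong:
  assumes "i < length zG" "l < snd (zG ! i)" "f \<in> laurent_fun" "\<And>z. z \<noteq> 0 \<Longrightarrow> f z = g z"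
  shows "\<xi> i l f = \<xi> i l g"
  using functional[OF assms(1,2)] assms(3,4) by (auto simp: laurent_functional_def)

lemma functional_add:
  assumes "i < length zG" "l < snd (zG ! i)" "f \<in> laurent_fun" "g \<in> laurent_fun"
  shows "\<xi> i l (\<lambda>z. f z + g z) = \<xi> i l f + \<xi> i l g"
  using functional[OF assms(1,2)] assms(3,4) by (auto simp: laurent_functional_def linear_on_def)

lemma functional_cmult:
  assumes "i < length zG" "l < snd (zG ! i)" "f \<in> laurent_fun"
  shows "\<xi> i l (\<lambda>z. c * f z) = c * \<xi> i l f"
  using functional[OF assms(1,2)] assms(3) by (auto simp: laurent_functional_def linear_on_def)

lemma functional_sum:
  assumes "i < length zG" "l < snd (zG ! i)" "\<And>k. k \<in> I \<Longrightarrow> f k \<in> laurent_fun"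
  shows "\<xi> i l (\<lambda>z. \<Sum>k\<in>I. c k * f k z) = (\<Sum>k\<in>I. c k * \<xi> i l (f k))"
  using assms(3)
proof (induction I rule: infinite_finite_induct)
  case (insert k I)
  thus ?case
    by (simp add: functional_add[OF assms(1,2)] functional_cmult[OF assms(1,2)] laurent_fun_cmult laurent_fun_sum)
qed (use functional_cmult[OF assms(1,2), of "\<lambda>z. 0" 0] in auto)

lemma zero_in_pole_region:
  assumes "j < length zG"
  shows "cnj (fst (zG ! j)) \<in> pole_region"
  using zero_nonzero[OF prepG enumG assms] zero_root[OF prepG enumG assms] disjoint
  by (auto simp: pole_region_def lp_zeros_def)

lemma deriv_eq_fps: "(deriv ^^ l) g z = fact l * fps_nth (fps_expansion g z) l"
  by (simp add: fps_nth_fps_expansion_eq)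

lemma Bt_eq_fps: "Bt f g = B (\<lambda>z. lp LC z * f z) (\<lambda>z. g z / lp LG z) +
  (\<Sum>i<length zG. \<Sum>l<snd (zG ! i).
    \<xi> i l (\<lambda>z. lp LC z * f z) * cnj (fps_nth (fps_expansion g (fst (zG ! i))) l))"
  unfolding Bt_eq deriv_eq_fps by simp

lemma finite_zeros: "finite (lp_zeros LG)"
  using enumG by (simp add: zeros_enum_def flip: set_map) (metis List.finite_set finite_imageI)

lemma laurent_fun_LC: "f \<in> laurent_fun \<Longrightarrow> (\<lambda>z. lp LC z * f z) \<in> laurent_fun"
  by (intro laurent_fun_mult laurent_fun_lp)

lemma rational_LG: "g \<in> laurent_fun \<Longrightarrow> (\<lambda>z. g z / lp LG z) \<in> rational_off S"
  by (intro rational_off_divide rational_off_laurent disjoint)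

lemma taylor_cong_laurent:
  assumes "z \<noteq> 0" "\<And>z. z \<noteq> 0 \<Longrightarrow> g z = g' z"
  shows "fps_expansion g z = fps_expansion g' z"
  by (rule fps_expansion_cong, rule eventually_mono[OF eventually_nhds_in_open[of "- {0}"]])
     (use assms in auto)

lemma laurent_form_Bt: "laurent_form Bt"
proof
  fix f f' g g' :: "complex \<Rightarrow> complex" and c :: complex
  assume f: "f \<in> laurent_fun" and g: "g \<in> laurent_fun"
  note nz = zero_nonzero[OF prepG enumG]
  show "Bt f g = Bt f' g'" if "\<And>z. z \<noteq> 0 \<Longrightarrow> f z = f' z" "\<And>z. z \<noteq> 0 \<Longrightarrow> g z = g' z"
    unfolding Bt_eq_fps
  proof (intro arg_cong2[where f = plus] sum.cong refl arg_cong2[where f = times])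
    show "B (\<lambda>z. lp LC z * f z) (\<lambda>z. g z / lp LG z) = B (\<lambda>z. lp LC z * f' z) (\<lambda>z. g' z / lp LG z)"
      by (rule cong[of _ _ "- {0}"]) (use that support_subset in auto)
    fix i l assume "i \<in> {..<length zG}" "l \<in> {..<snd (zG ! i)}"
    thus "\<xi> i l (\<lambda>z. lp LC z * f z) = \<xi> i l (\<lambda>z. lp LC z * f' z)"
      by (intro functional_cong laurent_fun_LC f) (auto simp: that)
    show "cnj (fps_nth (fps_expansion g (fst (zG ! i))) l) = cnj (fps_nth (fps_expansion g' (fst (zG ! i))) l)"
      by (subst taylor_cong_laurent[of _ g g']) (use that nz \<open>i \<in> _\<close> in auto)
  qed
  show "Bt (\<lambda>z. f z + f' z) g = Bt f g + Bt f' g" if "f' \<in> laurent_fun"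
    unfolding Bt_eq_fps using that f g
    by (simp add: distrib_left add_left laurent_fun_LC rational_LG functional_add distrib_right sum.distrib)
  show "Bt (\<lambda>z. c * f z) g = c * Bt f g"
  proof -
    have e: "(\<lambda>z. lp LC z * (c * f z)) = (\<lambda>z. c * (lp LC z * f z))" by (simp add: mult.left_commute)
    show ?thesis
      unfolding Bt_eq_fps e using f g
      by (simp add: cmult_left laurent_fun_LC rational_LG functional_cmult distrib_left sum_distrib_left mult.assoc)
  qed
  show "Bt f (\<lambda>z. g z + g' z) = Bt f g + Bt f g'" if "g' \<in> laurent_fun"
    unfolding Bt_eq_fps using that f g nz
    by (simp add: add_divide_distrib add_right laurent_fun_LC rational_LG fps_expansion_add laurent_fun_analytic
        distrib_left sum.distrib)
  show "Bt f (\<lambda>z. c * g z) = cnj c * Bt f g"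
  proof -
    have e: "(\<lambda>z. c * g z / lp LG z) = (\<lambda>z. c * (g z / lp LG z))" by simp
    have "B (\<lambda>z. lp LC z * f z) (\<lambda>z. c * g z / lp LG z) = cnj c * B (\<lambda>z. lp LC z * f z) (\<lambda>z. g z / lp LG z)"
      unfolding e by (rule cmult_right[OF laurent_fun_LC[OF f] rational_LG[OF g]])
    moreover have "(\<Sum>i<length zG. \<Sum>l<snd (zG ! i). \<xi> i l (\<lambda>z. lp LC z * f z) *
          cnj (fps_nth (fps_expansion (\<lambda>z. c * g z) (fst (zG ! i))) l)) =
        cnj c * (\<Sum>i<length zG. \<Sum>l<snd (zG ! i). \<xi> i l (\<lambda>z. lp LC z * f z) *
          cnj (fps_nth (fps_expansion g (fst (zG ! i))) l))"
      unfolding sum_distrib_left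
    proof (intro sum.cong refl)
      fix i l assume "i \<in> {..<length zG}" "l \<in> {..<snd (zG ! i)}"
      hence "fps_expansion (\<lambda>z. c * g z) (fst (zG ! i)) = fps_const c * fps_expansion g (fst (zG ! i))"
        by (intro fps_expansion_cmult laurent_fun_analytic g nz) auto
      thus "\<xi> i l (\<lambda>z. lp LC z * f z) * cnj (fps_nth (fps_expansion (\<lambda>z. c * g z) (fst (zG ! i))) l) =
          cnj c * (\<xi> i l (\<lambda>z. lp LC z * f z) * cnj (fps_nth (fps_expansion g (fst (zG ! i))) l))"
        by simp
    qed
    ultimately show ?thesis unfolding Bt_eq_fps by (simp add: distrib_left)
  qed
qed

lemma Bt_mult_LG:
  assumes f: "f \<in> laurent_fun" and g: "g \<in> laurent_fun"
  shows "Bt f (\<lambda>z. lp LG z * g z) = B (\<lambda>z. lp LC z * f z) g"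
proof -
  \<comment> \<open>At zeros of \<open>LG\<close> the quotient has the default value 0, so
    cancellation is valid only off these zeros. They avoid \<open>S\<close>, hence a neighbourhood
    of \<open>S\<close> is left.\<close>
  have "B (\<lambda>z. lp LC z * f z) (\<lambda>z. lp LG z * g z / lp LG z) = B (\<lambda>z. lp LC z * f z) g"
  proof (rule cong[of _ _ "- ({0} \<union> lp_zeros LG)"])
    show "open (- ({0} \<union> lp_zeros LG))" by (intro open_Compl finite_imp_closed) (simp add: finite_zeros)
    show "S \<subseteq> - ({0} \<union> lp_zeros LG)" using support_subset disjoint by auto
  qed (auto simp: lp_zeros_def)
  moreover have "fps_nth (fps_expansion (\<lambda>z. lp LG z * g z) (fst (zG ! i))) l = 0"
    if i: "i < length zG" and l: "l < snd (zG ! i)" for i l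
  proof -
    have nz: "fst (zG ! i) \<noteq> 0" by (rule zero_nonzero[OF prepG enumG i])
    have "fps_nth (fps_expansion (\<lambda>z. lp LG z * g z) (fst (zG ! i))) l =
        (if l < snd (zG ! i) then 0 else fps_nth (fps_expansion (\<lambda>z. deflated LG NG zG i z * g z) (fst (zG ! i))) (l - snd (zG ! i)))"
    proof (rule taylor_factor)
      show "(\<lambda>z. deflated LG NG zG i z * g z) analytic_on {fst (zG ! i)}"
        by (intro analytic_intros deflated_analytic[OF prepG enumG] laurent_fun_analytic g nz)
      show "\<forall>\<^sub>F w in nhds (fst (zG ! i)). lp LG w * g w =
          (w - fst (zG ! i)) ^ snd (zG ! i) * (deflated LG NG zG i w * g w)"
        by (rule eventually_mono[OF eventually_nhds_in_open[of "- {0}"]])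
           (use nz in \<open>auto simp: lp_eq_deflated[OF prepG enumG i]\<close>)
    qed
    thus ?thesis using l by simp
  qed
  ultimately show ?thesis unfolding Bt_eq_fps by simp
qed

text \<open>The entry for slot \<open>(j, q)\<close> of the row of masses multiplied by
  \<open>taylor_mat\<close>.\<close>

definition mass_term :: "nat \<Rightarrow> nat \<Rightarrow> (complex \<Rightarrow> complex) \<Rightarrow> complex" where
  "mass_term j q f = (\<Sum>p<snd (zG ! j). \<xi> j p f *
     (if p + q \<ge> snd (zG ! j) - 1 then taylor_coeff LG NG zG j (p + q - (snd (zG ! j) - 1)) else 0))"

lemma row_mult_masses_nth:
  assumes "r < length (slots zG)" "slots zG ! r = (j, q)"
  shows "vec_index (row_mult (masses \<xi> zG f) (taylor_mat LG NG zG)) r = mass_term j q f"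
  unfolding masses_eq_slots masses_mult_taylor using assms
  by (simp add: vec_of_list_index mass_term_def)

text \<open>With \<open>d\<close> the divided difference of \<open>L = lp LG\<close> at \<open>x = cnj w\<close>, the quotient \<open>d y / L y\<close> equals
  \<open>L x / (L y (x - y)) - 1 / (x - y)\<close>; pairing it with the form isolates the second kind function.\<close>

lemma second_kind_expansion:
  assumes f: "f \<in> laurent_fun" and d: "d \<in> laurent_fun" and w: "w \<in> pole_region"
    and dd: "\<And>y. y \<noteq> 0 \<Longrightarrow> (cnj w - y) * d y = lp LG (cnj w) - lp LG y"
  defines "g \<equiv> \<lambda>z. lp LC z * f z"
  shows "second_kind g w = conj_fun (lp LG) w * B g (\<lambda>z. 1 / lp LG z / (cnj w - z)) +
    (\<Sum>i<length zG. \<Sum>l<snd (zG ! i). \<xi> i l g * ((w - cnj (fst (zG ! i))) ^ (snd (zG ! i) - 1 - l) *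
      conj_fun (deflated LG NG zG i) w)) - Bt f d"
proof -
  have g: "g \<in> laurent_fun" unfolding g_def by (rule laurent_fun_LC[OF f])
  have wS: "cnj w \<notin> S" "w \<noteq> 0" using w by (auto simp: pole_region_def)
  have r1: "(\<lambda>z. 1 / (cnj w - z)) \<in> rational_off S"
    by (intro rational_off_pole rational_off_laurent wS) auto
  have r2: "(\<lambda>z. 1 / lp LG z / (cnj w - z)) \<in> rational_off S"
    by (intro rational_off_pole rational_LG wS) auto
  have r3: "(\<lambda>z. lp LG (cnj w) * (1 / lp LG z / (cnj w - z))) \<in> rational_off S"
  proof -
    have "(\<lambda>z. lp LG (cnj w) / lp LG z / (cnj w - z)) \<in> rational_off S"
      by (intro rational_off_pole rational_LG wS) auto
    thus ?thesis by simp
  qed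
  have r4: "(\<lambda>z. (- 1) * (1 / (cnj w - z))) \<in> rational_off S"
    using rational_off_pole[OF rational_off_laurent[OF laurent_fun_const[of "- 1"]] wS(1)] by simp
  let ?W = "- ({0, cnj w} \<union> lp_zeros LG)"
  have "B g (\<lambda>z. d z / lp LG z) =
      B g (\<lambda>z. lp LG (cnj w) * (1 / lp LG z / (cnj w - z)) + (- 1) * (1 / (cnj w - z)))"
  proof (rule cong[of _ _ ?W])
    show "open ?W" by (intro open_Compl finite_imp_closed) (simp add: finite_zeros)
    show "S \<subseteq> ?W" using support_subset disjoint wS by auto
    fix z assume "z \<in> ?W"
    hence z: "z \<noteq> 0" "cnj w - z \<noteq> 0" "lp LG z \<noteq> 0" by (auto simp: lp_zeros_def)
    have "d z = (lp LG (cnj w) - lp LG z) / (cnj w - z)"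
      using dd[OF z(1)] z(2) by (simp add: eq_divide_eq mult.commute)
    thus "d z / lp LG z = lp LG (cnj w) * (1 / lp LG z / (cnj w - z)) + (- 1) * (1 / (cnj w - z))"
      using z by (simp add: diff_divide_distrib mult.commute)
  qed auto
  also have "\<dots> = cnj (lp LG (cnj w)) * B g (\<lambda>z. 1 / lp LG z / (cnj w - z)) - second_kind g w"
    unfolding add_right[OF g r3 r4] cmult_right[OF g r2] cmult_right[OF g r1] second_kind_def by simp
  finally have 1: "B g (\<lambda>z. d z / lp LG z) =
    conj_fun (lp LG) w * B g (\<lambda>z. 1 / lp LG z / (cnj w - z)) - second_kind g w"
    by (simp add: conj_fun_def)
  have 2: "cnj (fps_nth (fps_expansion d (fst (zG ! i))) l) =
      (w - cnj (fst (zG ! i))) ^ (snd (zG ! i) - 1 - l) * conj_fun (deflated LG NG zG i) w"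
    if "i < length zG" "l < snd (zG ! i)" for i l
    by (subst divided_difference_taylor[OF prepG enumG that d _ dd]) (use wS in \<open>auto simp: conj_fun_def\<close>)
  show ?thesis
    using 1 2 unfolding Bt_eq_fps g_def[symmetric] by simp
qed

text \<open>In the expansion of \<open>second_kind g\<close>, the term with factor
  \<open>conj_fun (lp LG)\<close> has no coefficient below the multiplicity, and the mass sum gives
  \<open>mass_term\<close>. What remains is the pairing of \<open>Bt\<close> with divided
  differences, abstracted as \<open>\<psi>\<close>. The divided difference changes with
  \<open>w\<close>, which is why \<open>ev\<close> speaks of all admissible \<open>d\<close> for
  each \<open>w\<close>.\<close>

lemma second_kind_taylor:
  assumes f: "f \<in> laurent_fun" and j: "j < length zG" and q: "q < snd (zG ! j)"
    and \<psi>: "\<psi> analytic_on {cnj (fst (zG ! j))}"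
    and ev: "\<forall>\<^sub>F w in nhds (cnj (fst (zG ! j))). \<forall>d\<in>laurent_span (2 * NG).
      (\<forall>y. y \<noteq> 0 \<longrightarrow> (cnj w - y) * d y = lp LG (cnj w) - lp LG y) \<longrightarrow> Bt f d = \<psi> w"
  defines "g \<equiv> \<lambda>z. lp LC z * f z"
  shows "fps_nth (fps_expansion (second_kind g) (cnj (fst (zG ! j)))) q =
    mass_term j q g - fps_nth (fps_expansion \<psi> (cnj (fst (zG ! j)))) q"
proof -
  let ?z = "\<lambda>i. cnj (fst (zG ! i))"
  let ?m = "\<lambda>i. snd (zG ! i)"
  let ?D = "\<lambda>i. conj_fun (deflated LG NG zG i)"
  let ?E = "\<lambda>w. B g (\<lambda>z. 1 / lp LG z / (cnj w - z))"
  let ?h = "\<lambda>i l w. (w - ?z i) ^ (?m i - 1 - l) * ?D i w"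
  let ?s = "\<lambda>w. \<Sum>(i, l)\<in>set (slots zG). \<xi> i l g * ?h i l w"
  have g: "g \<in> laurent_fun" unfolding g_def by (rule laurent_fun_LC[OF f])
  have zj: "?z j \<in> pole_region" by (rule zero_in_pole_region[OF j])
  have nz: "fst (zG ! j) \<noteq> 0" by (rule zero_nonzero[OF prepG enumG j])
  have slots_sum: "(\<Sum>(i, l)\<in>set (slots zG). h i l) = (\<Sum>i<length zG. \<Sum>l<?m i. h i l)"
    for h :: "nat \<Rightarrow> nat \<Rightarrow> complex"
    by (subst sum.Sigma) (auto intro!: sum.cong simp: set_slots)
  have D: "?D i analytic_on {?z j}" for i
    by (intro conj_fun_analytic deflated_analytic[OF prepG enumG nz])
  have E: "?E analytic_on {?z j}"
    by (rule cauchy_transform_analytic[OF g _ zj]) (auto intro: rational_LG)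
  have LG: "conj_fun (lp LG) analytic_on {?z j}"
    by (intro conj_fun_analytic laurent_fun_analytic laurent_fun_lp nz)
  have h: "?h i l analytic_on {?z j}" for i l
    using D[of i] by (intro analytic_intros) auto
  have hs: "(\<lambda>w. \<xi> i l g * ?h i l w) analytic_on {?z j}" for i l
    by (intro analytic_on_mult analytic_on_const h)
  have s: "?s analytic_on {?z j}"
    unfolding split_beta by (intro analytic_on_sum hs)
  have evnz: "\<forall>\<^sub>F w in nhds (?z j). w \<noteq> 0"
    using eventually_nhds_in_open[of "- {0}" "?z j"] nz by auto
  have "fps_expansion (second_kind g) (?z j) =
      fps_expansion (\<lambda>w. (conj_fun (lp LG) w * ?E w + ?s w) + (- 1) * \<psi> w) (?z j)"
  proof (rule fps_expansion_cong)
    show "\<forall>\<^sub>F w in nhds (?z j). second_kind g w =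
        (conj_fun (lp LG) w * ?E w + ?s w) + (- 1) * \<psi> w"
      using ev eventually_pole_region[OF zj]
    proof eventually_elim
      case (elim w)
      have "cnj w \<noteq> 0" using elim(2) by (auto simp: pole_region_def)
      then obtain d where d: "d \<in> laurent_span (2 * NG)"
        "\<And>y. y \<noteq> 0 \<Longrightarrow> (cnj w - y) * d y = lp LG (cnj w) - lp LG y"
        using prepared_divided_difference[OF prepG] by metis
      show ?case
        using second_kind_expansion[OF f laurent_span_imp_fun[OF d(1)] elim(2) d(2)] elim(1) d
        unfolding g_def slots_sum by auto
    qed
  qed
  also have "\<dots> = fps_expansion (\<lambda>w. conj_fun (lp LG) w * ?E w) (?z j) + fps_expansion ?s (?z j)
      + fps_const (- 1) * fps_expansion \<psi> (?z j)"
  proof (subst fps_expansion_add)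
    show "(\<lambda>w. conj_fun (lp LG) w * ?E w + ?s w) analytic_on {?z j}"
      by (intro analytic_on_add analytic_on_mult LG E s)
    show "(\<lambda>w. - 1 * \<psi> w) analytic_on {?z j}"
      by (intro analytic_on_mult analytic_on_const \<psi>)
    have "fps_expansion (\<lambda>w. conj_fun (lp LG) w * ?E w + ?s w) (?z j) =
      fps_expansion (\<lambda>w. conj_fun (lp LG) w * ?E w) (?z j) + fps_expansion ?s (?z j)"
      by (intro fps_expansion_add analytic_on_mult LG E s)
    thus "fps_expansion (\<lambda>w. conj_fun (lp LG) w * ?E w + ?s w) (?z j) + fps_expansion (\<lambda>w. - 1 * \<psi> w) (?z j) =
      fps_expansion (\<lambda>w. conj_fun (lp LG) w * ?E w) (?z j) + fps_expansion ?s (?z j)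
      + fps_const (- 1) * fps_expansion \<psi> (?z j)"
      by (simp only: fps_expansion_cmult[OF \<psi>])
  qed
  finally have main: "fps_nth (fps_expansion (second_kind g) (?z j)) q =
      fps_nth (fps_expansion (\<lambda>w. conj_fun (lp LG) w * ?E w) (?z j)) q +
      fps_nth (fps_expansion ?s (?z j)) q - fps_nth (fps_expansion \<psi> (?z j)) q"
    by simp
  have "fps_nth (fps_expansion (\<lambda>w. conj_fun (lp LG) w * ?E w) (?z j)) q =
      (if q < ?m j then 0 else fps_nth (fps_expansion (\<lambda>w. ?D j w * ?E w) (?z j)) (q - ?m j))"
  proof (rule taylor_factor)
    show "(\<lambda>w. ?D j w * ?E w) analytic_on {?z j}" by (intro analytic_on_mult D E)
    show "\<forall>\<^sub>F w in nhds (?z j). conj_fun (lp LG) w * ?E w = (w - ?z j) ^ ?m j * (?D j w * ?E w)"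
      by (rule eventually_mono[OF evnz]) (simp add: conj_fun_def lp_eq_deflated[OF prepG enumG j])
  qed
  hence t1: "fps_nth (fps_expansion (\<lambda>w. conj_fun (lp LG) w * ?E w) (?z j)) q = 0" using q by simp
  \<comment> \<open>Origin of the Hankel pattern: the power of exponent \<open>?m j - 1 - l\<close>
    shifts the Taylor coefficients of the conjugated deflated polynomial, so that order
    \<open>q\<close> shows the coefficient of index \<open>l + q - (?m j - 1)\<close>. Zeros with
    \<open>i \<noteq> j\<close> contribute nothing.\<close>
  have t2: "fps_nth (fps_expansion (?h i l) (?z j)) q =
      (if i = j then if l + q \<ge> ?m j - 1 then taylor_coeff LG NG zG j (l + q - (?m j - 1)) else 0 else 0)"
    if i: "i < length zG" and l: "l < ?m i" for i l
  proof (cases "i = j")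
    case True
    have "fps_nth (fps_expansion (?h j l) (?z j)) q =
        (if q < ?m j - 1 - l then 0 else fps_nth (fps_expansion (?D j) (?z j)) (q - (?m j - 1 - l)))"
      by (rule taylor_factor[OF D]) auto
    also have "fps_nth (fps_expansion (?D j) (?z j)) (q - (?m j - 1 - l)) = taylor_coeff LG NG zG j (q - (?m j - 1 - l))"
      by (simp add: taylor_coeff_def fps_nth_fps_expansion_eq)
    also have "q - (?m j - 1 - l) = l + q - (?m j - 1)" using l True by simp
    also have "q < ?m j - 1 - l \<longleftrightarrow> \<not> l + q \<ge> ?m j - 1" by auto
    finally show ?thesis using True by simp
  next
    case False
    obtain k where k: "\<And>z. z \<noteq> 0 \<Longrightarrow> k analytic_on {z}"
      "\<And>z. deflated LG NG zG i z = (z - fst (zG ! j)) ^ ?m j * k z"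
      using deflated_factor[OF prepG enumG i j False] by blast
    have "fps_nth (fps_expansion (?h i l) (?z j)) q =
        (if q < ?m j then 0 else fps_nth (fps_expansion (\<lambda>w. (w - ?z i) ^ (?m i - 1 - l) * conj_fun k w) (?z j)) (q - ?m j))"
    proof (rule taylor_factor)
      have "conj_fun k analytic_on {?z j}" by (intro conj_fun_analytic k nz)
      thus "(\<lambda>w. (w - ?z i) ^ (?m i - 1 - l) * conj_fun k w) analytic_on {?z j}"
        by (intro analytic_intros) auto
    qed (auto simp: conj_fun_def k(2))
    thus ?thesis using q False by simp
  qed
  have "fps_nth (fps_expansion ?s (?z j)) q =
      (\<Sum>il\<in>set (slots zG). \<xi> (fst il) (snd il) g * fps_nth (fps_expansion (?h (fst il) (snd il)) (?z j)) q)"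
    by (rule taylor_sum[OF h]) (simp add: split_beta)
  also have "\<dots> = (\<Sum>i<length zG. \<Sum>l<?m i. \<xi> i l g * fps_nth (fps_expansion (?h i l) (?z j)) q)"
    using slots_sum[of "\<lambda>i l. \<xi> i l g * fps_nth (fps_expansion (?h i l) (?z j)) q"] by (simp add: split_beta)
  also have "\<dots> = (\<Sum>i<length zG. \<Sum>l<?m i. \<xi> i l g *
      (if i = j then if l + q \<ge> ?m j - 1 then taylor_coeff LG NG zG j (l + q - (?m j - 1)) else 0 else 0))"
    by (intro sum.cong refl arg_cong2[where f = times] t2) auto
  also have "\<dots> = (\<Sum>i<length zG. if i = j then mass_term j q g else 0)"
    by (intro sum.cong refl) (auto simp: mass_term_def)
  also have "\<dots> = mass_term j q g" using j by simp
  finally show ?thesis using main t1 by simp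
qed

end

section \<open>The spectral functionals behind the determinant rows\<close>

context perturbation
begin

text \<open>The row A_k is the value at the k-th unperturbed polynomial. A definition for arbitrary
  functions makes the row a linear map that can also be applied to \<open>lp LC\<close> times a
  perturbed polynomial or kernel.\<close>

definition spectral_row :: "(complex \<Rightarrow> complex) \<Rightarrow> complex vec" where
  "spectral_row f =
     (jet (conj_zeros zG) (second_kind f) - row_mult (masses \<xi> zG f) (taylor_mat LG NG zG)) @\<^sub>v jet zC f"

lemmas slots_G = length_slots_zeros[OF prepG enumG]
lemmas slots_C = length_slots_zeros[OF prepC enumC]

lemma dim_row_mult_masses: "dim_vec (row_mult v (taylor_mat LG NG zG)) = 2 * NG"
  by (simp add: row_mult_def dim_taylor_mat slots_G)

lemma spectral_row_carrier: "spectral_row f \<in> carrier_vec (2 * NG + 2 * NC)"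
  by (intro carrier_vecI) (simp add: spectral_row_def dim_row_mult_masses slots_C)

lemma spectral_row_nth_left:
  assumes "r < 2 * NG" "slots zG ! r = (j, q)"
  shows "vec_index (spectral_row f) r =
    fps_nth (fps_expansion (second_kind f) (cnj (fst (zG ! j)))) q - mass_term j q f"
proof -
  have "(j, q) \<in> set (slots zG)" using assms nth_mem[of r "slots zG"] slots_G by simp
  hence "j < length zG" by (simp add: set_slots)
  thus ?thesis using assms
    by (simp add: spectral_row_def dim_row_mult_masses slots_C slots_G row_mult_masses_nth jet_nth[of r _ j q] fst_conj_zeros)
qed

lemma spectral_row_nth_right:
  assumes "r < 2 * NC" "slots zC ! r = (j, q)"
  shows "vec_index (spectral_row f) (2 * NG + r) = fps_nth (fps_expansion f (fst (zC ! j))) q"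
  using assms by (simp add: spectral_row_def dim_row_mult_masses slots_C slots_G jet_nth)

lemma row_index_cases:
  assumes "r < 2 * NG + 2 * NC"
  obtains j q where "r < 2 * NG" "slots zG ! r = (j, q)" "j < length zG" "q < snd (zG ! j)"
  | s j q where "r = 2 * NG + s" "s < 2 * NC" "slots zC ! s = (j, q)" "j < length zC" "q < snd (zC ! j)"
proof (cases "r < 2 * NG")
  case True
  obtain j q where jq: "slots zG ! r = (j, q)" by fastforce
  moreover have "(j, q) \<in> set (slots zG)" using True jq nth_mem[of r "slots zG"] slots_G by simp
  ultimately show ?thesis using True that(1) by (simp add: set_slots)
next
  case False
  then obtain s where s: "r = 2 * NG + s" "s < 2 * NC"
    using assms that by (metis add_diff_inverse_nat nat_add_left_cancel_less)
  obtain j q where jq: "slots zC ! s = (j, q)" by fastforce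
  moreover have "(j, q) \<in> set (slots zC)" using s(2) jq nth_mem[of s "slots zC"] slots_C by simp
  ultimately show ?thesis using s that(2) by (simp add: set_slots)
qed

lemma mass_term_sum:
  assumes "j < length zG" "\<And>k. k \<in> I \<Longrightarrow> f k \<in> laurent_fun" "\<And>z. z \<noteq> 0 \<Longrightarrow> g z = (\<Sum>k\<in>I. c k * f k z)"
  shows "mass_term j q g = (\<Sum>k\<in>I. c k * mass_term j q (f k))"
proof -
  have s: "(\<lambda>z. \<Sum>k\<in>I. c k * f k z) \<in> laurent_fun"
    by (intro laurent_fun_sum laurent_fun_cmult assms(2))
  have "\<xi> j p g = (\<Sum>k\<in>I. c k * \<xi> j p (f k))" if "p < snd (zG ! j)" for p
  proof -
    have "\<xi> j p g = \<xi> j p (\<lambda>z. \<Sum>k\<in>I. c k * f k z)"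
      by (rule functional_cong[OF assms(1) that s, symmetric]) (simp add: assms(3))
    also have "\<dots> = (\<Sum>k\<in>I. c k * \<xi> j p (f k))"
      by (rule functional_sum[OF assms(1) that assms(2)])
    finally show ?thesis .
  qed
  hence "mass_term j q g = (\<Sum>p<snd (zG ! j). \<Sum>k\<in>I. c k * (\<xi> j p (f k) *
     (if p + q \<ge> snd (zG ! j) - 1 then taylor_coeff LG NG zG j (p + q - (snd (zG ! j) - 1)) else 0)))"
    unfolding mass_term_def by (intro sum.cong refl) (simp add: sum_distrib_right mult.assoc)
  thus ?thesis unfolding mass_term_def by (subst (asm) sum.swap) (simp add: sum_distrib_left)
qed

lemma second_kind_sum_taylor:
  assumes "j < length zG" "\<And>k. k \<in> I \<Longrightarrow> f k \<in> laurent_fun" "\<And>z. z \<noteq> 0 \<Longrightarrow> g z = (\<Sum>k\<in>I. c k * f k z)"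
  shows "fps_nth (fps_expansion (second_kind g) (cnj (fst (zG ! j)))) q =
    (\<Sum>k\<in>I. c k * fps_nth (fps_expansion (second_kind (f k)) (cnj (fst (zG ! j)))) q)"
proof (rule taylor_sum)
  show "second_kind (f k) analytic_on {cnj (fst (zG ! j))}" if "k \<in> I" for k
    by (intro second_kind_analytic zero_in_pole_region assms that)
  show "\<forall>\<^sub>F w in nhds (cnj (fst (zG ! j))). second_kind g w = (\<Sum>k\<in>I. c k * second_kind (f k) w)"
    by (rule eventually_mono[OF eventually_pole_region[OF zero_in_pole_region[OF assms(1)]]])
       (rule second_kind_sum[OF assms(2,3)])
qed

lemma laurent_sum_taylor:
  assumes "z \<noteq> 0" "\<And>k. k \<in> I \<Longrightarrow> f k \<in> laurent_fun" "\<And>z. z \<noteq> 0 \<Longrightarrow> g z = (\<Sum>k\<in>I. c k * f k z)"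
  shows "fps_nth (fps_expansion g z) q = (\<Sum>k\<in>I. c k * fps_nth (fps_expansion (f k) z) q)"
proof (rule taylor_sum)
  show "f k analytic_on {z}" if "k \<in> I" for k by (intro laurent_fun_analytic assms that)
  show "\<forall>\<^sub>F w in nhds z. g w = (\<Sum>k\<in>I. c k * f k w)"
    by (rule eventually_mono[OF eventually_nhds_in_open[of "- {0}"]]) (use assms in auto)
qed

lemma spectral_row_sum:
  assumes "\<And>k. k \<in> I \<Longrightarrow> f k \<in> laurent_fun" "\<And>z. z \<noteq> 0 \<Longrightarrow> g z = (\<Sum>k\<in>I. c k * f k z)"
    "r < 2 * NG + 2 * NC"
  shows "vec_index (spectral_row g) r = (\<Sum>k\<in>I. c k * vec_index (spectral_row (f k)) r)"
  using assms(3)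
proof (cases rule: row_index_cases)
  case (1 j q)
  have e1: "fps_nth (fps_expansion (second_kind g) (cnj (fst (zG ! j)))) q =
      (\<Sum>k\<in>I. c k * fps_nth (fps_expansion (second_kind (f k)) (cnj (fst (zG ! j)))) q)"
    by (rule second_kind_sum_taylor[OF 1(3) assms(1,2)])
  have e2: "mass_term j q g = (\<Sum>k\<in>I. c k * mass_term j q (f k))"
    by (rule mass_term_sum[OF 1(3) assms(1,2)])
  show ?thesis
    unfolding spectral_row_nth_left[OF 1(1,2)] e1 e2 by (simp add: right_diff_distrib sum_subtractf)
next
  case (2 s j q)
  have "fst (zC ! j) \<noteq> 0" by (rule zero_nonzero[OF prepC enumC 2(4)])
  from laurent_sum_taylor[where f = f and c = c and I = I and g = g, OF this assms(1,2)] show ?thesis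
    unfolding 2(1) spectral_row_nth_right[OF 2(2,3)] .
qed

text \<open>On multiples of \<open>LC\<close> the jets at its own zeros vanish, and in the remaining
  entries the masses cancel against those produced by the second kind function. Only the pairing
  with the divided difference is left.\<close>

lemma spectral_row_mult_LC:
  assumes f: "f \<in> laurent_fun"
    and \<psi>: "\<And>j. j < length zG \<Longrightarrow> \<psi> analytic_on {cnj (fst (zG ! j))}"
    and ev: "\<And>j. j < length zG \<Longrightarrow> \<forall>\<^sub>F w in nhds (cnj (fst (zG ! j))). \<forall>d\<in>laurent_span (2 * NG).
      (\<forall>y. y \<noteq> 0 \<longrightarrow> (cnj w - y) * d y = lp LG (cnj w) - lp LG y) \<longrightarrow> Bt f d = \<psi> w"
    and r: "r < 2 * NG + 2 * NC"
  shows "vec_index (spectral_row (\<lambda>z. lp LC z * f z)) r =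
    (if r < 2 * NG then - vec_index (jet (conj_zeros zG) \<psi>) r else 0)"
  using r
proof (cases rule: row_index_cases)
  case (1 j q)
  show ?thesis
    unfolding spectral_row_nth_left[OF 1(1,2)] second_kind_taylor[OF f 1(3,4) \<psi>[OF 1(3)] ev[OF 1(3)]]
    using 1 by (simp add: jet_nth[of r _ j q] slots_G fst_conj_zeros)
next
  case (2 s j q)
  have nz: "fst (zC ! j) \<noteq> 0" by (rule zero_nonzero[OF prepC enumC 2(4)])
  have "fps_nth (fps_expansion (\<lambda>z. lp LC z * f z) (fst (zC ! j))) q =
      (if q < snd (zC ! j) then 0 else fps_nth (fps_expansion (\<lambda>z. deflated LC NC zC j z * f z) (fst (zC ! j))) (q - snd (zC ! j)))"
  proof (rule taylor_factor)
    show "(\<lambda>z. deflated LC NC zC j z * f z) analytic_on {fst (zC ! j)}"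
      by (intro analytic_on_mult deflated_analytic[OF prepC enumC] laurent_fun_analytic f nz)
    show "\<forall>\<^sub>F w in nhds (fst (zC ! j)). lp LC w * f w =
        (w - fst (zC ! j)) ^ snd (zC ! j) * (deflated LC NC zC j w * f w)"
      by (rule eventually_mono[OF eventually_nhds_in_open[of "- {0}"]])
         (use nz in \<open>auto simp: lp_eq_deflated[OF prepC enumC 2(4)]\<close>)
  qed
  thus ?thesis unfolding 2(1) spectral_row_nth_right[OF 2(2,3)] using 2(5) by simp
qed

text \<open>As \<open>z\<close> is not a zero of \<open>LG\<close>, its conjugate keeps a distance
  from the conjugated zeros, and near them only the quotient branch of \<open>divided_diff\<close>
  is in force.\<close>

lemma divided_diff_conj_analytic:
  assumes j: "j < length zG" and z: "lp LG z \<noteq> 0"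
  shows "(\<lambda>w. divided_diff (conj_fun (lp LG)) (cnj z) w) analytic_on {cnj (fst (zG ! j))}"
proof -
  let ?z = "cnj (fst (zG ! j))"
  have nz: "fst (zG ! j) \<noteq> 0" by (rule zero_nonzero[OF prepG enumG j])
  have ne: "?z \<noteq> cnj z" using z zero_root[OF prepG enumG j] by auto
  have an1: "(\<lambda>w. (conj_fun (lp LG) (cnj z) - conj_fun (lp LG) w) / (cnj z - w)) analytic_on {?z}"
  proof (intro analytic_on_divide analytic_on_diff analytic_on_const analytic_on_ident)
    show "conj_fun (lp LG) analytic_on {?z}"
      by (intro conj_fun_analytic laurent_fun_analytic laurent_fun_lp nz)
  qed (use ne in auto)
  have "\<forall>\<^sub>F w in nhds ?z. w \<in> - {cnj z}"
    using ne by (intro eventually_nhds_in_open) auto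
  hence "\<forall>\<^sub>F w in nhds ?z. divided_diff (conj_fun (lp LG)) (cnj z) w = (conj_fun (lp LG) (cnj z) - conj_fun (lp LG) w) / (cnj z - w)"
    by eventually_elim (auto simp: divided_diff_def)
  from analytic_at_cong[OF this refl] an1 show ?thesis by simp
qed

end

section \<open>Connection coefficients and the three formulas for one perturbation\<close>

locale biorthogonal_perturbation = perturbation +
  fixes \<phi>1 \<phi>2 \<psi>1 \<psi>2 :: "nat \<Rightarrow> complex \<Rightarrow> complex" and H Ht :: "nat \<Rightarrow> complex"
  assumes system_B: "biorthogonal_system B \<phi>1 \<phi>2 H"
    and system_Bt: "biorthogonal_system Bt \<psi>1 \<psi>2 Ht"
begin

sublocale base: biorthogonal_form B \<phi>1 \<phi>2 H
  by unfold_locales (rule system_B)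

sublocale pert: biorthogonal_form Bt \<psi>1 \<psi>2 Ht
  by (intro biorthogonal_form.intro laurent_form_Bt biorthogonal_form_axioms.intro system_Bt)

abbreviation "A k \<equiv> spectral_row (\<phi>1 k)"

definition tau :: "nat \<Rightarrow> complex" where
  "tau l = det_rows (map A [l - 2 * NG..<l + 2 * NC])"

text \<open>The coefficient of \<open>\<phi>1 k\<close> in \<open>lp LC\<close> times
  \<open>F\<close>. Writing it through \<open>Bt\<close> makes perturbed orthogonality applicable,
  while \<open>Bt_mult_LG\<close> returns the usual Fourier coefficient.\<close>

definition connection :: "(complex \<Rightarrow> complex) \<Rightarrow> nat \<Rightarrow> complex" where
  "connection F k = Bt F (\<lambda>z. lp LG z * \<phi>2 k z) / H k"

definition mixed_row :: "nat \<Rightarrow> complex \<Rightarrow> complex vec" where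
  "mixed_row l z = (let m = l - 2 * NG + 1 in
      (jet (conj_zeros zG) (\<lambda>w. kernel \<phi>2 H (\<lambda>k. second_kind (\<phi>1 k)) m (cnj z) w)
        - row_mult (masses \<xi> zG (\<lambda>w. kernel \<phi>2 H \<phi>1 m (cnj z) w)) (taylor_mat LG NG zG)
        + (1 / cnj (lp LG z)) \<cdot>\<^sub>v jet (conj_zeros zG) (\<lambda>w. divided_diff (conj_fun (lp LG)) (cnj z) w))
      @\<^sub>v jet zC (\<lambda>w. kernel \<phi>2 H \<phi>1 m (cnj z) w))"

lemma LG_phi2_span: "k < n \<Longrightarrow> (\<lambda>z. lp LG z * \<phi>2 k z) \<in> laurent_span (n + 2 * NG)"
  by (intro prepared_mult_span prepG base.in_span)

lemma connection_expand:
  assumes "F \<in> laurent_span n" "z \<noteq> 0"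
  shows "lp LC z * F z = (\<Sum>k<n + 2 * NC. connection F k * \<phi>1 k z)"
  using base.expand1[OF prepared_mult_span[OF prepC assms(1)] assms(2)]
  by (simp add: connection_def Bt_mult_LG laurent_span_imp_fun[OF assms(1)])

lemma connection_row:
  assumes "F \<in> laurent_span n" "r < 2 * NG + 2 * NC"
  shows "vec_index (spectral_row (\<lambda>z. lp LC z * F z)) r = (\<Sum>k<n + 2 * NC. connection F k * vec_index (A k) r)"
  by (rule spectral_row_sum[OF _ _ assms(2)]) (auto intro: connection_expand[OF assms(1)])

lemma connection_top:
  assumes "g \<in> laurent_span l" "\<And>z. z \<noteq> 0 \<Longrightarrow> F z = c * cmv l z + g z"
  shows "connection F (l + 2 * NC) = c * Poly_Mapping.lookup LC ((-1) ^ l * int NC)"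
proof -
  have F: "F \<in> laurent_fun"
    by (rule laurent_fun_cong[OF _ assms(2)])
       (auto intro!: laurent_fun_add laurent_fun_cmult laurent_span_imp_fun[OF assms(1)])
  obtain h where h: "h \<in> laurent_span (l + 2 * NC)" "\<And>z. z \<noteq> 0 \<Longrightarrow>
      lp LC z * cmv l z = Poly_Mapping.lookup LC ((-1) ^ l * int NC) * cmv (l + 2 * NC) z + h z"
    using prepared_mult_cmv[OF prepC] by blast
  have "B (\<lambda>z. lp LC z * F z) (\<phi>2 (l + 2 * NC)) =
      (c * Poly_Mapping.lookup LC ((-1) ^ l * int NC)) * H (l + 2 * NC)"
  proof (rule base.leading1)
    show "(\<lambda>z. c * h z + lp LC z * g z) \<in> laurent_span (l + 2 * NC)"
      by (intro laurent_span_add laurent_span_cmult h prepared_mult_span prepC assms(1))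
    show "lp LC z * F z = c * Poly_Mapping.lookup LC ((-1) ^ l * int NC) * cmv (l + 2 * NC) z +
        (c * h z + lp LC z * g z)" if "z \<noteq> 0" for z
      using h(2)[OF that] by (simp add: assms(2)[OF that] algebra_simps)
  qed
  thus ?thesis using base.norm_nonzero by (simp add: connection_def Bt_mult_LG F)
qed

lemma even_power_shift:
  assumes "2 * N \<le> l"
  shows "(-1 :: int) ^ (l - 2 * N) = (-1) ^ l"
  using assms by (simp add: uminus_power_if)

context
  fixes l :: nat
  assumes l: "2 * NG \<le> l"
begin

abbreviation "a \<equiv> l - 2 * NG"
abbreviation "n \<equiv> 2 * NG + 2 * NC"
abbreviation "lead_C \<equiv> Poly_Mapping.lookup LC ((-1) ^ l * int NC)"
abbreviation "lead_G \<equiv> Poly_Mapping.lookup LG ((-1) ^ l * int NG)"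

lemma lead_nonzero: "lead_C \<noteq> 0" "lead_G \<noteq> 0"
  using prepC prepG by (cases "even l"; simp add: prepared_def)+

lemma an: "a + n = l + 2 * NC" and n_pos: "n > 0"
  using l prepG by (auto simp: prepared_def)

lemma A_carrier: "A k \<in> carrier_vec n"
  by (rule spectral_row_carrier)

text \<open>Lower edge of the band: for such \<open>k\<close>, \<open>lp LG\<close> times
  \<open>\<phi>2 k\<close> stays below index \<open>l\<close>.\<close>

lemma connection_low: "k < a \<Longrightarrow> connection (\<psi>1 l) k = 0"
  using l laurent_span_mono[OF LG_phi2_span[of k "Suc k"], of l]
  by (simp add: connection_def pert.orthogonal2)

text \<open>At \<open>k = a\<close> the product of \<open>lp LG\<close> and \<open>\<phi>2 a\<close>
  first reaches index \<open>l\<close>, with leading coefficient \<open>lead_G\<close>;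
  antilinearity conjugates it.\<close>

lemma connection_bottom: "connection (\<psi>1 l) a = cnj lead_G * Ht l / H a"
proof -
  obtain h where h: "h \<in> laurent_span (a + 2 * NG)" "\<And>z. z \<noteq> 0 \<Longrightarrow>
      lp LG z * cmv a z = Poly_Mapping.lookup LG ((-1) ^ a * int NG) * cmv (a + 2 * NG) z + h z"
    using prepared_mult_cmv[OF prepG] by blast
  obtain g where g: "g \<in> laurent_span a" "\<And>z. \<phi>2 a z = cmv a z + g z" using base.monic[of a] by metis
  have la: "a + 2 * NG = l" using l by simp
  have "Bt (\<psi>1 l) (\<lambda>z. lp LG z * \<phi>2 a z) = cnj lead_G * Ht l"
  proof (rule pert.leading2)
    show "(\<lambda>z. h z + lp LG z * g z) \<in> laurent_span l"
      using h(1) prepared_mult_span[OF prepG g(1)] by (simp add: la laurent_span_add)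
    show "lp LG z * \<phi>2 a z = lead_G * cmv l z + (h z + lp LG z * g z)" if "z \<noteq> 0" for z
      using h(2)[OF that] even_power_shift[OF l] by (simp add: la g(2) distrib_left)
  qed
  thus ?thesis by (simp add: connection_def)
qed

lemma psi1_monic: obtains g where "g \<in> laurent_span l" "\<And>z. \<psi>1 l z = cmv l z + g z"
  by (rule pert.monic[of l]) (rule that)

lemma connection_last: "connection (\<psi>1 l) (a + n) = lead_C"
proof -
  obtain g where g: "g \<in> laurent_span l" "\<And>z. \<psi>1 l z = cmv l z + g z" using psi1_monic by blast
  show ?thesis using connection_top[OF g(1), of "\<psi>1 l" 1] g(2) by (simp add: an)
qed

lemma connection_sum:
  fixes h :: "nat \<Rightarrow> complex"
  shows "(\<Sum>k<Suc l + 2 * NC. connection (\<psi>1 l) k * h k) = (\<Sum>k=a..a + n. connection (\<psi>1 l) k * h k)"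
  by (rule sum.mono_neutral_right) (use an connection_low in \<open>auto simp: not_le\<close>)

text \<open>Divided differences of \<open>LG\<close> lie below index \<open>2 * NG \<le> l\<close>
  and pair to zero with \<open>\<psi>1 l\<close>, so \<open>spectral_row_mult_LC\<close> applies
  with \<open>\<psi> = 0\<close>.\<close>

lemma connection_relation:
  assumes "r < n"
  shows "(\<Sum>k=a..a + n. connection (\<psi>1 l) k * vec_index (A k) r) = 0"
proof -
  have "vec_index (spectral_row (\<lambda>z. lp LC z * \<psi>1 l z)) r =
      (if r < 2 * NG then - vec_index (jet (conj_zeros zG) (\<lambda>_. 0)) r else 0)"
    by (rule spectral_row_mult_LC)
       (use assms l in \<open>auto intro!: always_eventually pert.orthogonal2 elim: laurent_span_mono\<close>)
  moreover have "vec_index (jet (conj_zeros zG) (\<lambda>_. 0)) r = 0" if "r < 2 * NG"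
    using that by (cases "slots zG ! r") (simp add: jet_nth[of r "conj_zeros zG"] slots_G fps_expansion_const)
  ultimately have "vec_index (spectral_row (\<lambda>z. lp LC z * \<psi>1 l z)) r = 0" by simp
  thus ?thesis
    unfolding connection_row[OF pert.in_span(1)[OF lessI] assms] connection_sum .
qed

lemma tau_eq: "tau l = det_rows (map A [a..<a + n])" "tau (l + 1) = det_rows (map A [a + 1..<a + n + 1])"
  using l by (simp_all add: tau_def an Suc_diff_le)

lemma first_polynomial:
  assumes "tau l \<noteq> 0" "z \<noteq> 0" "lp LC z \<noteq> 0"
  shows "\<psi>1 l z = lead_C / lp LC z * (1 / tau l) *
    det_rows (map (\<lambda>k. A k @\<^sub>v vec_of_list [\<phi>1 k z]) [a..<l + 2 * NC + 1])"
proof -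
  have "lead_C * det_rows (map (\<lambda>k. A k @\<^sub>v vec_of_list [\<phi>1 k z]) [a..<a + n + 1]) =
      (\<Sum>k=a..a + n. connection (\<psi>1 l) k * \<phi>1 k z) * tau l"
    unfolding connection_last[symmetric] tau_eq(1)
    by (rule cramer_bordered[OF A_carrier connection_relation n_pos])
  also have "(\<Sum>k=a..a + n. connection (\<psi>1 l) k * \<phi>1 k z) = lp LC z * \<psi>1 l z"
    using connection_expand[OF pert.in_span(1)[of l "Suc l"] assms(2)] connection_sum[of "\<lambda>k. \<phi>1 k z"] by simp
  finally show ?thesis using assms unfolding an by (simp add: field_simps)
qed

lemma norm_ratio:
  assumes "tau l \<noteq> 0"
  shows "Ht l = lead_C / cnj lead_G * H a * (tau (l + 1) / tau l)"
proof -
  have "lead_C * tau (l + 1) = (-1) ^ n * (cnj lead_G * Ht l / H a) * tau l"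
    unfolding connection_last[symmetric] connection_bottom[symmetric] tau_eq
    by (rule cramer_shift[OF A_carrier connection_relation n_pos])
  \<comment> \<open>The sign \<open>(-1) ^ n\<close> is 1, since
    \<open>n = 2 * NG + 2 * NC\<close>.\<close>
  thus ?thesis using assms lead_nonzero base.norm_nonzero[of a] by (simp add: field_simps power_add)
qed

lemma mixed_row_carrier: "mixed_row l z \<in> carrier_vec n"
  by (intro carrier_vecI) (simp add: mixed_row_def Let_def slots_G slots_C)

text \<open>The kernels are finite sums over \<open>k \<le> a\<close>, so jets and masses distribute
  over them: up to the divided difference, the mixed row is a combination of the rows
  \<open>A k\<close> that lie at or below the band.\<close>

lemma mixed_row_nth:
  assumes r: "r < n"
  shows "vec_index (mixed_row l z) r = (\<Sum>k<a + 1. cnj (\<phi>2 k z) / H k * vec_index (A k) r) +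
    (if r < 2 * NG then 1 / cnj (lp LG z) * vec_index (jet (conj_zeros zG) (\<lambda>w. divided_diff (conj_fun (lp LG)) (cnj z) w)) r else 0)"
proof -
  let ?K = "\<lambda>w. kernel \<phi>2 H \<phi>1 (a + 1) (cnj z) w"
  have K: "?K w = (\<Sum>k<a + 1. cnj (\<phi>2 k z) / H k * \<phi>1 k w)" for w
    by (simp add: kernel_def conj_fun_def divide_inverse)
  have KC: "kernel \<phi>2 H (\<lambda>k. second_kind (\<phi>1 k)) (a + 1) (cnj z) w = (\<Sum>k<a + 1. cnj (\<phi>2 k z) / H k * second_kind (\<phi>1 k) w)" for w
    by (simp add: kernel_def conj_fun_def divide_inverse)
  from r show ?thesis
  proof (cases rule: row_index_cases)
    case (1 j q)
    have zj: "cnj (fst (zG ! j)) \<in> pole_region" by (rule zero_in_pole_region[OF 1(3)])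
    have "fps_nth (fps_expansion (\<lambda>w. kernel \<phi>2 H (\<lambda>k. second_kind (\<phi>1 k)) (a + 1) (cnj z) w) (cnj (fst (zG ! j)))) q =
      (\<Sum>k<a + 1. cnj (\<phi>2 k z) / H k * fps_nth (fps_expansion (second_kind (\<phi>1 k)) (cnj (fst (zG ! j)))) q)"
      by (rule taylor_sum[OF _ always_eventually]) (use KC in \<open>blast intro: second_kind_analytic zj base.in_laurent_fun\<close>)+
    moreover have "mass_term j q ?K = (\<Sum>k<a + 1. cnj (\<phi>2 k z) / H k * mass_term j q (\<phi>1 k))"
      by (rule mass_term_sum[OF 1(3)], rule base.in_laurent_fun, rule K)
    ultimately show ?thesis
      unfolding spectral_row_nth_left[OF 1(1,2)]
      using 1(1-3) by (simp add: mixed_row_def Let_def slots_G slots_C dim_row_mult_masses row_mult_masses_nth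
          jet_nth[of r _ j q] fst_conj_zeros right_diff_distrib sum_subtractf del: sum.lessThan_Suc)
  next
    case (2 s j q)
    have nz: "fst (zC ! j) \<noteq> 0" by (rule zero_nonzero[OF prepC enumC 2(4)])
    have "fps_nth (fps_expansion ?K (fst (zC ! j))) q =
      (\<Sum>k<a + 1. cnj (\<phi>2 k z) / H k * fps_nth (fps_expansion (\<phi>1 k) (fst (zC ! j))) q)"
      by (rule laurent_sum_taylor[OF nz], rule base.in_laurent_fun, rule K)
    thus ?thesis unfolding 2(1) spectral_row_nth_right[OF 2(2,3)]
      using 2(2,3) by (simp add: mixed_row_def Let_def slots_G slots_C jet_nth)
  qed
qed

text \<open>Apply the spectral functionals to \<open>lp LC\<close> times the perturbed kernel
  \<open>F\<close>. Its coefficients with \<open>k \<le> a\<close> are \<open>cnj (lp LG z)\<close>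
  times those of the unperturbed kernel and form the mixed row together with the divided difference.
  The other coefficients multiply \<open>A k\<close> for \<open>a < k \<le> a + n\<close>; in the
  determinant only \<open>k = a + n\<close> survives, and that coefficient contains
  \<open>\<psi>2 l z\<close>.\<close>

lemma second_polynomial:
  assumes \<tau>: "tau l \<noteq> 0" and z: "z \<noteq> 0" "lp LG z \<noteq> 0"
  shows "cnj (\<psi>2 l z) = - (cnj (lp LG z) / cnj lead_G) * (H a / tau l) *
    det_rows (map A [a + 1..<l + 2 * NC] @ [mixed_row l z])"
proof -
  define F where "F w = (\<Sum>k<Suc l. cnj (\<psi>2 k z) / Ht k * \<psi>1 k w)" for w
  define c where "c = connection F"
  let ?\<psi> = "\<lambda>w. divided_diff (conj_fun (lp LG)) (cnj z) w"
  have F: "F \<in> laurent_span (Suc l)"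
    unfolding F_def by (intro laurent_span_sum laurent_span_cmult pert.in_span) auto
  \<comment> \<open>\<open>F\<close> is the perturbed kernel with first argument
    \<open>cnj z\<close>, truncated after index \<open>l\<close>, so it reproduces exactly up to
    that index.\<close>
  have reproducing: "Bt F g = cnj (g z)" if g: "g \<in> laurent_span (Suc l)" for g
  proof -
    have "Bt F g = (\<Sum>k<Suc l. cnj (\<psi>2 k z) / Ht k * Bt (\<psi>1 k) g)"
      unfolding F_def by (rule pert.form_sum_left) (use laurent_span_imp_fun[OF g] in auto)
    also have "\<dots> = cnj (\<Sum>k<Suc l. cnj (Bt (\<psi>1 k) g / Ht k) * \<psi>2 k z)"
      unfolding cnj_sum by (intro sum.cong refl) (simp add: mult.commute)
    also have "\<dots> = cnj (g z)" using pert.expand2[OF g z(1)] by simp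
    finally show ?thesis .
  qed
  \<comment> \<open>Explains \<open>m = l - 2 * NG + 1\<close>: these are the \<open>k\<close> for
    which \<open>lp LG\<close> times \<open>\<phi>2 k\<close> remains within the reproducing
    range.\<close>
  have c_low: "c k = cnj (lp LG z) * (cnj (\<phi>2 k z) / H k)" if "k < a + 1" for k
  proof -
    have "(\<lambda>z. lp LG z * \<phi>2 k z) \<in> laurent_span (Suc l)"
      using LG_phi2_span[OF that] l by (simp add: Suc_diff_le)
    thus ?thesis by (simp add: c_def connection_def reproducing)
  qed
  \<comment> \<open>Only the summand \<open>k = l\<close> of \<open>F\<close> contains
    \<open>cmv l\<close>, so the top coefficient isolates \<open>\<psi>2 l z\<close>.\<close>
  have c_top: "c (a + n) = cnj (\<psi>2 l z) / Ht l * lead_C"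
  proof -
    obtain g where g: "g \<in> laurent_span l" "\<And>z. \<psi>1 l z = cmv l z + g z" using psi1_monic by blast
    let ?h = "\<lambda>w. cnj (\<psi>2 l z) / Ht l * g w + (\<Sum>k<l. cnj (\<psi>2 k z) / Ht k * \<psi>1 k w)"
    have "?h \<in> laurent_span l"
      by (intro laurent_span_add laurent_span_sum laurent_span_cmult pert.in_span g) auto
    moreover have "F w = cnj (\<psi>2 l z) / Ht l * cmv l w + ?h w" for w
      by (simp add: F_def g(2) distrib_left add_divide_distrib)
    ultimately show ?thesis unfolding c_def an by (rule connection_top)
  qed
  have row: "vec_index (spectral_row (\<lambda>w. lp LC w * F w)) r = (if r < 2 * NG then - vec_index (jet (conj_zeros zG) ?\<psi>) r else 0)"
    if "r < n" for r
  proof (rule spectral_row_mult_LC[OF laurent_span_imp_fun[OF F] _ _ that])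
    fix j assume j: "j < length zG"
    let ?z = "cnj (fst (zG ! j))"
    have ne: "?z \<noteq> cnj z" using z zero_root[OF prepG enumG j] by auto
    have ev: "\<forall>\<^sub>F w in nhds ?z. w \<in> - {cnj z}"
      using ne by (intro eventually_nhds_in_open) auto
    show "?\<psi> analytic_on {?z}" by (rule divided_diff_conj_analytic[OF j z(2)])
    show "\<forall>\<^sub>F w in nhds ?z. \<forall>d\<in>laurent_span (2 * NG).
      (\<forall>y. y \<noteq> 0 \<longrightarrow> (cnj w - y) * d y = lp LG (cnj w) - lp LG y) \<longrightarrow> Bt F d = ?\<psi> w"
      using ev
    proof eventually_elim
      case (elim w)
      show ?case
      proof (intro ballI impI)
        fix d assume d: "d \<in> laurent_span (2 * NG)" "\<forall>y. y \<noteq> 0 \<longrightarrow> (cnj w - y) * d y = lp LG (cnj w) - lp LG y"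
        have ne': "cnj w \<noteq> z" using elim by auto
        \<comment> \<open>By the reproducing property the pairing with \<open>d\<close> is just
          \<open>cnj (d z)\<close>, the divided difference of the conjugated polynomial.\<close>
        have "d z = (lp LG (cnj w) - lp LG z) / (cnj w - z)"
          using d(2) z(1) ne' by (simp add: eq_divide_eq mult.commute)
        hence "cnj (d z) = (conj_fun (lp LG) w - conj_fun (lp LG) (cnj z)) / (w - cnj z)"
          by (simp add: conj_fun_def)
        also have "\<dots> = ?\<psi> w"
          using elim by (auto simp: divided_diff_def divide_simps) (simp_all add: algebra_simps)
        finally show "Bt F d = ?\<psi> w"
          using reproducing[OF laurent_span_mono[OF d(1)]] l by simp
      qed
    qed
  qed
  have "cnj (lp LG z) * det_rows (map A [a + 1..<a + n] @ [mixed_row l z]) =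
      (- c (a + n)) * det_rows (map A [a + 1..<a + n + 1])"
  proof (rule det_rows_replace_last[OF A_carrier n_pos mixed_row_carrier])
    fix r assume r: "r < n"
    have split: "{..<Suc l + 2 * NC} = {..<a + 1} \<union> {a + 1..a + n}" using an by auto
    have "(\<Sum>k<a + 1. c k * vec_index (A k) r) + (\<Sum>k=a + 1..a + n. c k * vec_index (A k) r) =
        (\<Sum>k<Suc l + 2 * NC. c k * vec_index (A k) r)"
      unfolding split by (rule sum.union_disjoint[symmetric]) auto
    also have "\<dots> = (if r < 2 * NG then - vec_index (jet (conj_zeros zG) ?\<psi>) r else 0)"
      using connection_row[OF F r] row[OF r] by (simp add: c_def)
    also have "(\<Sum>k<a + 1. c k * vec_index (A k) r) = cnj (lp LG z) * (\<Sum>k<a + 1. cnj (\<phi>2 k z) / H k * vec_index (A k) r)"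
      unfolding sum_distrib_left by (intro sum.cong refl) (simp add: c_low)
    finally have eq: "cnj (lp LG z) * (\<Sum>k<a + 1. cnj (\<phi>2 k z) / H k * vec_index (A k) r) +
        (\<Sum>k=a + 1..a + n. c k * vec_index (A k) r) =
        (if r < 2 * NG then - vec_index (jet (conj_zeros zG) ?\<psi>) r else 0)" .
    have *: "s * (x + (if P then 1 / s * j else 0)) = - y"
      if "s * x + y = (if P then - j else 0)" "s \<noteq> 0" for s x y j :: complex and P
      using that by (cases P) (simp_all add: distrib_left eq_neg_iff_add_eq_0 add_ac)
    have "cnj (lp LG z) * vec_index (mixed_row l z) r = - (\<Sum>k=a + 1..a + n. c k * vec_index (A k) r)"
      unfolding mixed_row_nth[OF r] by (rule *[OF eq]) (simp add: z(2))
    thus "cnj (lp LG z) * vec_index (mixed_row l z) r = (\<Sum>k=a + 1..a + n. (- c k) * vec_index (A k) r)"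
      by (simp add: sum_negf del: sum.cl_ivl_Suc)
  qed
  hence "cnj (lp LG z) * det_rows (map A [a + 1..<a + n] @ [mixed_row l z]) =
      - (cnj (\<psi>2 l z) / Ht l * lead_C) * tau (l + 1)"
    by (simp only: c_top tau_eq(2))
  \<comment> \<open>Eliminating \<open>tau (l + 1)\<close> through the norm formula cancels both
    \<open>Ht l\<close> and \<open>lead_C\<close>.\<close>
  also have "tau (l + 1) = Ht l * cnj lead_G * tau l / (lead_C * H a)"
    using norm_ratio[OF \<tau>] \<tau> lead_nonzero base.norm_nonzero[of a] by (simp add: field_simps)
  also have "- (cnj (\<psi>2 l z) / Ht l * lead_C) * (Ht l * cnj lead_G * tau l / (lead_C * H a)) =
      - (cnj (\<psi>2 l z) * cnj lead_G * tau l / H a)"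
    using pert.norm_nonzero[of l] lead_nonzero by simp
  finally show ?thesis
    using \<tau> z(2) lead_nonzero base.norm_nonzero[of a] unfolding an by (simp add: field_simps)
qed

end

end

section \<open>Conjugated rows and the exchange of the two slots\<close>

lemma row_mult_cnj:
  assumes "dim_vec v = dim_row M"
  shows "row_mult (map_vec cnj v) (map_mat cnj M) = map_vec cnj (row_mult v M)"
  using assms by (intro eq_vecI) (auto simp: row_mult_def scalar_prod_def intro!: sum.cong)

context biorthogonal_perturbation
begin

lemma kernel_as_conj_fun:
  "(\<lambda>x. kernel f (\<lambda>k. cnj (H k)) \<phi>2 m x z) = conj_fun (\<lambda>w. kernel \<phi>2 H f m (cnj z) w)"
  by (auto simp: fun_eq_iff kernel_def conj_fun_def mult_ac)

text \<open>Conjugation exchanges the two polynomial families in the kernels and moves jets from the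
  conjugated zeros to the zeros and vice versa. The masses appear as an explicit sum over
  \<open>k\<close>, since a conjugated functional is defined through its values on the
  polynomials.\<close>

lemma cnj_mixed_row:
  assumes z: "lp LG z \<noteq> 0"
  shows "map_vec cnj (mixed_row l z) = (let m = l - 2 * NG + 1 in
      (jet zG (\<lambda>x. kernel (\<lambda>k. second_kind (\<phi>1 k)) (\<lambda>k. cnj (H k)) \<phi>2 m x z)
        - row_mult
            (Matrix.vec (2 * NG) (\<lambda>i. \<Sum>k<m. cnj (vec_index (masses \<xi> zG (\<phi>1 k)) i)
                * inverse (cnj (H k)) * \<phi>2 k z))
            (map_mat cnj (taylor_mat LG NG zG))
        + (1 / lp LG z) \<cdot>\<^sub>v jet zG (\<lambda>x. divided_diff (lp LG) x z))
      @\<^sub>v jet (conj_zeros zC) (\<lambda>x. kernel \<phi>1 (\<lambda>k. cnj (H k)) \<phi>2 m x z))"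
    (is "_ = ?rhs")
proof -
  define m where "m = l - 2 * NG + 1"
  let ?K = "\<lambda>w. kernel \<phi>2 H \<phi>1 m (cnj z) w"
  let ?KC = "\<lambda>w. kernel \<phi>2 H (\<lambda>k. second_kind (\<phi>1 k)) m (cnj z) w"
  let ?\<psi> = "\<lambda>w. divided_diff (conj_fun (lp LG)) (cnj z) w"
  let ?v = "Matrix.vec (2 * NG) (\<lambda>i. \<Sum>k<m. cnj (vec_index (masses \<xi> zG (\<phi>1 k)) i) * inverse (cnj (H k)) * \<phi>2 k z)"
  have K: "?K \<in> laurent_fun"
    unfolding kernel_def by (intro laurent_fun_sum laurent_fun_cmult base.in_laurent_fun)
  have v: "?v = map_vec cnj (masses \<xi> zG ?K)"
  proof (rule eq_vecI)
    fix i assume "i < dim_vec (map_vec cnj (masses \<xi> zG ?K))"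
    hence i: "i < 2 * NG" by (simp add: slots_G)
    obtain j p where jp: "slots zG ! i = (j, p)" by fastforce
    have "(j, p) \<in> set (slots zG)" using i jp nth_mem[of i "slots zG"] slots_G by simp
    hence j: "j < length zG" "p < snd (zG ! j)" by (auto simp: set_slots)
    have "\<xi> j p ?K = (\<Sum>k<m. cnj (\<phi>2 k z) * inverse (H k) * \<xi> j p (\<phi>1 k))"
      unfolding kernel_def by (subst functional_sum[OF j]) (auto simp: conj_fun_def)
    thus "vec_index ?v i = vec_index (map_vec cnj (masses \<xi> zG ?K)) i"
      using i by (simp add: masses_nth[OF _ jp] slots_G mult_ac)
  qed (simp add: slots_G)
  have masses: "row_mult ?v (map_mat cnj (taylor_mat LG NG zG)) =
      map_vec cnj (row_mult (masses \<xi> zG ?K) (taylor_mat LG NG zG))"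
    unfolding v by (rule row_mult_cnj) (simp add: dim_taylor_mat)
  have jet_conj: "vec_index (jet zG (conj_fun f)) i = cnj (vec_index (jet (conj_zeros zG) f) i)"
    if "i < 2 * NG" "\<And>j. j < length zG \<Longrightarrow> f analytic_on {cnj (fst (zG ! j))}" for i f
  proof -
    obtain j p where jp: "slots zG ! i = (j, p)" by fastforce
    have "(j, p) \<in> set (slots zG)" using that(1) jp nth_mem[of i "slots zG"] slots_G by simp
    hence j: "j < length zG" by (simp add: set_slots)
    thus ?thesis using taylor_conj_fun[OF that(2)[OF j]] that(1) jp
      by (simp add: jet_nth[of i _ j p] slots_G fst_conj_zeros)
  qed
  have jetC: "jet (conj_zeros zC) (conj_fun f) = map_vec cnj (jet zC f)" if "f \<in> laurent_fun" for f
  proof (rule eq_vecI)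
    fix i assume "i < dim_vec (map_vec cnj (jet zC f))"
    hence i: "i < 2 * NC" by (simp add: slots_C)
    obtain j p where jp: "slots zC ! i = (j, p)" by fastforce
    have "(j, p) \<in> set (slots zC)" using i jp nth_mem[of i "slots zC"] slots_C by simp
    hence j: "j < length zC" by (simp add: set_slots)
    have "f analytic_on {fst (zC ! j)}"
      by (intro laurent_fun_analytic that zero_nonzero[OF prepC enumC j])
    thus "vec_index (jet (conj_zeros zC) (conj_fun f)) i = vec_index (map_vec cnj (jet zC f)) i"
      using taylor_conj_fun[of f "fst (zC ! j)"] i jp j
      by (simp add: jet_nth[of i _ j p] slots_C fst_conj_zeros)
  qed simp
  have KC: "?KC analytic_on {cnj (fst (zG ! j))}" if "j < length zG" for j
    unfolding kernel_def
    by (intro analytic_on_sum analytic_on_mult analytic_on_const second_kind_analytic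
        base.in_laurent_fun zero_in_pole_region that)
  \<comment> \<open>The divided difference is symmetric. Comparing the quotient branches near the
    zeros is enough, because \<open>z\<close> is not one of them.\<close>
  have jet\<psi>: "vec_index (jet zG (\<lambda>x. divided_diff (lp LG) x z)) i = vec_index (jet zG (conj_fun ?\<psi>)) i"
    if "i < 2 * NG" for i
  proof -
    obtain j p where jp: "slots zG ! i = (j, p)" by fastforce
    have "(j, p) \<in> set (slots zG)" using that jp nth_mem[of i "slots zG"] slots_G by simp
    hence j: "j < length zG" by (simp add: set_slots)
    have ne: "fst (zG ! j) \<noteq> z" using z zero_root[OF prepG enumG j] by auto
    have "\<forall>\<^sub>F x in nhds (fst (zG ! j)). x \<in> - {z}"
      using ne by (intro eventually_nhds_in_open) auto
    hence "\<forall>\<^sub>F x in nhds (fst (zG ! j)). divided_diff (lp LG) x z = conj_fun ?\<psi> x"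
    proof eventually_elim
      case (elim x)
      have "(lp LG x - lp LG z) / (x - z) = (lp LG z - lp LG x) / (z - x)"
        by (metis minus_diff_eq minus_divide_divide)
      thus ?case using elim by (simp add: divided_diff_def conj_fun_def)
    qed
    from fps_expansion_cong[OF this] show ?thesis
      using that jp by (simp add: jet_nth slots_G)
  qed
  have mixed: "mixed_row l z = (jet (conj_zeros zG) ?KC - row_mult (masses \<xi> zG ?K) (taylor_mat LG NG zG)
      + (1 / cnj (lp LG z)) \<cdot>\<^sub>v jet (conj_zeros zG) ?\<psi>) @\<^sub>v jet zC ?K"
    by (simp only: mixed_row_def Let_def m_def)
  have "map_vec cnj (mixed_row l z) =
      (jet zG (conj_fun ?KC) - row_mult ?v (map_mat cnj (taylor_mat LG NG zG))
        + (1 / lp LG z) \<cdot>\<^sub>v jet zG (\<lambda>x. divided_diff (lp LG) x z))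
      @\<^sub>v jet (conj_zeros zC) (conj_fun ?K)"
    unfolding masses jetC[OF K]
  proof (rule eq_vecI)
    fix i assume "i < dim_vec ((jet zG (conj_fun ?KC) - map_vec cnj (row_mult (masses \<xi> zG ?K) (taylor_mat LG NG zG))
        + (1 / lp LG z) \<cdot>\<^sub>v jet zG (\<lambda>x. divided_diff (lp LG) x z)) @\<^sub>v map_vec cnj (jet zC ?K))"
    hence i: "i < 2 * NG + 2 * NC" by (simp add: slots_G slots_C)
    show "vec_index (map_vec cnj (mixed_row l z)) i =
      vec_index ((jet zG (conj_fun ?KC) - map_vec cnj (row_mult (masses \<xi> zG ?K) (taylor_mat LG NG zG))
        + (1 / lp LG z) \<cdot>\<^sub>v jet zG (\<lambda>x. divided_diff (lp LG) x z)) @\<^sub>v map_vec cnj (jet zC ?K)) i"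
    proof (cases "i < 2 * NG")
      case True
      have 1: "vec_index (jet zG (conj_fun ?KC)) i = cnj (vec_index (jet (conj_zeros zG) ?KC) i)"
        by (rule jet_conj[OF True KC])
      have 2: "vec_index (jet zG (\<lambda>x. divided_diff (lp LG) x z)) i = cnj (vec_index (jet (conj_zeros zG) ?\<psi>) i)"
        unfolding jet\<psi>[OF True] by (rule jet_conj[OF True divided_diff_conj_analytic[OF _ z]])
      show ?thesis
        using i True by (simp add: mixed slots_G slots_C dim_row_mult_masses 1 2)
    next
      case False
      thus ?thesis
        using i by (simp add: mixed slots_G slots_C dim_row_mult_masses)
    qed
  qed (simp add: mixed slots_G slots_C)
  also have "\<dots> = ?rhs"
    by (simp only: Let_def m_def[symmetric] kernel_as_conj_fun)
  finally show ?thesis .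
qed

end

text \<open>The new Gram matrix is the conjugate transpose of the old one, and taking adjoints in
  its factorization exchanges \<open>S1\<close> and \<open>S2\<close> and conjugates
  \<open>H\<close>.\<close>

lemma biorthogonal_system_swap:
  assumes "biorthogonal_system Q \<phi>1 \<phi>2 H"
  shows "biorthogonal_system (\<lambda>f g. cnj (Q g f)) \<phi>2 \<phi>1 (\<lambda>k. cnj (H k))"
proof -
  obtain S1 S2 R1 R2 where S: "lower_unitriangular S1" "lower_unitriangular S2"
    "\<forall>k. H k \<noteq> 0" "lower_unitriangular R1" "lower_unitriangular R2" "lower_inverse S1 R1" "lower_inverse S2 R2"
    and G: "\<And>i j. gram Q i j = (\<Sum>k\<le>min i j. R1 i k * H k * cnj (R2 j k))"
    and \<phi>: "\<phi>1 = cmv_comb S1" "\<phi>2 = cmv_comb S2"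
    using assms unfolding biorthogonal_system_def gauss_borel_def by blast
  have "gram (\<lambda>f g. cnj (Q g f)) i j = (\<Sum>k\<le>min i j. R2 i k * cnj (H k) * cnj (R1 j k))" for i j
  proof -
    have "gram (\<lambda>f g. cnj (Q g f)) i j = cnj (gram Q j i)" by (simp add: gram_def)
    thus ?thesis by (simp add: G min.commute mult_ac)
  qed
  thus ?thesis
    unfolding biorthogonal_system_def gauss_borel_def using S \<phi> by auto
qed

subsection \<open>Evaluation of the bivariate functional\<close>

lemma agrees_near_sym: "agrees_near K f g \<Longrightarrow> agrees_near K g f"
  unfolding agrees_near_def by metis

lemma agrees_near_trans:
  assumes "agrees_near K f g" "agrees_near K g h"
  shows "agrees_near K f h"
proof -
  obtain U V where "open U" "K \<subseteq> U" "\<forall>x\<in>U. f x = g x" "open V" "K \<subseteq> V" "\<forall>x\<in>V. g x = h x"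
    using assms by (auto simp: agrees_near_def)
  thus ?thesis unfolding agrees_near_def by (intro exI[of _ "U \<inter> V"]) auto
qed

text \<open>Both functions have the same test representatives, so \<open>SOME\<close> ranges over
  the same predicate and makes the same choice.\<close>

lemma evaluate_cong:
  assumes "agrees_near (support F v) f f'"
  shows "evaluate F v f = evaluate F v f'"
proof -
  have "agrees_near (support F v) f g \<longleftrightarrow> agrees_near (support F v) f' g" for g
    using assms agrees_near_trans agrees_near_sym by blast
  thus ?thesis by (simp add: evaluate_def)
qed

lemma admissible_cong:
  assumes "agrees_near (support F v) f f'" "admissible F v f'"
  shows "admissible F v f"
  using assms unfolding admissible_def by (meson agrees_near_trans)

lemma support_subset_cstar2: "support F v \<subseteq> cstar2"
  by (auto simp: support_def)

lemma open_cstar2: "open cstar2"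
  by (auto simp: cstar2_def intro!: open_Times)

lemma agrees_near_cstar2:
  assumes "\<And>z1 z2. z1 \<noteq> 0 \<Longrightarrow> z2 \<noteq> 0 \<Longrightarrow> f (z1, z2) = f' (z1, z2)"
  shows "agrees_near (support F v) f f'"
  unfolding agrees_near_def
  by (intro exI[of _ cstar2] conjI open_cstar2 support_subset_cstar2) (use assms in \<open>auto simp: cstar2_def\<close>)

context bivariate_functional
begin

lemma F_add: "f \<in> F \<Longrightarrow> g \<in> F \<Longrightarrow> (\<lambda>x. f x + g x) \<in> F"
  using continuous_map_image_subset_topspace[OF continuous_add] by (auto simp: topspace_T)

lemma F_cmult: "f \<in> F \<Longrightarrow> (\<lambda>x. c * f x) \<in> F"
  using continuous_map_image_subset_topspace[OF continuous_scale] by (auto simp: topspace_T)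

lemma u_add: "f \<in> F \<Longrightarrow> g \<in> F \<Longrightarrow> u (\<lambda>x. f x + g x) = u f + u g"
  using linear by (auto simp: linear_on_def)

lemma u_cmult: "f \<in> F \<Longrightarrow> u (\<lambda>x. c * f x) = c * u f"
  using linear by (auto simp: linear_on_def)

text \<open>The difference vanishes on a neighbourhood of the support, so its own support is
  disjoint from it. This makes \<open>evaluate\<close> independent of the representative.\<close>

lemma u_eq_near:
  assumes g: "g \<in> F" and h: "h \<in> F" and gh: "agrees_near (support F u) g h"
  shows "u g = u h"
proof -
  let ?k = "\<lambda>x. g x + (- 1) * h x"
  obtain W where W: "open W" "support F u \<subseteq> W" "\<And>x. x \<in> W \<Longrightarrow> g x = h x"
    using gh by (auto simp: agrees_near_def)
  have k: "?k \<in> F" by (intro F_add F_cmult g h)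
  have "closure {x \<in> cstar2. ?k x \<noteq> 0} \<subseteq> - W"
    by (rule closure_minimal) (use W in \<open>auto simp: closed_def\<close>)
  hence "fun_support ?k \<inter> support F u = {}" using W(2) by (auto simp: fun_support_def)
  hence "u ?k = 0" using supports[OF linear continuous] k by (auto simp: has_support_def)
  thus ?thesis using u_add[OF g F_cmult[OF h, of "- 1"]] u_cmult[OF h, of "- 1"] by simp
qed

lemma evaluate_eq:
  assumes "g \<in> F" "agrees_near (support F u) f g"
  shows "evaluate F u f = u g"
proof -
  let ?h = "SOME g. g \<in> F \<and> agrees_near (support F u) f g"
  have "?h \<in> F \<and> agrees_near (support F u) f ?h" by (rule someI[of _ g]) (use assms in auto)
  thus ?thesis unfolding evaluate_def
    using assms by (intro u_eq_near) (auto intro: agrees_near_trans agrees_near_sym)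
qed

lemma evaluate_add:
  assumes "admissible F u f" "admissible F u f'"
  shows "evaluate F u (\<lambda>x. f x + f' x) = evaluate F u f + evaluate F u f'"
proof -
  obtain g g' where g: "g \<in> F" "agrees_near (support F u) f g" "g' \<in> F" "agrees_near (support F u) f' g'"
    using assms by (auto simp: admissible_def)
  obtain W W' where "open W" "support F u \<subseteq> W" "\<And>x. x \<in> W \<Longrightarrow> f x = g x"
    "open W'" "support F u \<subseteq> W'" "\<And>x. x \<in> W' \<Longrightarrow> f' x = g' x"
    using g by (auto simp: agrees_near_def)
  hence "agrees_near (support F u) (\<lambda>x. f x + f' x) (\<lambda>x. g x + g' x)"
    unfolding agrees_near_def by (intro exI[of _ "W \<inter> W'"]) auto
  thus ?thesis using g by (simp add: evaluate_eq[of g] evaluate_eq[of g'] evaluate_eq[OF F_add] u_add)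
qed

lemma evaluate_cmult:
  assumes "admissible F u f"
  shows "evaluate F u (\<lambda>x. c * f x) = c * evaluate F u f"
proof -
  obtain g where g: "g \<in> F" "agrees_near (support F u) f g"
    using assms by (auto simp: admissible_def)
  hence "agrees_near (support F u) (\<lambda>x. c * f x) (\<lambda>x. c * g x)"
    unfolding agrees_near_def by auto
  thus ?thesis using g by (simp add: evaluate_eq[of g] evaluate_eq[OF F_cmult] u_cmult)
qed

lemma rational_admissible:
  assumes "f \<in> rational_off (supp1 F u)" "g \<in> rational_off (supp2 F u)"
  shows "admissible F u (\<lambda>(z1, z2). f z1 * cnj (g z2))"
proof -
  obtain P1 Q1 P2 Q2 where PQ: "lp_zeros Q1 \<inter> supp1 F u = {}" "\<And>z. z \<noteq> 0 \<Longrightarrow> f z = lp P1 z / lp Q1 z"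
    "lp_zeros Q2 \<inter> supp2 F u = {}" "\<And>z. z \<noteq> 0 \<Longrightarrow> g z = lp P2 z / lp Q2 z"
    using assms by (auto simp: rational_off_def)
  show ?thesis
    by (rule admissible_cong[OF agrees_near_cstar2 rational[OF PQ(1,3), of P1 P2]]) (simp add: PQ(2,4))
qed

lemma form_of_cong:
  assumes "open V" "supp1 F u \<subseteq> V" "\<And>z. z \<in> V \<Longrightarrow> f z = f' z"
    and "open W" "supp2 F u \<subseteq> W" "\<And>z. z \<in> W \<Longrightarrow> g z = g' z"
  shows "form_of F u f g = form_of F u f' g'"
  unfolding form_of_def
proof (rule evaluate_cong)
  have "support F u \<subseteq> V \<times> W" using assms(2,5) unfolding supp1_def supp2_def
    by (auto simp: subset_iff image_iff)
  thus "agrees_near (support F u) (\<lambda>(z1, z2). f z1 * cnj (g z2)) (\<lambda>(z1, z2). f' z1 * cnj (g' z2))"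
    unfolding agrees_near_def using assms by (intro exI[of _ "V \<times> W"]) (auto intro: open_Times)
qed

lemma supp_subset: "supp1 F u \<subseteq> - {0}" "supp2 F u \<subseteq> - {0}"
  using support_subset_cstar2[of F u] by (auto simp: supp1_def supp2_def cstar2_def)

lemma form_of_sesquilinear:
  assumes "f \<in> rational_off (supp1 F u)" "g \<in> rational_off (supp2 F u)"
  shows "f' \<in> rational_off (supp1 F u) \<Longrightarrow> form_of F u (\<lambda>z. f z + f' z) g = form_of F u f g + form_of F u f' g"
    and "form_of F u (\<lambda>z. c * f z) g = c * form_of F u f g"
    and "g' \<in> rational_off (supp2 F u) \<Longrightarrow> form_of F u f (\<lambda>z. g z + g' z) = form_of F u f g + form_of F u f g'"
    and "form_of F u f (\<lambda>z. c * g z) = cnj c * form_of F u f g"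
proof -
  show "form_of F u (\<lambda>z. f z + f' z) g = form_of F u f g + form_of F u f' g" if "f' \<in> rational_off (supp1 F u)"
    using evaluate_add[OF rational_admissible[OF assms] rational_admissible[OF that assms(2)]]
    by (simp add: form_of_def case_prod_unfold distrib_right)
  show "form_of F u (\<lambda>z. c * f z) g = c * form_of F u f g"
    using evaluate_cmult[OF rational_admissible[OF assms]]
    by (simp add: form_of_def case_prod_unfold mult.assoc)
  show "form_of F u f (\<lambda>z. g z + g' z) = form_of F u f g + form_of F u f g'" if "g' \<in> rational_off (supp2 F u)"
    using evaluate_add[OF rational_admissible[OF assms] rational_admissible[OF assms(1) that]]
    by (simp add: form_of_def case_prod_unfold distrib_left)
  show "form_of F u f (\<lambda>z. c * g z) = cnj c * form_of F u f g"
    using evaluate_cmult[OF rational_admissible[OF assms]]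
    by (simp add: form_of_def case_prod_unfold mult.left_commute)
qed

text \<open>Near \<open>w0\<close> the value is \<open>u\<close> of one topologically continuous
  family of test functions, whichever representative \<open>SOME\<close> selects for each
  \<open>w\<close>.\<close>

lemma continuous_family_isCont:
  assumes "continuous_family F T u \<Phi> w0"
  shows "isCont (\<lambda>w. evaluate F u (\<Phi> w)) w0"
proof -
  obtain W G where W: "open W" "support F u \<subseteq> W"
    and ev: "\<forall>\<^sub>F w in nhds w0. G w \<in> F \<and> (\<forall>x\<in>W. G w x = \<Phi> w x)"
    and lim: "limitin T G (G w0) (at w0)"
    using assms by (auto simp: continuous_family_def)
  have ev': "\<forall>\<^sub>F w in nhds w0. u (G w) = evaluate F u (\<Phi> w)"
    using ev
  proof eventually_elim
    case (elim w)
    hence "agrees_near (support F u) (\<Phi> w) (G w)" using W by (auto simp: agrees_near_def)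
    thus ?case using elim evaluate_eq[of "G w" "\<Phi> w"] by simp
  qed
  have "limitin euclidean (u \<circ> G) (u (G w0)) (at w0)"
    using continuous_map_limit[OF continuous lim] .
  hence "((\<lambda>w. u (G w)) \<longlongrightarrow> u (G w0)) (at w0)" by (simp add: o_def)
  hence "((\<lambda>w. evaluate F u (\<Phi> w)) \<longlongrightarrow> u (G w0)) (at w0)"
    by (rule Lim_transform_eventually) (use ev' in \<open>simp add: eventually_nhds_conv_at\<close>)
  thus ?thesis using eventually_nhds_x_imp_x[OF ev'] by (simp add: isCont_def)
qed

lemma second_slot_form_of: "second_slot_form (form_of F u) (supp2 F u)"
proof
  show "closedin (top_of_set (- {0})) (supp2 F u)" by (rule closed_projections)
  fix f f' g g' :: "complex \<Rightarrow> complex" and W :: "complex set" and c :: complex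
  show "form_of F u f g = form_of F u f' g'"
    if "\<And>z. z \<noteq> 0 \<Longrightarrow> f z = f' z" "open W" "supp2 F u \<subseteq> W" "\<And>z. z \<in> W \<Longrightarrow> g z = g' z"
    by (rule form_of_cong[of "- {0}" _ _ W]) (use that supp_subset in auto)
  assume f: "f \<in> laurent_fun" and g: "g \<in> rational_off (supp2 F u)"
  note f' = rational_off_laurent[OF f]
  show "form_of F u (\<lambda>z. f z + f' z) g = form_of F u f g + form_of F u f' g" if "f' \<in> laurent_fun"
    by (rule form_of_sesquilinear(1)[OF f' g rational_off_laurent[OF that]])
  show "form_of F u (\<lambda>z. c * f z) g = c * form_of F u f g"
    by (rule form_of_sesquilinear(2)[OF f' g])
  show "form_of F u f (\<lambda>z. g z + g' z) = form_of F u f g + form_of F u f g'" if "g' \<in> rational_off (supp2 F u)"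
    by (rule form_of_sesquilinear(3)[OF f' g that])
  show "form_of F u f (\<lambda>z. c * g z) = cnj c * form_of F u f g"
    by (rule form_of_sesquilinear(4)[OF f' g])
  fix w0 :: complex assume w0: "w0 \<noteq> 0" "cnj w0 \<notin> supp2 F u"
  obtain P1 Q1 P2 Q2 where PQ: "lp_zeros Q1 \<inter> supp1 F u = {}" "\<And>z. z \<noteq> 0 \<Longrightarrow> f z = lp P1 z / lp Q1 z"
    "lp_zeros Q2 \<inter> supp2 F u = {}" "\<And>z. z \<noteq> 0 \<Longrightarrow> g z = lp P2 z / lp Q2 z"
    using f'[of "supp1 F u"] g by (auto simp: rational_off_def)
  have "form_of F u f (\<lambda>z. g z / (cnj w - z)) = evaluate F u
      (\<lambda>(z1, z2). (lp P1 z1 / lp Q1 z1) * (cnj (lp P2 z2 / lp Q2 z2) / (w - cnj z2)))" for w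
    unfolding form_of_def by (rule evaluate_cong[OF agrees_near_cstar2]) (simp add: PQ(2,4))
  thus "isCont (\<lambda>w. form_of F u f (\<lambda>z. g z / (cnj w - z))) w0"
    using continuous_family_isCont[OF cauchy2[OF PQ(1,3) w0, of P1 P2]] by simp
qed

text \<open>Conjugating after the exchange restores linearity in the first slot and antilinearity in
  the second. It is the input for part (II).\<close>

lemma second_slot_form_swapped: "second_slot_form (\<lambda>f g. cnj (form_of F u g f)) (supp1 F u)"
proof
  show "closedin (top_of_set (- {0})) (supp1 F u)" by (rule closed_projections)
  fix f f' g g' :: "complex \<Rightarrow> complex" and W :: "complex set" and c :: complex
  show "cnj (form_of F u g f) = cnj (form_of F u g' f')"
    if "\<And>z. z \<noteq> 0 \<Longrightarrow> f z = f' z" "open W" "supp1 F u \<subseteq> W" "\<And>z. z \<in> W \<Longrightarrow> g z = g' z"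
    by (subst form_of_cong[of W g g' "- {0}" f f']) (use that supp_subset in auto)
  assume f: "f \<in> laurent_fun" and g: "g \<in> rational_off (supp1 F u)"
  note f' = rational_off_laurent[OF f]
  note s = form_of_sesquilinear[OF g f']
  show "cnj (form_of F u g (\<lambda>z. f z + f' z)) = cnj (form_of F u g f) + cnj (form_of F u g f')" if "f' \<in> laurent_fun"
    using s(3)[OF rational_off_laurent[OF that]] by simp
  show "cnj (form_of F u g (\<lambda>z. c * f z)) = c * cnj (form_of F u g f)"
    using s(4) by simp
  show "cnj (form_of F u (\<lambda>z. g z + g' z) f) = cnj (form_of F u g f) + cnj (form_of F u g' f)"
    if "g' \<in> rational_off (supp1 F u)"
    using s(1)[OF that] by simp
  show "cnj (form_of F u (\<lambda>z. c * g z) f) = cnj c * cnj (form_of F u g f)"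
    using s(2) by simp
  fix w0 :: complex assume w0: "w0 \<noteq> 0" "cnj w0 \<notin> supp1 F u"
  obtain P1 Q1 P2 Q2 where PQ: "lp_zeros Q1 \<inter> supp1 F u = {}" "\<And>z. z \<noteq> 0 \<Longrightarrow> g z = lp P1 z / lp Q1 z"
    "lp_zeros Q2 \<inter> supp2 F u = {}" "\<And>z. z \<noteq> 0 \<Longrightarrow> f z = lp P2 z / lp Q2 z"
    using f'[of "supp2 F u"] g by (auto simp: rational_off_def)
  have eq: "form_of F u (\<lambda>z. g z / (w - z)) f = evaluate F u
      (\<lambda>(z1, z2). (lp P1 z1 / lp Q1 z1) / (w - z1) * cnj (lp P2 z2 / lp Q2 z2))" for w
    unfolding form_of_def by (rule evaluate_cong[OF agrees_near_cstar2]) (simp add: PQ(2,4))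
  have w0': "cnj w0 \<noteq> 0" using w0 by simp
  \<comment> \<open>\<open>cauchy1\<close> has its pole at the unconjugated \<open>w\<close>; it is
    used at \<open>cnj w0\<close> and then composed with conjugation on both sides.\<close>
  have "isCont (\<lambda>w. form_of F u (\<lambda>z. g z / (w - z)) f) (cnj w0)"
    using continuous_family_isCont[OF cauchy1[OF PQ(1,3) w0' w0(2), of P1 P2]] by (simp add: eq)
  hence "isCont (\<lambda>w. form_of F u (\<lambda>z. g z / (cnj w - z)) f) w0"
    by (rule isCont_o2[rotated]) (intro continuous_intros)
  thus "isCont (\<lambda>w. cnj (form_of F u (\<lambda>z. g z / (cnj w - z)) f)) w0"
    by (intro continuous_intros)
qed

end

theorem theorem1:
  fixes F :: "(complex \<times> complex \<Rightarrow> complex) set"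
    and T :: "(complex \<times> complex \<Rightarrow> complex) topology"
    and u :: "(complex \<times> complex \<Rightarrow> complex) \<Rightarrow> complex"
    and LG1 LG2 LC1 LC2 :: "int \<Rightarrow>\<^sub>0 complex"
    and NG NC :: nat
    and zG1 zG2 zC1 zC2 :: "(complex \<times> nat) list"
    and \<xi>1 \<xi>2 :: "nat \<Rightarrow> nat \<Rightarrow> (complex \<Rightarrow> complex) \<Rightarrow> complex"
    and \<phi>1 \<phi>2 \<phi>12_1 \<phi>12_2 \<phi>21_1 \<phi>21_2 :: "nat \<Rightarrow> complex \<Rightarrow> complex"
    and H H12 H21 :: "nat \<Rightarrow> complex"
    and C1 C2 :: "nat \<Rightarrow> complex \<Rightarrow> complex"
    and K KC1 KC2 :: "nat \<Rightarrow> complex \<Rightarrow> complex \<Rightarrow> complex"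
    and A12 A21 :: "nat \<Rightarrow> complex vec"
    and B12 B21 :: "nat \<Rightarrow> complex \<Rightarrow> complex vec"
    and \<tau>12 \<tau>21 :: "nat \<Rightarrow> complex"
  assumes "bivariate_functional F T u"
    and "prepared LG1 NG" "prepared LG2 NG" "prepared LC1 NC" "prepared LC2 NC"
    and "zeros_enum LG1 zG1" "zeros_enum LG2 zG2" "zeros_enum LC1 zC1" "zeros_enum LC2 zC2"
    and "lp_zeros LG1 \<inter> supp1 F u = {}" "lp_zeros LG2 \<inter> supp2 F u = {}"
    and "\<And>i l. i < length zG1 \<Longrightarrow> l < snd (zG1 ! i) \<Longrightarrow> laurent_functional (\<xi>1 i l)"
    and "\<And>i l. i < length zG2 \<Longrightarrow> l < snd (zG2 ! i) \<Longrightarrow> laurent_functional (\<xi>2 i l)"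
    and "quasidefinite (gram (form_of F u))"
    and "quasidefinite (gram (form12 F u LG1 zG1 \<xi>1 LC2))"
    and "quasidefinite (gram (form21 F u LG2 zG2 \<xi>2 LC1))"
    and "biorthogonal_system (form_of F u) \<phi>1 \<phi>2 H"
    and "biorthogonal_system (form12 F u LG1 zG1 \<xi>1 LC2) \<phi>12_1 \<phi>12_2 H12"
    and "biorthogonal_system (form21 F u LG2 zG2 \<xi>2 LC1) \<phi>21_1 \<phi>21_2 H21"
  defines "C1 \<equiv> second_kind1 F u \<phi>1"
    and "C2 \<equiv> second_kind2 F u \<phi>2"
  defines "K \<equiv> kernel \<phi>2 H \<phi>1"
    and "KC2 \<equiv> kernel C2 H \<phi>1"
    and "KC1 \<equiv> kernel \<phi>2 H C1"
  defines "A21 \<equiv> \<lambda>k.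
      (jet (conj_zeros zG2) (C1 k) - row_mult (masses \<xi>2 zG2 (\<phi>1 k)) (taylor_mat LG2 NG zG2))
      @\<^sub>v jet zC1 (\<phi>1 k)"
    and "A12 \<equiv> \<lambda>k.
      (jet (conj_zeros zG1) (C2 k) - row_mult (masses \<xi>1 zG1 (\<phi>2 k)) (taylor_mat LG1 NG zG1))
      @\<^sub>v jet zC2 (\<phi>2 k)"
  defines "\<tau>21 \<equiv> \<lambda>l. det_rows (map A21 [l - 2 * NG..<l + 2 * NC])"
    and "\<tau>12 \<equiv> \<lambda>l. det_rows (map A12 [l - 2 * NG..<l + 2 * NC])"
  defines "B21 \<equiv> \<lambda>l z. let m = l - 2 * NG + 1 in
      (jet (conj_zeros zG2) (\<lambda>w. KC1 m (cnj z) w)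
        - row_mult (masses \<xi>2 zG2 (\<lambda>w. K m (cnj z) w)) (taylor_mat LG2 NG zG2)
        + (1 / cnj (lp LG2 z)) \<cdot>\<^sub>v
            jet (conj_zeros zG2) (\<lambda>w. divided_diff (conj_fun (lp LG2)) (cnj z) w))
      @\<^sub>v jet zC1 (\<lambda>w. K m (cnj z) w)"
    and "B12 \<equiv> \<lambda>l z. let m = l - 2 * NG + 1 in
      (jet zG1 (\<lambda>x. KC2 m x z)
        - row_mult
            (Matrix.vec (2 * NG) (\<lambda>i. \<Sum>k<m. cnj (vec_index (masses \<xi>1 zG1 (\<phi>2 k)) i)
                * inverse (H k) * \<phi>1 k z))
            (map_mat cnj (taylor_mat LG1 NG zG1))
        + (1 / lp LG1 z) \<cdot>\<^sub>v jet zG1 (\<lambda>x. divided_diff (lp LG1) x z))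
      @\<^sub>v jet (conj_zeros zC2) (\<lambda>x. K m x z)"
  shows
    "(\<forall>l \<ge> 2 * max NG NC. \<tau>21 l \<noteq> 0 \<longrightarrow>
       (\<forall>z. z \<noteq> 0 \<and> lp LC1 z \<noteq> 0 \<longrightarrow>
          \<phi>21_1 l z = Poly_Mapping.lookup LC1 ((-1) ^ l * int NC) / lp LC1 z * (1 / \<tau>21 l) *
            det_rows (map (\<lambda>k. A21 k @\<^sub>v vec_of_list [\<phi>1 k z])
              [l - 2 * NG..<l + 2 * NC + 1])) \<and>
       H21 l = Poly_Mapping.lookup LC1 ((-1) ^ l * int NC) / cnj (Poly_Mapping.lookup LG2 ((-1) ^ l * int NG)) *
         H (l - 2 * NG) * (\<tau>21 (l + 1) / \<tau>21 l) \<and>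
       (\<forall>z. z \<noteq> 0 \<and> lp LG2 z \<noteq> 0 \<longrightarrow>
          cnj (\<phi>21_2 l z) = - (cnj (lp LG2 z) / cnj (Poly_Mapping.lookup LG2 ((-1) ^ l * int NG))) *
            (H (l - 2 * NG) / \<tau>21 l) *
            det_rows (map A21 [l - 2 * NG + 1..<l + 2 * NC] @ [B21 l z])))
     \<and>
     (\<forall>l \<ge> 2 * max NG NC. \<tau>12 l \<noteq> 0 \<longrightarrow>
       (\<forall>z. z \<noteq> 0 \<and> lp LC2 z \<noteq> 0 \<longrightarrow>
          \<phi>12_2 l z = Poly_Mapping.lookup LC2 ((-1) ^ l * int NC) / lp LC2 z * (1 / \<tau>12 l) *
            det_rows (map (\<lambda>k. A12 k @\<^sub>v vec_of_list [\<phi>2 k z])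
              [l - 2 * NG..<l + 2 * NC + 1])) \<and>
       cnj (H12 l) = Poly_Mapping.lookup LC2 ((-1) ^ l * int NC) / cnj (Poly_Mapping.lookup LG1 ((-1) ^ l * int NG)) *
         cnj (H (l - 2 * NG)) * (\<tau>12 (l + 1) / \<tau>12 l) \<and>
       (\<forall>z. z \<noteq> 0 \<and> lp LG1 z \<noteq> 0 \<longrightarrow>
          \<phi>12_1 l z = - (lp LG1 z / Poly_Mapping.lookup LG1 ((-1) ^ l * int NG)) *
            (H (l - 2 * NG) / cnj (\<tau>12 l)) *
            det_rows (map (\<lambda>k. map_vec cnj (A12 k)) [l - 2 * NG + 1..<l + 2 * NC] @ [B12 l z])))"
proof -
  interpret U: bivariate_functional F T u by fact
  interpret P21: biorthogonal_perturbation "form_of F u" "supp2 F u" LG2 LC1 NG NC zG2 zC1 \<xi>2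
    "form21 F u LG2 zG2 \<xi>2 LC1" \<phi>1 \<phi>2 \<phi>21_1 \<phi>21_2 H H21
    by (intro biorthogonal_perturbation.intro perturbation.intro perturbation_axioms.intro
        biorthogonal_perturbation_axioms.intro U.second_slot_form_of assms)
       (simp_all add: form21_def form_of_def)
  interpret P12: biorthogonal_perturbation "\<lambda>f g. cnj (form_of F u g f)" "supp1 F u" LG1 LC2 NG NC zG1 zC2 \<xi>1
    "\<lambda>f g. cnj (form12 F u LG1 zG1 \<xi>1 LC2 g f)" \<phi>2 \<phi>1 \<phi>12_2 \<phi>12_1 "\<lambda>k. cnj (H k)" "\<lambda>k. cnj (H12 k)"
    by (intro biorthogonal_perturbation.intro perturbation.intro perturbation_axioms.intro
        biorthogonal_perturbation_axioms.intro U.second_slot_form_swapped biorthogonal_system_swap assms)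
       (simp_all add: form12_def form_of_def mult_ac)
  have C1: "C1 = (\<lambda>k. P21.second_kind (\<phi>1 k))"
    by (simp add: C1_def second_kind1_def P21.second_kind_def fun_eq_iff)
  have C2: "C2 = (\<lambda>k. P12.second_kind (\<phi>2 k))"
    by (simp add: C2_def second_kind2_def P12.second_kind_def fun_eq_iff)
  have A21: "A21 = (\<lambda>k. P21.spectral_row (\<phi>1 k))"
    by (simp add: A21_def C1 P21.spectral_row_def)
  have A12: "A12 = (\<lambda>k. P12.spectral_row (\<phi>2 k))"
    by (simp add: A12_def C2 P12.spectral_row_def)
  have \<tau>21: "\<tau>21 = P21.tau"
    by (simp add: \<tau>21_def A21 P21.tau_def fun_eq_iff)
  have \<tau>12: "\<tau>12 = P12.tau"
    by (simp add: \<tau>12_def A12 P12.tau_def fun_eq_iff)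
  have B21: "B21 = P21.mixed_row"
    unfolding B21_def K_def KC1_def C1 by (intro ext) (simp only: P21.mixed_row_def)
  have B12: "B12 l z = map_vec cnj (P12.mixed_row l z)" if "lp LG1 z \<noteq> 0" for l z
    by (simp only: B12_def K_def KC2_def C2 P12.cnj_mixed_row[OF that] complex_cnj_cnj)
  have le: "2 * NG \<le> l" if "2 * max NG NC \<le> l" for l using that by simp
  show ?thesis
  proof (intro conjI allI impI; (elim conjE)?)
    fix l z assume l: "2 * max NG NC \<le> l" and \<tau>: "\<tau>21 l \<noteq> 0"
    show "\<phi>21_1 l z = Poly_Mapping.lookup LC1 ((-1) ^ l * int NC) / lp LC1 z * (1 / \<tau>21 l) *
            det_rows (map (\<lambda>k. A21 k @\<^sub>v vec_of_list [\<phi>1 k z]) [l - 2 * NG..<l + 2 * NC + 1])"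
      if "z \<noteq> 0" "lp LC1 z \<noteq> 0"
      using P21.first_polynomial[OF le[OF l] \<tau>[unfolded \<tau>21] that] unfolding A21 \<tau>21 .
    show "H21 l = Poly_Mapping.lookup LC1 ((-1) ^ l * int NC) / cnj (Poly_Mapping.lookup LG2 ((-1) ^ l * int NG)) *
         H (l - 2 * NG) * (\<tau>21 (l + 1) / \<tau>21 l)"
      using P21.norm_ratio[OF le[OF l] \<tau>[unfolded \<tau>21]] unfolding \<tau>21 .
    show "cnj (\<phi>21_2 l z) = - (cnj (lp LG2 z) / cnj (Poly_Mapping.lookup LG2 ((-1) ^ l * int NG))) *
            (H (l - 2 * NG) / \<tau>21 l) * det_rows (map A21 [l - 2 * NG + 1..<l + 2 * NC] @ [B21 l z])"
      if "z \<noteq> 0" "lp LG2 z \<noteq> 0"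
      using P21.second_polynomial[OF le[OF l] \<tau>[unfolded \<tau>21] that] unfolding A21 \<tau>21 B21 .
  next
    fix l z assume l: "2 * max NG NC \<le> l" and \<tau>: "\<tau>12 l \<noteq> 0"
    show "\<phi>12_2 l z = Poly_Mapping.lookup LC2 ((-1) ^ l * int NC) / lp LC2 z * (1 / \<tau>12 l) *
            det_rows (map (\<lambda>k. A12 k @\<^sub>v vec_of_list [\<phi>2 k z]) [l - 2 * NG..<l + 2 * NC + 1])"
      if "z \<noteq> 0" "lp LC2 z \<noteq> 0"
      using P12.first_polynomial[OF le[OF l] \<tau>[unfolded \<tau>12] that] unfolding A12 \<tau>12 .
    show "cnj (H12 l) = Poly_Mapping.lookup LC2 ((-1) ^ l * int NC) / cnj (Poly_Mapping.lookup LG1 ((-1) ^ l * int NG)) *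
         cnj (H (l - 2 * NG)) * (\<tau>12 (l + 1) / \<tau>12 l)"
      using P12.norm_ratio[OF le[OF l] \<tau>[unfolded \<tau>12]] unfolding \<tau>12 .
    show "\<phi>12_1 l z = - (lp LG1 z / Poly_Mapping.lookup LG1 ((-1) ^ l * int NG)) *
            (H (l - 2 * NG) / cnj (\<tau>12 l)) *
            det_rows (map (\<lambda>k. map_vec cnj (A12 k)) [l - 2 * NG + 1..<l + 2 * NC] @ [B12 l z])"
      if z: "z \<noteq> 0" "lp LG1 z \<noteq> 0"
    proof -
      let ?rs = "map A12 [l - 2 * NG + 1..<l + 2 * NC] @ [P12.mixed_row l z]"
      \<comment> \<open>Positivity of the band width keeps the truncated subtraction in the list
        bounds honest: the list has one row fewer than the width, and the mixed row completes
        it.\<close>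
      have "length ?rs = 2 * NG + 2 * NC"
        using le[OF l] P12.n_pos[OF le[OF l]] by (simp, arith)
      hence "det_rows (map (map_vec cnj) ?rs) = cnj (det_rows ?rs)"
        by (intro det_rows_cnj) (auto simp: A12 P12.spectral_row_carrier P12.mixed_row_carrier[OF le[OF l]])
      moreover have "map (map_vec cnj) ?rs =
          map (\<lambda>k. map_vec cnj (A12 k)) [l - 2 * NG + 1..<l + 2 * NC] @ [B12 l z]"
        by (simp add: B12[OF z(2)])
      ultimately have det: "det_rows (map (\<lambda>k. map_vec cnj (A12 k)) [l - 2 * NG + 1..<l + 2 * NC] @ [B12 l z]) =
          cnj (det_rows ?rs)" by metis
      \<comment> \<open>In the exchanged system \<open>\<phi>12_1\<close> is the second family, so
        its formula comes out conjugated; a further conjugation gives the claim.\<close>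
      have "cnj (\<phi>12_1 l z) = - (cnj (lp LG1 z) / cnj (Poly_Mapping.lookup LG1 ((-1) ^ l * int NG))) *
            (cnj (H (l - 2 * NG)) / \<tau>12 l) * det_rows ?rs"
        using P12.second_polynomial[OF le[OF l] \<tau>[unfolded \<tau>12] z] unfolding A12 \<tau>12 .
      from arg_cong[OF this, of cnj] show ?thesis unfolding det by simp
    qed
  qed
qed

end
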